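(* Let $a_1,g_1,a_2,g_2\colon\mathbb{N}\to\mathbb{C}$ be arithmetic functions such that, for some $\varepsilon>0$, $g_i(d)\ll d^{-\frac12-\varepsilon}$ for $i=1,2$, and such that $a_i(n)=\sum_{d\mid n}g_i(d)$ for all $n\in\mathbb{N}$ and $i=1,2$. Let $(X,\nu,T)$ be a uniquely ergodic topological dynamical system. Then for every continuous function $h\colon X\to\mathbb{C}$ and every $x\in X$, $$\lim_{N\to\infty}\frac1N\sum_{n\le N}a_1(n)a_2(n+1)\,h(T^{\Omega(n)}x)=\Bigg(\sum_{\substack{m,l=1\\ (m,l)=1}}^\infty\frac{g_1(m)g_2(l)}{ml}\Bigg)\Big(\int_X h\,d\nu\Big).$$
   Context: $\mathbb{N}=\{1,2,3,\dots\}$; $(m,l)$ denotes the gcd. $g(d)\ll d^{-1/2-\varepsilon}$ means there is a constant $C>0$ with $|g(d)|\le C d^{-1/2-\varepsilon}$ for all $d\ge1$. $\Omega(n)$ is the number of prime factors of $n$ counted with multiplicity. A uniquely ergodic topological dynamical system $(X,\nu,T)$ consists of a compact metric space $X$, a continuous map $T\colon X\to X$, and a $T$-invariant Borel probability measure $\nu$ on $X$ that is the only $T$-invariant Borel probability measure. *)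

theory Defs
  imports
    "HOL-Probability.Probability_Measure"
    "HOL-Computational_Algebra.Computational_Algebra"
begin

definition prime_Omega :: "nat \<Rightarrow> nat" where
  "prime_Omega n = size (prime_factorization n)"

text \<open>
  A Borel measure on a subset \<open>X\<close> of a metric space is a measure on the trace of the ambient
  Borel algebra on \<open>X\<close>, which is the Borel algebra of the subspace topology; in particular
  its space is \<open>X\<close>.
\<close>

definition invariant_prob_on ::
    "'x::metric_space set \<Rightarrow> ('x \<Rightarrow> 'x) \<Rightarrow> 'x measure \<Rightarrow> bool" where
  "invariant_prob_on X T \<mu> \<longleftrightarrow>
     prob_space \<mu> \<and> sets \<mu> = sets (restrict_space borel X) \<and> distr \<mu> \<mu> T = \<mu>"

definition uniquely_ergodic_system ::
    "'x::metric_space set \<Rightarrow> 'x measure \<Rightarrow> ('x \<Rightarrow> 'x) \<Rightarrow> bool" where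
  "uniquely_ergodic_system X \<nu> T \<longleftrightarrow>
     compact X \<and> continuous_on X T \<and> T ` X \<subseteq> X \<and>
     invariant_prob_on X T \<nu> \<and> (\<forall>\<mu>. invariant_prob_on X T \<mu> \<longrightarrow> \<mu> = \<nu>)"

end

theory Submission
  imports Defs "HOL-Number_Theory.Number_Theory" "HOL-Real_Asymp.Real_Asymp"
begin

text \<open>
  Writing \<open>a\<^sub>1(n) a\<^sub>2(n + 1)\<close> as a double sum over divisors \<open>m | n\<close>, \<open>l | n + 1\<close> and truncating at
  \<open>m, l \<le> D\<close>, where Cauchy-Schwarz and second moments of the divisor sums control the error,
  reduces the claim to the equidistribution of \<open>T\<^sup>\<Omega>\<^sup>(\<^sup>n\<^sup>) x\<close> along a residue class
  \<open>n \<equiv> c (mod l)\<close>. By compactness and unique ergodicity it is enough that for every bounded \<open>f\<close>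
  the means of \<open>f(\<Omega>(n) + 1)\<close> and of \<open>f(\<Omega>(n))\<close> over the class have the same limit.

  Let \<open>\<Phi> k c u\<close> be a limit, along a common filter of \<open>N\<close>, of the normalised sum of \<open>f(\<Omega>(n) + k)\<close> over
  \<open>n \<le> N e\<^sup>u\<close>, \<open>n \<equiv> c (mod l)\<close>. The dual Turan-Kubilius inequality gives
  \<open>\<Phi> k c u \<approx> \<Phi> (k + 1) (c / p) (u - ln p)\<close> for all primes \<open>p\<close> outside a set with convergent sum of
  reciprocals. Mertens' theorem turns this into a period of \<open>\<Phi>\<close> in \<open>u\<close>; boundedness of
  \<open>\<zeta>(\<sigma> + i t)\<close> as \<open>\<sigma> \<rightarrow> 1\<close> then makes \<open>\<Phi>\<close> constant in \<open>u\<close>, and the nonvanishing of \<open>L(1, \<psi>)\<close> removes the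
  dependence on the residue of \<open>p\<close>, leaving \<open>\<Phi> k c u = \<Phi> (k + 1) c u\<close>.
\<close>

section \<open>Cluster points and summability\<close>

text \<open>The relation at a prime \<open>p\<close> changes three things at once: the shift
  \<open>k\<close>, the residue class (by \<open>1 / p\<close>) and the cutoff (by
  \<open>ln p\<close>). Only the first change is wanted, and each relation has its own exceptional
  set of primes, depending on \<open>k\<close>, \<open>c\<close> and \<open>u\<close>. Limits along
  a filter make these sets harmless: any set of primes with divergent sum of reciprocals, on which
  the class of \<open>p\<close> and \<open>ln p\<close> modulo a period converge, turns the
  approximate relations into one exact identity. So the arithmetic input stays qualitative:
  \<open>ln p\<close> does not concentrate modulo a lattice and no nonprincipal character is
  constant at most primes. Both follow from Dirichlet series as their real variable tends to 1 from
  the right.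

  Since \<open>f\<close> is an arbitrary bounded function, it can be the indicator of the visits of
  an orbit to an arbitrary set. The limiting frequencies are therefore invariant on all sets, and a
  Borel measure is built from this finitely additive content afterwards. The exponent
  \<open>1 / 2 + \<epsilon>\<close> enters only through the second moments of divisor sums.\<close>

lemma cluster_filter:
  fixes M :: "'i \<Rightarrow> 'b \<Rightarrow> real"
  assumes F: "F \<noteq> bot" and bd: "\<And>i x. \<bar>M i x\<bar> \<le> B i"
  obtains F' \<Phi> where "F' \<le> F" "F' \<noteq> bot" "\<And>i. (M i \<longlongrightarrow> \<Phi> i) F'"
proof -
  \<comment> \<open>Tychonoff: all values lie in a compact product of intervals. The index type may
    be uncountable (real cutoffs, arbitrary sets), so a filter takes the place of a diagonal
    subsequence.\<close>
  define K where "K = PiE UNIV (\<lambda>i. {- B i..B i})"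
  define G where "G = filtermap (\<lambda>x i. M i x) F"
  have "compact K"
    using compactin_PiE[of "\<lambda>i. euclidean" UNIV "\<lambda>i. {- B i..B i}"]
    by (simp add: K_def euclidean_product_topology)
  moreover have "G \<noteq> bot" using F by (simp add: G_def filtermap_bot_iff)
  moreover have "(\<lambda>i. M i x) \<in> K" for x
    using bd[of _ x] by (simp add: K_def PiE_iff abs_le_iff) (metis minus_le_iff)
  then have "eventually (\<lambda>x. x \<in> K) G"
    by (simp add: G_def eventually_filtermap)
  ultimately obtain \<Phi> where \<Phi>: "inf (nhds \<Phi>) G \<noteq> bot"
    unfolding compact_filter by blast
  \<comment> \<open>\<open>F\<close> refined by the preimages of the neighbourhoods of
    \<open>\<Phi>\<close>. It is proper because \<open>\<Phi>\<close> is a cluster point, and along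
    it every coordinate converges by construction.\<close>
  define F' where "F' = inf F (filtercomap (\<lambda>x i. M i x) (nhds \<Phi>))"
  show thesis
  proof
    show "F' \<le> F" by (simp add: F'_def)
    show "F' \<noteq> bot"
    proof
      assume "F' = bot"
      then obtain P Q where PQ: "eventually P F" "eventually Q (nhds \<Phi>)" "\<And>x. P x \<Longrightarrow> \<not> Q (\<lambda>i. M i x)"
        unfolding F'_def trivial_limit_def eventually_inf eventually_filtercomap by blast
      have "eventually (\<lambda>\<phi>. \<not> Q \<phi>) G"
        using PQ(1) unfolding G_def eventually_filtermap by eventually_elim (use PQ(3) in auto)
      then have "eventually (\<lambda>_. False) (inf (nhds \<Phi>) G)"
        using PQ(2) unfolding eventually_inf by blast
      with \<Phi> show False by (simp add: trivial_limit_def)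
    qed
    fix i
    have lim: "filterlim (\<lambda>x i. M i x) (nhds \<Phi>) F'"
      unfolding F'_def filterlim_def filtermap_le_iff_le_filtercomap by simp
    show "(M i \<longlongrightarrow> \<Phi> i) F'"
    proof (rule topological_tendstoI)
      fix U :: "real set" assume U: "open U" "\<Phi> i \<in> U"
      have "open {\<phi>. \<forall>j\<in>{i}. \<phi> j \<in> U}"
        using product_topology_basis'[of "{i}" "\<lambda>_. U" "\<lambda>i. i"] U(1) by simp
      then have "eventually (\<lambda>\<phi>. \<phi> i \<in> U) (nhds \<Phi>)"
        using U(2) unfolding eventually_nhds by (intro exI[of _ "{\<phi>. \<forall>j\<in>{i}. \<phi> j \<in> U}"]) auto
      from eventually_compose_filterlim[OF this lim] show "eventually (\<lambda>x. M i x \<in> U) F'" .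
    qed
  qed
qed

lemma summable_on_finite_UN:
  fixes f :: "'a \<Rightarrow> real"
  assumes "finite I" "\<And>i. i \<in> I \<Longrightarrow> f summable_on A i"
  shows "f summable_on (\<Union>i\<in>I. A i)"
  using assms
proof (induction I rule: finite_induct)
  case (insert i I)
  have UN: "f summable_on (\<Union>i\<in>I. A i)" using insert by simp
  have "f summable_on ((\<Union>i\<in>I. A i) - A i)"
    by (rule summable_on_subset_banach[OF UN]) auto
  then have "f summable_on (A i \<union> ((\<Union>i\<in>I. A i) - A i))"
    using insert.prems by (intro summable_on_Un_disjoint) auto
  then show ?case by (simp add: Un_Diff_cancel)
qed auto

text \<open>Pigeonhole for divergence; it is used to fix the residue classes of primes.\<close>

lemma nonsummable_on_fiber:
  fixes w :: "'a \<Rightarrow> real"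
  assumes "\<not> w summable_on A" "g ` A \<subseteq> B" "finite B"
  obtains b where "b \<in> B" "\<not> w summable_on {x\<in>A. g x = b}"
proof -
  have eq: "(\<Union>b\<in>B. {x\<in>A. g x = b}) = A" using assms(2) by auto
  have "\<exists>b\<in>B. \<not> w summable_on {x\<in>A. g x = b}"
  proof (rule ccontr)
    assume "\<not> ?thesis"
    then have "w summable_on (\<Union>b\<in>B. {x\<in>A. g x = b})"
      by (intro summable_on_finite_UN assms(3)) auto
    with assms(1) show False unfolding eq by contradiction
  qed
  then show thesis using that by auto
qed

text \<open>If every \<open>q\<close> had a neighbourhood with a convergent part, finitely many of
  them would cover the interval. The divergent mass accumulates around \<open>q\<close>, but need
  not sit on a single level set of \<open>g\<close>.\<close>

lemma nonsummable_on_cluster: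
  fixes w :: "'a \<Rightarrow> real"
  assumes ns: "\<not> w summable_on A" and g: "\<And>x. x \<in> A \<Longrightarrow> g x \<in> {a..b::real}"
  obtains q where "q \<in> {a..b}" "\<And>e. e > 0 \<Longrightarrow> \<not> w summable_on {x\<in>A. \<bar>g x - q\<bar> < e}"
proof -
  have "\<exists>q\<in>{a..b}. \<forall>e>0. \<not> w summable_on {x\<in>A. \<bar>g x - q\<bar> < e}"
  proof (rule ccontr)
  assume "\<not> ?thesis"
  then have "\<forall>q\<in>{a..b}. \<exists>e. e > 0 \<and> w summable_on {x\<in>A. \<bar>g x - q\<bar> < e}"
    by auto
  from bchoice[OF this] obtain e
    where e: "\<forall>q\<in>{a..b}. e q > 0 \<and> w summable_on {x\<in>A. \<bar>g x - q\<bar> < e q}"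
    by blast
  have cov: "{a..b} \<subseteq> (\<Union>q\<in>{a..b}. ball q (e q))" using e by force
  obtain D where D: "D \<subseteq> {a..b}" "finite D" "{a..b} \<subseteq> (\<Union>q\<in>D. ball q (e q))"
    by (rule compactE_image[of "{a..b}" "{a..b}" "\<lambda>q. ball q (e q)"]) (use cov in auto)
  have "w summable_on (\<Union>q\<in>D. {x\<in>A. \<bar>g x - q\<bar> < e q})"
    using D e by (intro summable_on_finite_UN) auto
  moreover have "(\<Union>q\<in>D. {x\<in>A. \<bar>g x - q\<bar> < e q}) = A"
  proof (intro equalityI subsetI)
    fix x assume x: "x \<in> A"
    then obtain q where "q \<in> D" "g x \<in> ball q (e q)" using g[OF x] D(3) by blast
    with x show "x \<in> (\<Union>q\<in>D. {x\<in>A. \<bar>g x - q\<bar> < e q})"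
      by (auto simp: dist_real_def abs_minus_commute)
  qed auto
  ultimately show False using ns by simp
  qed
  then show thesis using that by auto
qed

lemma summable_on_split:
  fixes f :: "'a \<Rightarrow> real"
  assumes "f summable_on {x\<in>A. Q x}" "f summable_on {x\<in>A. \<not> Q x}"
  shows "f summable_on A"
proof -
  have "{x\<in>A. Q x} \<union> {x\<in>A. \<not> Q x} = A" by auto
  moreover have "f summable_on ({x\<in>A. Q x} \<union> {x\<in>A. \<not> Q x})"
    by (rule summable_on_Un_disjoint[OF assms]) auto
  ultimately show ?thesis by simp
qed

text \<open>By Euler's theorem this power inverts \<open>p\<close> modulo \<open>l\<close>. Being an
  explicit power, it stays in every multiplicatively closed set that contains 1 and
  \<open>p\<close>.\<close>

definition inv_mod :: "nat \<Rightarrow> nat \<Rightarrow> nat" where "inv_mod l p = p ^ (totient l - 1)"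

lemma inv_mod_cong:
  assumes "l > 0" "coprime p l"
  shows "[p * inv_mod l p = 1] (mod l)"
proof -
  have "p * inv_mod l p = p ^ totient l"
    using power_minus_mult[of "totient l" p] assms by (simp add: inv_mod_def mult.commute)
  then show ?thesis using euler_theorem[OF assms(2)] by (simp only:)
qed

lemma inv_mod_cancel:
  assumes "l > 0" "coprime p l"
  shows "[c * inv_mod l p * p = c] (mod l)" "[c * p * inv_mod l p = c] (mod l)"
  using cong_mult[OF cong_refl[of c] inv_mod_cong[OF assms]] unfolding mult_1_right
  by (simp_all only: mult.assoc mult.commute[of "inv_mod l p" p])

lemma coprime_inv_mod: "coprime p l \<Longrightarrow> coprime (inv_mod l p) l"
  by (simp add: inv_mod_def)

section \<open>Euler products and the zeta function near the line of real part 1\<close>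

lemma cmod_cis_diff_le: "cmod (cis x - cis y) \<le> \<bar>x - y\<bar>"
proof -
  have "(cmod (cis x - cis y))\<^sup>2 = 2 - 2 * cos (x - y)"
    unfolding cmod_power2 using sin_cos_squared_add[of x] sin_cos_squared_add[of y]
    by (simp add: cos_diff power2_eq_square algebra_simps)
  also have "\<dots> = (2 * sin ((x - y) / 2))\<^sup>2"
    using cos_double_sin[of "(x - y) / 2"] unfolding power_mult_distrib mult_2 field_sum_of_halves by simp
  also have "\<dots> \<le> (x - y)\<^sup>2"
    using abs_sin_x_le_abs_x[of "(x - y) / 2"] by (intro abs_le_square_iff[THEN iffD1]) (simp add: abs_mult)
  finally show ?thesis by (metis abs_le_square_iff abs_norm_cancel)
qed

lemma cmod_one_plus_le: "cmod (1 + w) \<le> exp (Re w + (cmod w)\<^sup>2 / 2)"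
proof -
  have "(cmod (1 + w))\<^sup>2 = 1 + (2 * Re w + (cmod w)\<^sup>2)"
    unfolding cmod_power2 by (simp add: power2_eq_square algebra_simps)
  also have "\<dots> \<le> exp (2 * Re w + (cmod w)\<^sup>2)" by (rule exp_ge_add_one_self)
  also have "\<dots> = (exp (Re w + (cmod w)\<^sup>2 / 2))\<^sup>2"
    using exp_double[of "Re w + (cmod w)\<^sup>2 / 2"] by (simp only: distrib_left) simp
  finally show ?thesis by (rule power2_le_imp_le) simp
qed

text \<open>The real part of \<open>log (1 - z) = - z + O(z^2)\<close>, written as bounds of norms
  so that no branch of the logarithm enters.\<close>

lemma cmod_one_minus_bounds:
  assumes z: "cmod z \<le> 1 / 2"
  shows "cmod (1 - z) \<le> exp (- Re z + 4 * (cmod z)\<^sup>2)" "exp (- Re z - 4 * (cmod z)\<^sup>2) \<le> cmod (1 - z)"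
proof -
  have "cmod (1 - z) \<le> exp (- Re z + (cmod z)\<^sup>2 / 2)" using cmod_one_plus_le[of "- z"] by simp
  also have "\<dots> \<le> exp (- Re z + 4 * (cmod z)\<^sup>2)" by simp
  finally show "cmod (1 - z) \<le> exp (- Re z + 4 * (cmod z)\<^sup>2)" .
  have ge: "cmod (1 - z) \<ge> 1 / 2" using norm_triangle_ineq2[of 1 z] z by simp
  then have nz: "1 - z \<noteq> 0" by auto
  \<comment> \<open>Chosen so that \<open>1 + w\<close> is the reciprocal of \<open>1 - z\<close>:
    the upper bound for \<open>1 + w\<close> becomes the lower bound for
    \<open>1 - z\<close>.\<close>
  define w where "w = z / (1 - z)"
  have w1: "1 + w = 1 / (1 - z)" using nz by (simp add: w_def field_simps)
  have "w = z + z\<^sup>2 / (1 - z)" using nz by (simp add: w_def field_simps power2_eq_square)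
  then have "Re w \<le> Re z + cmod (z\<^sup>2 / (1 - z))" using complex_Re_le_cmod[of "z\<^sup>2 / (1 - z)"] by simp
  also have "cmod (z\<^sup>2 / (1 - z)) \<le> (cmod z)\<^sup>2 / (1 / 2)"
    unfolding norm_divide norm_power using ge by (intro divide_left_mono) auto
  finally have Rew: "Re w \<le> Re z + 2 * (cmod z)\<^sup>2" by simp
  have "cmod w \<le> cmod z / (1 / 2)"
    unfolding w_def norm_divide using ge by (intro divide_left_mono) auto
  then have "(cmod w)\<^sup>2 \<le> (2 * cmod z)\<^sup>2" by (intro power_mono) auto
  then have w2: "(cmod w)\<^sup>2 / 2 \<le> 2 * (cmod z)\<^sup>2" by (simp add: power_mult_distrib)
  have "1 / cmod (1 - z) \<le> exp (Re w + (cmod w)\<^sup>2 / 2)"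
    using cmod_one_plus_le[of w] unfolding w1 by (simp add: norm_divide)
  also have "\<dots> \<le> exp (Re z + 4 * (cmod z)\<^sup>2)" using Rew w2 by simp
  finally have "1 \<le> exp (Re z + 4 * (cmod z)\<^sup>2) * cmod (1 - z)" using nz by (simp add: field_simps)
  then have "exp (- (Re z + 4 * (cmod z)\<^sup>2)) * 1 \<le> exp (- (Re z + 4 * (cmod z)\<^sup>2)) * (exp (Re z + 4 * (cmod z)\<^sup>2) * cmod (1 - z))"
    by (intro mult_left_mono) auto
  then show "exp (- Re z - 4 * (cmod z)\<^sup>2) \<le> cmod (1 - z)"
    by (simp add: mult.assoc[symmetric] exp_add[symmetric])
qed

text \<open>\<open>\<psi>\<close> is the complete summand, twist times power of \<open>n\<close>, so
  that the zeta function off the real axis and \<open>L\<close>-functions on it are both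
  instances.\<close>

locale completely_multiplicative =
  fixes \<psi> :: "nat \<Rightarrow> complex" and \<sigma> :: real
  assumes mult: "\<psi> (m * n) = \<psi> m * \<psi> n" and one: "\<psi> 1 = 1" and zero: "\<psi> 0 = 0"
    and sigma: "\<sigma> > 1" and bound: "cmod (\<psi> n) \<le> real n powr - \<sigma>"
begin

lemma summable_norm: "summable (\<lambda>n. cmod (\<psi> n))"
  by (rule summable_comparison_test'[of "\<lambda>n. real n powr - \<sigma>" 0])
    (use sigma bound in \<open>auto simp: summable_real_powr_iff\<close>)

lemma summable: "summable \<psi>" by (rule summable_norm_cancel[OF summable_norm])

text \<open>Sieve of Eratosthenes: as \<open>\<psi> (p * m) = \<psi> p * \<psi> m\<close>, the
  factor \<open>1 - \<psi> p\<close> removes the multiples of \<open>p\<close>.\<close>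

lemma sieve:
  assumes "finite A" "\<And>p. p \<in> A \<Longrightarrow> prime p"
  shows "(\<lambda>n. of_bool (\<forall>p\<in>A. \<not> p dvd n) * \<psi> n) sums ((\<Prod>p\<in>A. 1 - \<psi> p) * suminf \<psi>)"
  using assms
proof (induction A rule: finite_induct)
  case empty
  then show ?case using summable by (simp add: summable_sums)
next
  case (insert p A)
  define f where "f n = of_bool (\<forall>p\<in>A. \<not> p dvd n) * \<psi> n" for n
  define S where "S = (\<Prod>p\<in>A. 1 - \<psi> p) * suminf \<psi>"
  have f: "f sums S" using insert by (simp add: f_def[abs_def] S_def)
  have p: "prime p" using insert.prems by simp
  define g where "g n = of_bool (p dvd n) * f n" for n
  have "g (p * m) = \<psi> p * f m" for m
  proof -
    have "(\<forall>q\<in>A. \<not> q dvd p * m) \<longleftrightarrow> (\<forall>q\<in>A. \<not> q dvd m)"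
      using p insert.prems insert.hyps(2) by (metis insertCI prime_dvd_multD primes_dvd_imp_eq dvd_mult)
    then show ?thesis by (simp add: g_def f_def mult)
  qed
  then have "(\<lambda>m. g (p * m)) sums (\<psi> p * S)" using sums_mult[OF f, of "\<psi> p"] by simp
  moreover have "strict_mono (\<lambda>m. p * m)" using prime_gt_0_nat[OF p] by (simp add: strict_mono_def)
  moreover have "g n = 0" if "n \<notin> range (\<lambda>m. p * m)" for n using that by (auto simp: g_def elim!: dvdE)
  ultimately have "g sums (\<psi> p * S)" using sums_mono_reindex[of "\<lambda>m. p * m" g] by blast
  from sums_diff[OF f this] have "(\<lambda>n. f n - g n) sums ((1 - \<psi> p) * S)" by (simp add: algebra_simps)
  moreover have "f n - g n = of_bool (\<forall>q\<in>insert p A. \<not> q dvd n) * \<psi> n" for n by (simp add: f_def g_def)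
  ultimately show ?case using insert.hyps by (simp add: S_def mult_ac)
qed

text \<open>Sieving by the primes up to \<open>N\<close> leaves \<open>n = 1\<close> and some
  \<open>n > N\<close>, so the error is a tail of an absolutely convergent series. In the form
  product times sum, nonvanishing of the sum is a consequence and not a prerequisite.\<close>

lemma euler_product: "(\<lambda>N. (\<Prod>p | prime p \<and> p \<le> N. 1 - \<psi> p) * suminf \<psi>) \<longlonglongrightarrow> 1"
proof -
  define R where "R N = (\<Sum>n. cmod (\<psi> (n + Suc N)))" for N
  have R: "R \<longlonglongrightarrow> 0"
    using LIMSEQ_Suc[OF suminf_exist_split2[OF summable_norm]] by (simp add: R_def[abs_def])
  show ?thesis
  proof (rule Lim_transform_bound[OF _ R, THEN LIM_zero_cancel] )
    show "\<forall>\<^sub>F N in sequentially. norm ((\<Prod>p | prime p \<and> p \<le> N. 1 - \<psi> p) * suminf \<psi> - 1) \<le> norm (R N)"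
      using eventually_ge_at_top[of 1]
    proof eventually_elim
      case (elim N)
      define f where "f n = of_bool (\<forall>p\<in>{p. prime p \<and> p \<le> N}. \<not> p dvd n) * \<psi> n" for n
      have "f sums ((\<Prod>p | prime p \<and> p \<le> N. 1 - \<psi> p) * suminf \<psi>)"
        unfolding f_def by (rule sieve) auto
      then have "(\<lambda>n. f (n + Suc N)) sums ((\<Prod>p | prime p \<and> p \<le> N. 1 - \<psi> p) * suminf \<psi> - (\<Sum>n<Suc N. f n))"
        by (subst sums_iff_shift) simp
      moreover have "(\<Sum>n<Suc N. f n) = (\<Sum>n\<in>{1}. f n)"
      proof (rule sum.mono_neutral_right)
        show "\<forall>i\<in>{..<Suc N} - {1}. f i = 0"
        proof
          fix i assume i: "i \<in> {..<Suc N} - {1}"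
          show "f i = 0"
          proof (cases "i = 0")
            case False
            then obtain p where "prime p" "p dvd i" using i prime_factor_nat[of i] by auto
            moreover have "p \<le> N" using dvd_imp_le[OF \<open>p dvd i\<close>] i False by auto
            ultimately show ?thesis by (auto simp: f_def)
          qed (simp add: f_def zero)
        qed
      qed (use elim in auto)
      moreover have "f 1 = 1" using one by (auto simp: f_def)
      ultimately have s: "(\<lambda>n. f (n + Suc N)) sums ((\<Prod>p | prime p \<and> p \<le> N. 1 - \<psi> p) * suminf \<psi> - 1)" by simp
      have sn: "summable (\<lambda>n. cmod (\<psi> (n + Suc N)))" using summable_norm by (rule summable_ignore_initial_segment)
      have le: "cmod (f (n + Suc N)) \<le> cmod (\<psi> (n + Suc N))" for n by (simp add: f_def norm_mult)
      have "norm (\<Sum>n. f (n + Suc N)) \<le> R N"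
        unfolding R_def by (rule norm_suminf_le[OF le sn])
      then show ?case using s by (simp add: sums_iff)
    qed
  qed
qed

definition prime_sum :: real where "prime_sum = (\<Sum>p. of_bool (prime p) * Re (\<psi> p))"

lemma summable_prime_sum: "summable (\<lambda>p. of_bool (prime p) * Re (\<psi> p))"
  by (rule summable_comparison_test'[OF summable_norm, of 0]) (auto simp: abs_Re_le_cmod)

text \<open>The norm of the Euler product gives the logarithm up to a multiple of the sum of
  \<open>(cmod (\<psi> p))\<^sup>2\<close>. What matters is that the error constant depends neither
  on \<open>\<sigma>\<close> nor on the twist, so it survives
  \<open>\<sigma> \<rightarrow> 1\<close>.\<close>

lemma log_bound: "suminf \<psi> \<noteq> 0" "\<bar>ln (cmod (suminf \<psi>)) - prime_sum\<bar> \<le> 4 * (\<Sum>n. 1 / real n ^ 2)"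
proof -
  define L where "L = suminf \<psi>"
  define P where "P N = (\<Prod>p | prime p \<and> p \<le> N. 1 - \<psi> p)" for N :: nat
  define S where "S N = (\<Sum>p | prime p \<and> p \<le> N. Re (\<psi> p))" for N :: nat
  define E where "E = 4 * (\<Sum>n. 1 / real n ^ 2)"
  have sq: "summable (\<lambda>n. 1 / real n ^ 2)" using inverse_power_summable[of 2, where 'a = real] by (simp add: inverse_eq_divide)
  have lim: "(\<lambda>N. cmod (P N) * cmod L) \<longlonglongrightarrow> 1"
    using tendsto_norm[OF euler_product] by (simp add: P_def L_def norm_mult)
  then show L0: "suminf \<psi> \<noteq> 0" unfolding L_def[symmetric] by (auto simp: LIMSEQ_const_iff)
  have S: "S \<longlonglongrightarrow> prime_sum"
  proof -
    have "(\<lambda>N. \<Sum>p\<le>N. of_bool (prime p) * Re (\<psi> p)) \<longlonglongrightarrow> prime_sum"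
      unfolding prime_sum_def using summable_LIMSEQ'[OF summable_prime_sum] .
    moreover have "(\<Sum>p\<le>N. of_bool (prime p) * Re (\<psi> p)) = S N" for N
      unfolding S_def by (rule sum.mono_neutral_cong_right) auto
    ultimately show ?thesis by simp
  qed
  have half: "cmod (\<psi> p) \<le> 1 / 2" "(cmod (\<psi> p))\<^sup>2 \<le> 1 / real p ^ 2" if "prime p" for p
  proof -
    have p: "real p \<ge> 2" using prime_ge_2_nat[OF that] by simp
    have "cmod (\<psi> p) \<le> real p powr - \<sigma>" by (rule bound)
    also have "\<dots> \<le> real p powr - 1" using p sigma by (intro powr_mono) auto
    also have "\<dots> = 1 / p" using p by (simp add: powr_minus_divide)
    finally have 1: "cmod (\<psi> p) \<le> 1 / p" .
    also have "\<dots> \<le> 1 / 2" using p by (intro divide_left_mono) auto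
    finally show "cmod (\<psi> p) \<le> 1 / 2" .
    show "(cmod (\<psi> p))\<^sup>2 \<le> 1 / real p ^ 2" using power_mono[OF 1, of 2] by (simp add: power_divide)
  qed
  have E: "(\<Sum>p | prime p \<and> p \<le> N. 4 * (cmod (\<psi> p))\<^sup>2) \<le> E" for N
  proof -
    have "(\<Sum>p | prime p \<and> p \<le> N. 4 * (cmod (\<psi> p))\<^sup>2) \<le> (\<Sum>p | prime p \<and> p \<le> N. 4 * (1 / real p ^ 2))"
      using half(2) by (intro sum_mono mult_left_mono) auto
    also have "\<dots> \<le> (\<Sum>n. 4 * (1 / real n ^ 2))"
      using sq by (intro sum_le_suminf summable_mult) auto
    also have "\<dots> = E" unfolding E_def using sq by (rule suminf_mult)
    finally show ?thesis .
  qed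
  have upper: "cmod (P N) \<le> exp (- S N + E)" for N
  proof -
    have "cmod (P N) \<le> (\<Prod>p | prime p \<and> p \<le> N. exp (- Re (\<psi> p) + 4 * (cmod (\<psi> p))\<^sup>2))"
      unfolding P_def prod_norm[symmetric]
    proof (rule prod_mono)
      fix p assume "p \<in> {p. prime p \<and> p \<le> N}"
      then show "0 \<le> cmod (1 - \<psi> p) \<and> cmod (1 - \<psi> p) \<le> exp (- Re (\<psi> p) + 4 * (cmod (\<psi> p))\<^sup>2)"
        using cmod_one_minus_bounds(1)[OF half(1)[of p]] by simp
    qed
    also have "\<dots> = exp (- S N + (\<Sum>p | prime p \<and> p \<le> N. 4 * (cmod (\<psi> p))\<^sup>2))"
      by (simp add: S_def sum.distrib sum_negf sum_subtractf flip: exp_sum)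
    also have "\<dots> \<le> exp (- S N + E)" using E by simp
    finally show ?thesis .
  qed
  have lower: "cmod (P N) \<ge> exp (- S N - E)" for N
  proof -
    have "exp (- S N - E) \<le> exp (- S N - (\<Sum>p | prime p \<and> p \<le> N. 4 * (cmod (\<psi> p))\<^sup>2))" using E by simp
    also have "\<dots> = (\<Prod>p | prime p \<and> p \<le> N. exp (- Re (\<psi> p) - 4 * (cmod (\<psi> p))\<^sup>2))"
      by (simp add: S_def sum_subtractf sum_negf flip: exp_sum)
    also have "\<dots> \<le> cmod (P N)"
      unfolding P_def prod_norm[symmetric]
    proof (rule prod_mono)
      fix p assume "p \<in> {p. prime p \<and> p \<le> N}"
      then show "0 \<le> exp (- Re (\<psi> p) - 4 * (cmod (\<psi> p))\<^sup>2) \<and> exp (- Re (\<psi> p) - 4 * (cmod (\<psi> p))\<^sup>2) \<le> cmod (1 - \<psi> p)"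
        using cmod_one_minus_bounds(2)[OF half(1)[of p]] by simp
    qed
    finally show ?thesis .
  qed
  have L: "cmod L > 0" using L0 by (simp add: L_def)
  have "exp (- prime_sum - E) * cmod L \<le> 1"
  proof (rule LIMSEQ_le[OF _ lim])
    show "(\<lambda>N. exp (- S N - E) * cmod L) \<longlonglongrightarrow> exp (- prime_sum - E) * cmod L" by (intro tendsto_intros S)
    show "\<exists>N. \<forall>n\<ge>N. exp (- S n - E) * cmod L \<le> cmod (P n) * cmod L" using lower by (auto intro!: mult_right_mono)
  qed
  then have "ln (exp (- prime_sum - E) * cmod L) \<le> ln 1" using L by (subst ln_le_cancel_iff) auto
  then have 1: "ln (cmod L) \<le> prime_sum + E" using L by (simp add: ln_mult)
  have "1 \<le> exp (- prime_sum + E) * cmod L"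
  proof (rule LIMSEQ_le[OF lim])
    show "(\<lambda>N. exp (- S N + E) * cmod L) \<longlonglongrightarrow> exp (- prime_sum + E) * cmod L" by (intro tendsto_intros S)
    show "\<exists>N. \<forall>n\<ge>N. cmod (P n) * cmod L \<le> exp (- S n + E) * cmod L" using upper by (auto intro!: mult_right_mono)
  qed
  then have "ln 1 \<le> ln (exp (- prime_sum + E) * cmod L)" using L by (subst ln_le_cancel_iff) auto
  then have 2: "ln (cmod L) \<ge> prime_sum - E" using L by (simp add: ln_mult)
  show "\<bar>ln (cmod (suminf \<psi>)) - prime_sum\<bar> \<le> 4 * (\<Sum>n. 1 / real n ^ 2)"
    using 1 2 unfolding L_def E_def by linarith
qed

end

section \<open>Dirichlet series near 1 and sets of primes with convergent sum of reciprocals\<close>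

lemma summable_prime_powr:
  assumes "\<sigma> > 1" "\<And>p. \<bar>c p\<bar> \<le> (B::real)"
  shows "summable (\<lambda>p. of_bool (prime p) * (c p * real p powr - \<sigma>))"
proof (rule summable_comparison_test'[of "\<lambda>n. B * real n powr - \<sigma>" 0])
  show "summable (\<lambda>n. B * real n powr - \<sigma>)" using assms by (intro summable_mult) (simp add: summable_real_powr_iff)
  fix n show "norm (of_bool (prime n) * (c n * real n powr - \<sigma>)) \<le> B * real n powr - \<sigma>"
    using assms(2)[of n] by (auto simp: abs_mult intro!: mult_right_mono)
qed

text \<open>On a finite set the exponent can tend to 1 term by term, so a bound uniform in
  \<open>\<sigma>\<close> passes to all finite partial sums.\<close>

lemma summable_on_reciprocals_of_powr_bound:
  assumes \<delta>: "\<delta> > 0" and w: "\<And>p. p \<in> A \<Longrightarrow> w p \<ge> 0" and A: "\<And>p. p \<in> A \<Longrightarrow> p > 0"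
    and bd: "\<And>F \<sigma>. finite F \<Longrightarrow> F \<subseteq> A \<Longrightarrow> 1 < \<sigma> \<Longrightarrow> \<sigma> < 1 + \<delta> \<Longrightarrow> (\<Sum>p\<in>F. w p * real p powr - \<sigma>) \<le> C"
  shows "(\<lambda>p. w p / real p) summable_on A"
proof (rule nonneg_bdd_above_summable_on)
  show "bdd_above (sum (\<lambda>p. w p / real p) ` {F. F \<subseteq> A \<and> finite F})"
  proof (rule bdd_aboveI2)
    fix F assume F: "F \<in> {F. F \<subseteq> A \<and> finite F}"
    have "((\<lambda>\<sigma>. \<Sum>p\<in>F. w p * real p powr - \<sigma>) \<longlongrightarrow> (\<Sum>p\<in>F. w p * real p powr - 1)) (at_right 1)"
      using F A by (intro tendsto_intros) auto
    moreover have "\<forall>\<^sub>F \<sigma> in at_right 1. (\<Sum>p\<in>F. w p * real p powr - \<sigma>) \<le> C"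
      unfolding eventually_at_right_field using \<delta> F by (intro exI[of _ "1 + \<delta>"]) (auto intro: bd)
    ultimately have "(\<Sum>p\<in>F. w p * real p powr - 1) \<le> C"
      by (intro tendsto_upperbound[where F = "at_right (1::real)"]) auto
    moreover have "(\<Sum>p\<in>F. w p * real p powr - 1) = (\<Sum>p\<in>F. w p / real p)"
      using F A by (intro sum.cong refl) (simp add: powr_minus_divide)
    ultimately show "(\<Sum>p\<in>F. w p / real p) \<le> C" by simp
  qed
qed (use w in auto)

lemma completely_multiplicative_zeta:
  assumes "\<sigma> > 1"
  shows "completely_multiplicative (\<lambda>n. of_nat n powr - Complex \<sigma> t) \<sigma>"
    and "\<And>p. p > 0 \<Longrightarrow> Re (of_nat p powr - Complex \<sigma> t) = cos (t * ln (real p)) * real p powr - \<sigma>"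
proof -
  show "Re (of_nat p powr - Complex \<sigma> t) = cos (t * ln (real p)) * real p powr - \<sigma>" if "p > 0" for p
    using that by (simp add: powr_def Re_exp Ln_of_nat)
  show "completely_multiplicative (\<lambda>n. of_nat n powr - Complex \<sigma> t) \<sigma>"
  proof
    show "of_nat (m * n) powr - Complex \<sigma> t = of_nat m powr - Complex \<sigma> t * of_nat n powr - Complex \<sigma> t" for m n
      unfolding of_nat_mult by (intro powr_times_real) auto
    show "cmod (of_nat n powr - Complex \<sigma> t) \<le> real n powr - \<sigma>" for n
      by (cases "n = 0") (auto simp: norm_powr_real_powr)
  qed (use assms in auto)
qed

lemma zeta_prime_sum_bound:
  assumes "\<sigma> > 1"
  shows "\<bar>ln (cmod (\<Sum>n. of_nat n powr - Complex \<sigma> t)) - (\<Sum>p. of_bool (prime p) * (cos (t * ln (real p)) * real p powr - \<sigma>))\<bar>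
      \<le> 4 * (\<Sum>n. 1 / real n ^ 2)"
    and "(\<Sum>n. of_nat n powr - Complex \<sigma> t) \<noteq> 0"
proof -
  interpret completely_multiplicative "\<lambda>n. of_nat n powr - Complex \<sigma> t" \<sigma>
    by (rule completely_multiplicative_zeta(1)[OF assms])
  have "prime_sum = (\<Sum>p. of_bool (prime p) * (cos (t * ln (real p)) * real p powr - \<sigma>))"
    unfolding prime_sum_def using completely_multiplicative_zeta(2)[OF assms]
    by (intro arg_cong[of _ _ suminf] ext) (simp add: prime_gt_0_nat)
  with log_bound show "\<bar>ln (cmod (\<Sum>n. of_nat n powr - Complex \<sigma> t)) - (\<Sum>p. of_bool (prime p) * (cos (t * ln (real p)) * real p powr - \<sigma>))\<bar>
      \<le> 4 * (\<Sum>n. 1 / real n ^ 2)" "(\<Sum>n. of_nat n powr - Complex \<sigma> t) \<noteq> 0" by simp_all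
qed

definition primes_to :: "nat \<Rightarrow> nat set" where "primes_to l = {p. prime p \<and> coprime p l}"

lemma summable_of_summable_on:
  fixes w :: "nat \<Rightarrow> real"
  assumes "w summable_on A" "\<And>n. w n \<ge> 0"
  shows "summable (\<lambda>n. of_bool (n \<in> A) * w n)"
proof -
  have "(\<lambda>n. of_bool (n \<in> A) * w n) summable_on UNIV"
    by (rule summable_on_cong_neutral[THEN iffD1, OF _ _ _ assms(1)]) auto
  then show ?thesis using assms(2) by (subst (asm) summable_on_UNIV_nonneg_real_iff) auto
qed

lemma finite_primes_not_to: "(l :: nat) > 0 \<Longrightarrow> finite {p. prime p \<and> \<not> coprime p l}"
  by (rule finite_subset[OF _ finite_divisors_nat[of l]]) (auto dest: prime_imp_coprime)

text \<open>Euler's argument: convergence would bound \<open>\<zeta>(\<sigma>)\<close> uniformly for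
  \<open>1 < \<sigma> < 2\<close>, and then the harmonic series would converge.\<close>

lemma nonsummable_primes: "\<not> (\<lambda>p. 1 / real p) summable_on {p. prime p}"
proof
  assume s: "(\<lambda>p. 1 / real p) summable_on {p :: nat. prime p}"
  have sB: "summable (\<lambda>p. of_bool (p \<in> {p :: nat. prime p}) * (1 / real p))"
    by (rule summable_of_summable_on[OF s]) auto
  define B where "B = (\<Sum>p. of_bool (p \<in> {p :: nat. prime p}) * (1 / real p)) + 4 * (\<Sum>n. 1 / real n ^ 2)"
  have "(\<lambda>n. 1 / real n) summable_on {n. n > 0}"
  proof (rule summable_on_reciprocals_of_powr_bound[where w = "\<lambda>_. 1" and \<delta> = 1 and C = "exp B"])
    fix F :: "nat set" and \<sigma> :: real assume F: "finite F" "F \<subseteq> {n. n > 0}" and \<sigma>: "1 < \<sigma>" "\<sigma> < 1 + 1"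
    define Z where "Z = (\<Sum>n. of_nat n powr - Complex \<sigma> 0)"
    interpret completely_multiplicative "\<lambda>n. of_nat n powr - Complex \<sigma> 0" \<sigma>
      by (rule completely_multiplicative_zeta(1)[OF \<sigma>(1)])
    have Ren: "Re (of_nat n powr - Complex \<sigma> 0) = real n powr - \<sigma>" for n
      using completely_multiplicative_zeta(2)[OF \<sigma>(1), of n 0] by (cases "n = 0") auto
    have "(\<Sum>p. of_bool (prime p) * (cos (0 * ln (real p)) * real p powr - \<sigma>)) \<le> (\<Sum>p. of_bool (p \<in> {p :: nat. prime p}) * (1 / real p))"
    proof (rule suminf_le[OF _ summable_prime_powr[OF \<sigma>(1)] sB])
      fix p :: nat
      have "real p powr - \<sigma> \<le> real p powr - 1" if "prime p"
        using prime_ge_1_nat[OF that] \<sigma> by (intro powr_mono) auto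
      then show "of_bool (prime p) * (cos (0 * ln (real p)) * real p powr - \<sigma>) \<le> of_bool (p \<in> {p. prime p}) * (1 / real p)"
        using prime_gt_0_nat[of p] by (auto simp: powr_minus_divide)
    qed (rule abs_cos_le_one)
    then have "ln (cmod Z) \<le> B"
      using zeta_prime_sum_bound(1)[OF \<sigma>(1), of 0] unfolding Z_def B_def by linarith
    then have "exp (ln (cmod Z)) \<le> exp B" by simp
    then have Z: "cmod Z \<le> exp B"
      using zeta_prime_sum_bound(2)[OF \<sigma>(1), of 0] unfolding Z_def by (simp del: exp_le_cancel_iff)
    have sR: "summable (\<lambda>n. real n powr - \<sigma>)" using \<sigma> by (simp add: summable_real_powr_iff)
    have "(\<Sum>n\<in>F. 1 * real n powr - \<sigma>) \<le> (\<Sum>n. real n powr - \<sigma>)"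
      using F sR by (auto intro!: sum_le_suminf)
    also have "\<dots> = Re Z" unfolding Z_def using Re_suminf[OF summable] by (simp add: Ren)
    also have "\<dots> \<le> exp B" using Z complex_Re_le_cmod[of Z] by linarith
    finally show "(\<Sum>n\<in>F. 1 * real n powr - \<sigma>) \<le> exp B" .
  qed auto
  from summable_of_summable_on[OF this] have "summable (\<lambda>n. of_bool (n > 0) * (1 / real n))" by simp
  moreover have "(\<lambda>n. of_bool (n > 0) * (1 / real n)) = (\<lambda>n. inverse (of_nat n))"
    by (auto simp: fun_eq_iff inverse_eq_divide)
  ultimately show False using not_summable_harmonic[where 'a = real] by simp
qed

lemma nonsummable_primes_to:
  assumes "l > 0"
  shows "\<not> (\<lambda>p. 1 / real p) summable_on primes_to l"
proof
  assume "(\<lambda>p. 1 / real p) summable_on primes_to l"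
  then have "(\<lambda>p. 1 / real p) summable_on {p\<in>{p. prime p}. coprime p l}" by (simp add: primes_to_def)
  moreover have "(\<lambda>p. 1 / real p) summable_on {p\<in>{p. prime p}. \<not> coprime p l}"
    using finite_primes_not_to[OF assms] by simp
  ultimately have "(\<lambda>p. 1 / real p) summable_on {p. prime p}" by (rule summable_on_split)
  with nonsummable_primes show False by contradiction
qed

text \<open>If \<open>c p \<ge> \<kappa>\<close> outside a set of convergent sum of reciprocals, the
  sums of \<open>c p * p powr - \<sigma>\<close> are at least \<open>\<kappa>\<close> times the sum
  over the remaining primes, up to a constant, and hence unbounded as
  \<open>\<sigma> \<rightarrow> 1\<close>. This turns bounds for Dirichlet series near 1 into
  statements about most primes.\<close>

lemma no_bias:
  fixes c :: "nat \<Rightarrow> real"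
  assumes c: "\<And>p. \<bar>c p\<bar> \<le> 1" and \<delta>: "\<delta> > 0" and \<kappa>: "\<kappa> > 0"
    and upper: "\<And>\<sigma>. 1 < \<sigma> \<Longrightarrow> \<sigma> < 1 + \<delta> \<Longrightarrow> (\<Sum>p. of_bool (prime p) * (c p * real p powr - \<sigma>)) \<le> C"
    and bad: "(\<lambda>p. 1 / real p) summable_on {p. prime p \<and> c p < \<kappa>}"
  shows False
proof -
  define Bad where "Bad = {p. prime p \<and> c p < \<kappa>}"
  have sB: "summable (\<lambda>p. of_bool (p \<in> Bad) * (1 / real p))"
    unfolding Bad_def by (rule summable_of_summable_on[OF bad]) auto
  define B where "B = (\<Sum>p. of_bool (p \<in> Bad) * (1 / real p))"
  have "(\<lambda>p. \<kappa> / real p) summable_on {p. prime p \<and> \<not> c p < \<kappa>}"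
  proof (rule summable_on_reciprocals_of_powr_bound[OF \<delta>, where C = "C + B"])
    fix F :: "nat set" and \<sigma> :: real
    assume F: "finite F" "F \<subseteq> {p. prime p \<and> \<not> c p < \<kappa>}" and \<sigma>: "1 < \<sigma>" "\<sigma> < 1 + \<delta>"
    note sp = summable_prime_powr[OF \<sigma>(1) c]
    have "(\<lambda>p. of_bool (p \<in> F) * (\<kappa> * real p powr - \<sigma>)) sums (\<Sum>p\<in>F. \<kappa> * real p powr - \<sigma>)"
      using sums_If_finite_set[OF F(1), of "\<lambda>p. \<kappa> * real p powr - \<sigma>"]
      by (rule back_subst[of "\<lambda>f. f sums _"]) (auto simp: fun_eq_iff)
    then have "(\<Sum>p\<in>F. \<kappa> * real p powr - \<sigma>) \<le> (\<Sum>p. of_bool (prime p) * (c p * real p powr - \<sigma>) + of_bool (p \<in> Bad) * (1 / real p))"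
    proof (rule sums_le[OF _ _ summable_sums[OF summable_add[OF sp sB]], rotated])
      fix p :: nat
      show "of_bool (p \<in> F) * (\<kappa> * real p powr - \<sigma>) \<le> of_bool (prime p) * (c p * real p powr - \<sigma>) + of_bool (p \<in> Bad) * (1 / real p)"
      proof (cases "prime p")
        case True
        have "real p powr - \<sigma> \<le> real p powr - 1"
          using prime_ge_1_nat[OF True] \<sigma> by (intro powr_mono) auto
        then have le: "real p powr - \<sigma> \<le> 1 / p" using prime_gt_0_nat[OF True] by (simp add: powr_minus_divide)
        show ?thesis
        proof (cases "c p < \<kappa>")
          case bad: True
          then have "p \<notin> F" "p \<in> Bad" using F True by (auto simp: Bad_def)
          moreover have "- 1 * real p powr - \<sigma> \<le> c p * real p powr - \<sigma>"
            using c[of p] by (intro mult_right_mono) auto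
          ultimately show ?thesis using le True by simp
        next
          case False
          then have "\<kappa> * real p powr - \<sigma> \<le> c p * real p powr - \<sigma>" "p \<notin> Bad"
            by (auto simp: Bad_def intro!: mult_right_mono)
          moreover have "0 \<le> c p * real p powr - \<sigma>" using \<kappa> False by (intro mult_nonneg_nonneg) auto
          ultimately show ?thesis using True by (cases "p \<in> F") simp_all
        qed
      qed (use F in \<open>auto simp: Bad_def\<close>)
    qed
    also have "\<dots> = (\<Sum>p. of_bool (prime p) * (c p * real p powr - \<sigma>)) + B"
      unfolding B_def by (rule suminf_add[OF sp sB, symmetric])
    also have "\<dots> \<le> C + B" using upper[OF \<sigma>] by simp
    finally show "(\<Sum>p\<in>F. \<kappa> * real p powr - \<sigma>) \<le> C + B" .
  qed (use \<kappa> prime_gt_0_nat in auto)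
  from summable_on_cmult_right[OF this, of "1 / \<kappa>"]
  have "(\<lambda>p. 1 / real p) summable_on {p\<in>{p. prime p}. \<not> c p < \<kappa>}" using \<kappa> by simp
  moreover have "(\<lambda>p. 1 / real p) summable_on {p\<in>{p. prime p}. c p < \<kappa>}" using bad by simp
  ultimately have "(\<lambda>p. 1 / real p) summable_on {p. prime p}" by (rule summable_on_split[rotated])
  with nonsummable_primes show False by contradiction
qed

text \<open>First-order Euler-Maclaurin: with \<open>u\<close> an antiderivative of
  \<open>f\<close>, each \<open>f n\<close> equals \<open>u (n + 1) - u n\<close> up to
  \<open>O(1 / n^2)\<close>, and the differences telescope. The values of \<open>u\<close> are at
  most \<open>1 / \<bar>t\<bar>\<close> because \<open>1 - s\<close> has norm at least
  \<open>\<bar>t\<bar>\<close>.\<close>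

lemma zeta_bounded:
  assumes t: "t \<noteq> 0" and \<sigma>: "1 < \<sigma>" "\<sigma> < 2"
  shows "cmod (\<Sum>n. of_nat n powr - Complex \<sigma> t) \<le> 2 / \<bar>t\<bar> + (2 + \<bar>t\<bar>) * (\<Sum>n. 1 / real n ^ 2)"
proof -
  define s where "s = Complex \<sigma> t"
  interpret completely_multiplicative "\<lambda>n. of_nat n powr - Complex \<sigma> t" \<sigma>
    by (rule completely_multiplicative_zeta(1)[OF \<sigma>(1)])
  have s1: "cmod (1 - s) \<ge> \<bar>t\<bar>" using abs_Im_le_cmod[of "1 - s"] by (simp add: s_def)
  then have s1': "1 - s \<noteq> 0" using t by auto
  have s2: "cmod s \<le> 2 + \<bar>t\<bar>" using cmod_le[of s] \<sigma> by (simp add: s_def)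
  define f where "f z = z powr - s" for z :: complex
  define u where "u z = z powr (1 - s) / (1 - s)" for z :: complex
  have step: "cmod (u (of_nat (Suc n)) - u (of_nat n) - f (of_nat n)) \<le> cmod s * (1 / real n ^ 2)" if n: "n > 0" for n
  proof -
    define I where "I = closed_segment (of_nat n :: complex) (of_nat (Suc n))"
    have I: "convex I" "of_nat n \<in> I" "of_nat (Suc n) \<in> I" by (auto simp: I_def)
    have Ireal: "\<exists>x. z = of_real x \<and> real n \<le> x \<and> x \<le> real n + 1" if zI: "z \<in> I" for z
    proof -
      obtain v where v: "0 \<le> v" "v \<le> 1" "z = (1 - v) *\<^sub>R of_nat n + v *\<^sub>R of_nat (Suc n)"
        using zI by (auto simp: I_def in_segment)
      then have "z = of_real (real n + v)" by (simp add: scaleR_conv_of_real algebra_simps)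
      then show ?thesis using v by (intro exI[of _ "real n + v"]) auto
    qed
    have pos: "z \<notin> \<real>\<^sub>\<le>\<^sub>0" "z \<in> \<real>" "Re z \<ge> n" "Re z > 0" "z \<noteq> 0" if "z \<in> I" for z
      using Ireal[OF that] n by auto
    have f: "cmod (f z - f (of_nat n)) \<le> cmod s * (1 / real n ^ 2)" if z: "z \<in> I" for z
    proof -
      have "cmod (f z - f (of_nat n)) \<le> cmod s * (1 / real n ^ 2) * cmod (z - of_nat n)"
      proof (rule field_differentiable_bound[OF I(1) _ _ z I(2)])
        fix w assume w: "w \<in> I"
        show "(f has_field_derivative - s * w powr (- s - 1)) (at w within I)"
          unfolding f_def[abs_def]
          using has_field_derivative_powr[OF pos(1)[OF w], of "- s"] by (rule has_field_derivative_at_within)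
        have "cmod (w powr (- s - 1)) = Re w powr (- \<sigma> - 1)"
          using pos[OF w] by (simp add: norm_powr_real_powr s_def)
        also have "\<dots> \<le> Re w powr - 2" using pos[OF w] n \<sigma> by (intro powr_mono) auto
        also have "\<dots> \<le> real n powr - 2" using pos[OF w] n by (intro powr_mono2') auto
        also have "\<dots> = 1 / real n ^ 2" using n by (simp add: powr_minus_divide)
        finally show "cmod (- s * w powr (- s - 1)) \<le> cmod s * (1 / real n ^ 2)"
          unfolding norm_mult by (intro mult_mono) auto
      qed
      also have "\<dots> \<le> cmod s * (1 / real n ^ 2) * 1"
      proof (rule mult_left_mono)
        obtain x where x: "z = of_real x" "real n \<le> x" "x \<le> real n + 1" using Ireal[OF z] by blast
        then have "z - of_nat n = of_real (x - real n)" by simp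
        then show "cmod (z - of_nat n) \<le> 1" using x by (simp del: of_real_diff)
      qed auto
      finally show ?thesis by simp
    qed
    \<comment> \<open>Subtracting the linear function of slope \<open>f n\<close> leaves the
      derivative \<open>f w - f n\<close>, already known to be \<open>O(1 / n^2)\<close> on the
      segment.\<close>
    define g where "g z = u z - f (of_nat n) * z" for z
    have "cmod (g (of_nat (Suc n)) - g (of_nat n)) \<le> cmod s * (1 / real n ^ 2) * cmod (of_nat (Suc n) - of_nat n :: complex)"
    proof (rule field_differentiable_bound[OF I(1) _ _ I(3,2)])
      fix w assume w: "w \<in> I"
      have "((\<lambda>z. z powr (1 - s) / (1 - s)) has_field_derivative (1 - s) * w powr (1 - s - 1) / (1 - s)) (at w within I)"
        by (rule has_field_derivative_at_within[OF DERIV_cdivide[OF has_field_derivative_powr[OF pos(1)[OF w]]]])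
      then have "(u has_field_derivative f w) (at w within I)" using s1' by (simp add: u_def[abs_def] f_def)
      then show "(g has_field_derivative f w - f (of_nat n)) (at w within I)"
        unfolding g_def[abs_def] by (auto intro!: derivative_eq_intros)
      show "cmod (f w - f (of_nat n)) \<le> cmod s * (1 / real n ^ 2)" by (rule f[OF w])
    qed
    moreover have "g (of_nat (Suc n)) - g (of_nat n) = u (of_nat (Suc n)) - u (of_nat n) - f (of_nat n)"
      by (simp add: g_def algebra_simps)
    ultimately show ?thesis by simp
  qed
  have u: "cmod (u (of_nat n)) \<le> 1 / \<bar>t\<bar>" if n: "n > 0" for n
  proof -
    have "cmod (of_nat n powr (1 - s)) = real n powr (1 - \<sigma>)" using n by (simp add: norm_powr_real_powr s_def)
    also have "\<dots> \<le> real n powr 0" using n \<sigma> by (intro powr_mono) auto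
    finally have "cmod (of_nat n powr (1 - s)) \<le> 1" using n by simp
    then show ?thesis unfolding u_def norm_divide using s1 t by (intro frac_le) auto
  qed
  have sq: "summable (\<lambda>n. 1 / real n ^ 2)" using inverse_power_summable[of 2, where 'a = real] by (simp add: inverse_eq_divide)
  have bound: "cmod (\<Sum>n<N. f (of_nat n)) \<le> 2 / \<bar>t\<bar> + (2 + \<bar>t\<bar>) * (\<Sum>n. 1 / real n ^ 2)" for N
  proof (cases "N = 0")
    case True
    have "0 \<le> (\<Sum>n. 1 / real n ^ 2)" using sq by (intro suminf_nonneg) auto
    then show ?thesis using True by simp
  next
    case False
    then obtain K where K: "N = Suc K" by (cases N) auto
    have "(\<Sum>n<N. f (of_nat n)) = (\<Sum>n=1..K. f (of_nat n))"
      unfolding K by (rule sum.mono_neutral_right) (auto simp: f_def)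
    also have "\<dots> = (u (of_nat (Suc K)) - u (of_nat 1)) - (\<Sum>n=1..K. u (of_nat (Suc n)) - u (of_nat n) - f (of_nat n))"
      using sum_Suc_diff[of 1 K "\<lambda>n. u (of_nat n)"] by (simp add: sum_subtractf)
    finally have eq: "(\<Sum>n<N. f (of_nat n)) = (u (of_nat (Suc K)) - u (of_nat 1)) - (\<Sum>n=1..K. u (of_nat (Suc n)) - u (of_nat n) - f (of_nat n))" .
    have "cmod (a - b - c) \<le> cmod a + cmod b + cmod c" for a b c
      using norm_triangle_ineq4[of "a - b" c] norm_triangle_ineq4[of a b] by linarith
    then have "cmod (\<Sum>n<N. f (of_nat n)) \<le> cmod (u (of_nat (Suc K))) + cmod (u (of_nat 1))
        + cmod (\<Sum>n=1..K. u (of_nat (Suc n)) - u (of_nat n) - f (of_nat n))"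
      unfolding eq .
    moreover have "cmod (\<Sum>n=1..K. u (of_nat (Suc n)) - u (of_nat n) - f (of_nat n)) \<le> (\<Sum>n=1..K. cmod s * (1 / real n ^ 2))"
      by (intro sum_norm_le step) auto
    moreover have "(\<Sum>n=1..K. cmod s * (1 / real n ^ 2)) \<le> (2 + \<bar>t\<bar>) * (\<Sum>n. 1 / real n ^ 2)"
      unfolding sum_distrib_left[symmetric] using sq s2
      by (intro mult_mono sum_le_suminf) (auto intro!: sum_nonneg)
    moreover note u[of "Suc K"] u[of 1]
    ultimately show ?thesis by (simp del: of_nat_Suc)
  qed
  have "(\<lambda>N. cmod (\<Sum>n<N. f (of_nat n))) \<longlonglongrightarrow> cmod (\<Sum>n. of_nat n powr - Complex \<sigma> t)"
    using summable_LIMSEQ[OF summable] unfolding f_def s_def by (rule tendsto_norm)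
  then show ?thesis by (rule LIMSEQ_le_const2) (use bound in auto)
qed

text \<open>Were \<open>cis (\<tau> * ln p)\<close> close to \<open>cis \<alpha>\<close> for most
  primes, some \<open>j\<close>-th power would be close to 1, and the cosine sums for
  \<open>j * \<tau>\<close> would be biased although the zeta function is bounded near
  \<open>1 + i j \<tau>\<close>.\<close>

lemma prime_rotation:
  assumes l: "l > 0" and \<tau>: "\<tau> \<noteq> 0"
    and summable: "\<And>e. e > 0 \<Longrightarrow> (\<lambda>p. 1 / real p) summable_on {p\<in>primes_to l. \<not> cmod (cis (\<tau> * ln p) - cis \<alpha>) < e}"
  shows False
proof -
  \<comment> \<open>A multiple of \<open>\<alpha>\<close> within
    \<open>2 * pi / 16 \<le> 1 / 2\<close> of a multiple of \<open>2 * pi\<close>. Together with an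
    error \<open>1 / 4\<close> from the primes this makes \<open>3 / 4\<close>, which still leaves a
    cosine of at least \<open>1 / 4\<close>.\<close>
  obtain h k :: int where hk: "0 < k" "\<bar>of_int k * (\<alpha> / (2 * pi)) - of_int h\<bar> < 1 / real 16"
    by (rule Dirichlet_approx[of 16 "\<alpha> / (2 * pi)"]) auto
  define j where "j = nat k"
  have j: "j > 0" "of_int k = real j" using hk by (auto simp: j_def)
  have "cmod (cis (j * \<alpha>) - cis (2 * pi * of_int h)) \<le> \<bar>j * \<alpha> - 2 * pi * of_int h\<bar>" by (rule cmod_cis_diff_le)
  also have "j * \<alpha> - 2 * pi * of_int h = 2 * pi * (of_int k * (\<alpha> / (2 * pi)) - of_int h)"
    by (simp add: j(2) field_simps)
  also have "\<bar>\<dots>\<bar> \<le> 2 * pi * (1 / 16)" unfolding abs_mult using hk by (intro mult_mono) auto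
  also have "\<dots> \<le> 1 / 2" using pi_less_4 by simp
  finally have j\<alpha>: "cmod (cis (j * \<alpha>) - 1) \<le> 1 / 2" using cis_multiple_2pi[of "of_int h"] by simp
  have tj: "real j * \<tau> \<noteq> 0" using j \<tau> by simp
  define C where "C = 2 / \<bar>real j * \<tau>\<bar> + (2 + \<bar>real j * \<tau>\<bar>) * (\<Sum>n. 1 / real n ^ 2)"
  show False
  proof (rule no_bias[of "\<lambda>p. cos (real j * \<tau> * ln (real p))" 1 "1 / 4" "ln C + 4 * (\<Sum>n. 1 / real n ^ 2)"])
    fix \<sigma> :: real assume \<sigma>: "1 < \<sigma>" "\<sigma> < 1 + 1"
    have "ln (cmod (\<Sum>n. of_nat n powr - Complex \<sigma> (real j * \<tau>))) \<le> ln C"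
      using zeta_bounded[OF tj \<sigma>(1)] \<sigma> zeta_prime_sum_bound(2)[OF \<sigma>(1)] unfolding C_def by (intro ln_mono) auto
    then show "(\<Sum>p. of_bool (prime p) * (cos (real j * \<tau> * ln (real p)) * real p powr - \<sigma>)) \<le> ln C + 4 * (\<Sum>n. 1 / real n ^ 2)"
      using zeta_prime_sum_bound(1)[OF \<sigma>(1), of "real j * \<tau>"] by linarith
  next
    \<comment> \<open>A \<open>j\<close>-th power multiplies distances on the unit circle by at most
      \<open>j\<close>, hence the tolerance \<open>1 / (4 * j)\<close>.\<close>
    define A where "A = {p\<in>primes_to l. \<not> cmod (cis (\<tau> * ln p) - cis \<alpha>) < 1 / (4 * real j)}"
    have sA: "(\<lambda>p. 1 / real p) summable_on A" unfolding A_def using j by (intro summable) auto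
    have "(\<lambda>p. 1 / real p) summable_on (\<Union>i\<in>{True, False}. if i then A else {p. prime p \<and> \<not> coprime p l})"
      using sA finite_primes_not_to[OF l] by (intro summable_on_finite_UN) auto
    then show "(\<lambda>p. 1 / real p) summable_on {p. prime p \<and> cos (real j * \<tau> * ln (real p)) < 1 / 4}"
    proof (rule summable_on_subset_banach)
      show "{p. prime p \<and> cos (real j * \<tau> * ln (real p)) < 1 / 4} \<subseteq> (\<Union>i\<in>{True, False}. if i then A else {p. prime p \<and> \<not> coprime p l})"
      proof
        fix p assume p: "p \<in> {p. prime p \<and> cos (real j * \<tau> * ln (real p)) < 1 / 4}"
        have "p \<in> A" if "coprime p l"
        proof (rule ccontr)
          assume "p \<notin> A"
          then have close: "cmod (cis (\<tau> * ln p) - cis \<alpha>) < 1 / (4 * real j)"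
            using p that by (auto simp: A_def primes_to_def)
          have "cmod (cis (\<tau> * ln p) ^ j - cis \<alpha> ^ j) \<le> real j * cmod (cis (\<tau> * ln p) - cis \<alpha>)"
            by (rule norm_power_diff) auto
          also have "\<dots> \<le> real j * (1 / (4 * real j))" using close by (intro mult_left_mono) auto
          also have "\<dots> = 1 / 4" using j by simp
          finally have "cmod (cis (j * \<tau> * ln p) - cis (j * \<alpha>)) \<le> 1 / 4"
            unfolding Complex.DeMoivre by (simp add: mult.assoc)
          then have "cmod (cis (j * \<tau> * ln p) - 1) \<le> 3 / 4"
            using j\<alpha> norm_triangle_ineq[of "cis (j * \<tau> * ln p) - cis (j * \<alpha>)" "cis (j * \<alpha>) - 1"] by simp
          then have "\<bar>Re (cis (j * \<tau> * ln p) - 1)\<bar> \<le> 3 / 4" using abs_Re_le_cmod order_trans by blast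
          then show False using p by (simp add: abs_le_iff)
        qed
        then show "p \<in> (\<Union>i\<in>{True, False}. if i then A else {p. prime p \<and> \<not> coprime p l})" using p by auto
      qed
    qed
  qed auto
qed

section \<open>Mertens' theorem\<close>

lemma prod_primes_dvd:
  fixes n :: nat
  assumes "finite A" "\<And>p. p \<in> A \<Longrightarrow> prime p \<and> p dvd n"
  shows "\<Prod>A dvd n"
  using assms
proof (induction A rule: finite_induct)
  case (insert p A)
  have "coprime p (\<Prod>A)" using insert by (intro prod_coprime_right primes_coprime) auto
  then show ?case using insert by (simp add: divides_mult)
qed auto

definition theta :: "nat \<Rightarrow> real" where "theta n = (\<Sum>p | prime p \<and> p \<le> n. ln (real p))"

lemma theta_mono: "m \<le> n \<Longrightarrow> theta m \<le> theta n"
  unfolding theta_def by (intro sum_mono2) (auto dest: prime_gt_0_nat)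

text \<open>Each prime in \<open>(m, 2 m]\<close> divides the central binomial coefficient, which is
  at most \<open>2 ^ (2 * m)\<close>.\<close>

lemma theta_double: "theta (2 * m) \<le> theta m + 2 * m * ln 2"
proof -
  define A where "A = {p. prime p \<and> m < p \<and> p \<le> 2 * m}"
  have fin: "finite A" by (rule finite_subset[of _ "{..2 * m}"]) (auto simp: A_def)
  have "p dvd (2 * m choose m)" if "p \<in> A" for p
  proof -
    have p: "prime p" "m < p" "p \<le> 2 * m" using that by (auto simp: A_def)
    have "fact m * fact (2 * m - m) * (2 * m choose m) = (fact (2 * m) :: nat)"
      by (rule binomial_fact_lemma) simp
    then have "p dvd fact m * fact m * (2 * m choose m)" using p by (simp add: prime_dvd_fact_iff mult_2)
    then show ?thesis using p by (auto simp: prime_dvd_mult_iff prime_dvd_fact_iff)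
  qed
  then have "\<Prod>A dvd (2 * m choose m)" using fin by (intro prod_primes_dvd) (auto simp: A_def)
  then have "\<Prod>A \<le> (2 * m choose m)" by (intro dvd_imp_le) auto
  also have "\<dots> \<le> 2 ^ (2 * m)" using member_le_sum[of m "{..2 * m}" "\<lambda>k. 2 * m choose k"]
    by (simp add: choose_row_sum)
  finally have "real (\<Prod>A) \<le> 2 ^ (2 * m)" by (metis of_nat_le_iff of_nat_numeral of_nat_power)
  moreover have "real (\<Prod>A) > 0" using fin by (auto simp: A_def intro!: prod_pos dest: prime_gt_0_nat)
  ultimately have "ln (real (\<Prod>A)) \<le> ln (2 ^ (2 * m))" by (intro ln_mono)
  then have "(\<Sum>p\<in>A. ln (real p)) \<le> 2 * m * ln 2"
    using fin by (subst (asm) of_nat_prod, subst (asm) ln_prod) (auto simp: A_def ln_realpow dest: prime_gt_0_nat)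
  moreover have "theta (2 * m) = theta m + (\<Sum>p\<in>A. ln (real p))"
  proof -
    have "{p. prime p \<and> p \<le> 2 * m} = {p. prime p \<and> p \<le> m} \<union> A" by (auto simp: A_def)
    then show ?thesis unfolding theta_def using fin by (subst sum.union_disjoint[symmetric]) (auto simp: A_def)
  qed
  ultimately show ?thesis by simp
qed

text \<open>Chebyshev's bound by halving. One step gives \<open>3 * ln 2 * (2 * m)\<close>, and
  \<open>2 * m \<le> n + 1 \<le> 4 / 3 * n\<close> for \<open>n \<ge> 3\<close>; this is the origin
  of the constant 4.\<close>

lemma theta_bound: "theta n \<le> 4 * ln 2 * n"
proof (induction n rule: less_induct)
  case (less n)
  consider "n < 2" | "n = 2" | "n \<ge> 3" by linarith
  then show ?case
  proof cases
    case 1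
    then have "{p. prime p \<and> p \<le> n} = {}" by (auto dest: prime_ge_2_nat)
    then show ?thesis unfolding theta_def by (simp only:) simp
  next
    case 2
    have "{p::nat. prime p \<and> p \<le> 2} = {2}" by (auto dest: prime_ge_2_nat)
    then show ?thesis using 2 by (simp add: theta_def)
  next
    case 3
    define m where "m = (n + 1) div 2"
    have m: "m < n" "n \<le> 2 * m" "2 * m \<le> n + 1" using 3 by (auto simp: m_def)
    have "theta n \<le> theta m + 2 * m * ln 2" using theta_mono[OF m(2)] theta_double[of m] by simp
    also have "\<dots> \<le> 4 * ln 2 * m + 2 * m * ln 2" using less.IH[OF m(1)] by (simp add: algebra_simps)
    also have "\<dots> = 3 * ln 2 * real (2 * m)" by simp
    also have "\<dots> \<le> 3 * ln 2 * real (n + 1)" using m(3) by (intro mult_left_mono) (simp_all only: of_nat_le_iff, simp)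
    also have "\<dots> \<le> 3 * ln 2 * (4 / 3 * real n)" using 3 by (intro mult_left_mono) auto
    finally show ?thesis by (simp add: algebra_simps)
  qed
qed

lemma sum_ln_lower: "(n :: nat) > 0 \<Longrightarrow> real n * ln n - n \<le> (\<Sum>m=1..n. ln (real m))"
proof (induction n rule: nat_induct_non_zero)
  case (Suc n)
  have "real n * (ln (real (Suc n)) - ln n) \<le> 1"
  proof -
    have "ln (real (Suc n)) - ln n = ln (1 + 1 / n)" 
    proof -
      have "real (Suc n) / n = 1 + 1 / n" using Suc.hyps by (simp add: field_simps)
      then show ?thesis using ln_div[of "real (Suc n)" "real n"] Suc.hyps by simp
    qed
    also have "\<dots> \<le> 1 / n" by (rule ln_add_one_self_le_self) simp
    finally have "real n * (ln (real (Suc n)) - ln n) \<le> real n * (1 / n)" by (intro mult_left_mono) auto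
    then show ?thesis using Suc.hyps by simp
  qed
  then show ?case using Suc.IH by (simp add: algebra_simps)
qed simp

lemma sum_ln_upper: "(\<Sum>m=1..n. ln (real m)) \<le> real n * ln n"
proof -
  have "(\<Sum>m=1..n. ln (real m)) \<le> (\<Sum>m=1..n. ln (real n))" by (intro sum_mono ln_mono) auto
  then show ?thesis by simp
qed

text \<open>Legendre's formula for the exponent of \<open>p\<close> in \<open>n!\<close>: each
  \<open>m\<close> is counted once for every power of \<open>p\<close> dividing it. The range
  \<open>k \<le> n\<close> suffices because \<open>k < p ^ k\<close>.\<close>

lemma sum_multiplicity:
  fixes p n :: nat
  assumes p: "prime p"
  shows "(\<Sum>m=1..n. multiplicity p m) = (\<Sum>k=1..n. n div p ^ k)"
proof -
  have "multiplicity p m = (\<Sum>k=1..n. of_bool (p ^ k dvd m))" if m: "m \<in> {1..n}" for m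
  proof -
    have le: "multiplicity p m \<le> n"
    proof -
      have "multiplicity p m < p ^ multiplicity p m"
        using prime_gt_1_nat[OF p] by (simp add: power_gt_expt)
      also have "\<dots> \<le> m" using m by (intro dvd_imp_le multiplicity_dvd) auto
      finally show ?thesis using m by simp
    qed
    have "{1..n} \<inter> {k. p ^ k dvd m} = {1..multiplicity p m}"
    proof -
      have "p ^ k dvd m \<longleftrightarrow> k \<le> multiplicity p m" for k
        using m p not_prime_unit[of p] by (intro power_dvd_iff_le_multiplicity) auto
      then have "{1..n} \<inter> {k. p ^ k dvd m} = {1..n} \<inter> {k. k \<le> multiplicity p m}" by (simp only:)
      also have "\<dots> = {1..multiplicity p m}" using le by auto
      finally show ?thesis .
    qed
    then show ?thesis by simp
  qed
  then have "(\<Sum>m=1..n. multiplicity p m) = (\<Sum>m=1..n. \<Sum>k=1..n. of_bool (p ^ k dvd m))"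
    by (intro sum.cong refl)
  also have "\<dots> = (\<Sum>k=1..n. \<Sum>m=1..n. of_bool (p ^ k dvd m))" by (rule sum.swap)
  also have "\<dots> = (\<Sum>k=1..n. n div p ^ k)"
  proof (rule sum.cong[OF refl])
    fix k
    have pk: "p ^ k > 0" using prime_gt_0_nat[OF p] by simp
    have "{1..n} \<inter> {m. p ^ k dvd m} = (\<lambda>j. p ^ k * j) ` {1..n div p ^ k}"
    proof (intro equalityI subsetI)
      fix m assume "m \<in> {1..n} \<inter> {m. p ^ k dvd m}"
      then have m: "p ^ k dvd m" "1 \<le> m" "m \<le> n" by auto
      then obtain j where "m = p ^ k * j" by (elim dvdE)
      with m have j: "m = p ^ k * j" "1 \<le> m" "m \<le> n" by simp_all
      then have "j \<le> n div p ^ k" using pk by (simp add: less_eq_div_iff_mult_less_eq mult.commute)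
      then show "m \<in> (\<lambda>j. p ^ k * j) ` {1..n div p ^ k}" using j by (intro image_eqI[of _ _ j]) auto
    next
      fix m assume "m \<in> (\<lambda>j. p ^ k * j) ` {1..n div p ^ k}"
      then obtain j where "m = p ^ k * j" "j \<in> {1..n div p ^ k}" by blast
      then have j: "m = p ^ k * j" "1 \<le> j" "j \<le> n div p ^ k" by simp_all
      then have "m \<le> n" using pk by (simp add: less_eq_div_iff_mult_less_eq mult.commute)
      then show "m \<in> {1..n} \<inter> {m. p ^ k dvd m}" using j pk by auto
    qed
    moreover have "inj_on (\<lambda>j. p ^ k * j) {1..n div p ^ k}" using pk by (auto intro!: inj_onI)
    ultimately show "(\<Sum>m=1..n. of_bool (p ^ k dvd m)) = n div p ^ k"
      by (simp add: card_image)
  qed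
  finally show ?thesis .
qed

lemma ln_eq_sum_multiplicity:
  assumes "1 \<le> m" "m \<le> n"
  shows "ln (real m) = (\<Sum>p | prime p \<and> p \<le> n. real (multiplicity p m) * ln (real p))"
proof -
  have "m = (\<Prod>p\<in>prime_factors m. p ^ multiplicity p m)"
    using assms prime_factorization_nat[of m] by simp
  then have "ln (real m) = ln (\<Prod>p\<in>prime_factors m. real p ^ multiplicity p m)"
    by (metis (mono_tags, lifting) of_nat_power of_nat_prod prod.cong)
  also have "\<dots> = (\<Sum>p\<in>prime_factors m. ln (real p ^ multiplicity p m))"
    by (rule ln_prod) (auto dest!: in_prime_factors_imp_prime prime_gt_0_nat)
  also have "\<dots> = (\<Sum>p\<in>prime_factors m. real (multiplicity p m) * ln (real p))"
    by (intro sum.cong refl ln_realpow)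
  also have "\<dots> = (\<Sum>p | prime p \<and> p \<le> n. real (multiplicity p m) * ln (real p))"
  proof (rule sum.mono_neutral_left)
    show "prime_factors m \<subseteq> {p. prime p \<and> p \<le> n}"
      using assms by (auto simp: in_prime_factors_iff dest!: dvd_imp_le)
    show "\<forall>p\<in>{p. prime p \<and> p \<le> n} - prime_factors m. real (multiplicity p m) * ln (real p) = 0"
      using assms by (auto simp: in_prime_factors_iff not_dvd_imp_multiplicity_0)
  qed auto
  finally show ?thesis .
qed

lemma sum_ln_eq:
  fixes n :: nat
  shows "(\<Sum>m=1..n. ln (real m)) = (\<Sum>p | prime p \<and> p \<le> n. ln (real p) * (\<Sum>k=1..n. real (n div p ^ k)))"
proof -
  have "(\<Sum>m=1..n. ln (real m)) = (\<Sum>m=1..n. \<Sum>p | prime p \<and> p \<le> n. real (multiplicity p m) * ln (real p))"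
    by (rule sum.cong[OF refl], rule ln_eq_sum_multiplicity) auto
  also have "\<dots> = (\<Sum>p | prime p \<and> p \<le> n. \<Sum>m=1..n. real (multiplicity p m) * ln (real p))" by (rule sum.swap)
  also have "\<dots> = (\<Sum>p | prime p \<and> p \<le> n. ln (real p) * real (\<Sum>m=1..n. multiplicity p m))"
    by (simp add: sum_distrib_left mult.commute)
  also have "\<dots> = (\<Sum>p | prime p \<and> p \<le> n. ln (real p) * (\<Sum>k=1..n. real (n div p ^ k)))"
    by (intro sum.cong refl) (simp only: mem_Collect_eq sum_multiplicity of_nat_sum)
  finally show ?thesis .
qed

text \<open>Only \<open>k = 1\<close> is kept in Legendre's formula. Rounding \<open>n / p\<close>
  down costs at most 1 for each prime, in total \<open>theta n\<close>, which Chebyshev's bound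
  makes \<open>O(n)\<close>.\<close>

lemma mertens_upper:
  fixes n :: nat
  assumes n: "n > 0"
  shows "(\<Sum>p | prime p \<and> p \<le> n. ln (real p) / real p) \<le> ln n + 4 * ln 2"
proof -
  have "(\<Sum>p | prime p \<and> p \<le> n. ln (real p) * (n / p - 1)) \<le> (\<Sum>m=1..n. ln (real m))"
    unfolding sum_ln_eq
  proof (intro sum_mono mult_left_mono)
    fix p assume p: "p \<in> {p. prime p \<and> p \<le> n}"
    have "n / p - 1 \<le> real (n div p)" 
    proof -
      have "real (n div p) = of_int \<lfloor>real n / real p\<rfloor>" by (simp add: floor_divide_of_nat_eq)
      then show ?thesis by linarith
    qed
    also have "\<dots> \<le> (\<Sum>k=1..n. real (n div p ^ k))"
      using member_le_sum[of 1 "{1..n}" "\<lambda>k. real (n div p ^ k)"] n by simp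
    finally show "n / p - 1 \<le> (\<Sum>k=1..n. real (n div p ^ k))" .
  qed (auto dest: prime_gt_0_nat)
  also have "\<dots> \<le> n * ln n" by (rule sum_ln_upper)
  finally have "n * (\<Sum>p | prime p \<and> p \<le> n. ln (real p) / real p) - theta n \<le> n * ln n"
    by (simp add: theta_def right_diff_distrib sum_subtractf sum_distrib_left mult.commute)
  then have "n * (\<Sum>p | prime p \<and> p \<le> n. ln (real p) / real p) \<le> n * (ln n + 4 * ln 2)"
    using theta_bound[of n] by (simp add: algebra_simps)
  then show ?thesis using n by simp
qed

lemma ln_le_two_sqrt: "(x :: real) > 0 \<Longrightarrow> ln x \<le> 2 * x powr (1 / 2)"
  using ln_le_minus_one[of "x powr (1 / 2)"] by (simp add: ln_powr)

text \<open>Here all powers of \<open>p\<close> count, but those with \<open>k \<ge> 2\<close> add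
  only \<open>ln p / (p * (p - 1))\<close>, which \<open>4 * p powr - (3 / 2)\<close>
  dominates.\<close>

lemma mertens_lower:
  fixes n :: nat
  assumes n: "n > 0"
  shows "(\<Sum>p | prime p \<and> p \<le> n. ln (real p) / real p) \<ge> ln n - 1 - 4 * (\<Sum>n. real n powr - (3 / 2))"
proof -
  have sm: "summable (\<lambda>n. real n powr - (3 / 2))" by (simp add: summable_real_powr_iff)
  have "(\<Sum>m=1..n. ln (real m)) \<le> (\<Sum>p | prime p \<and> p \<le> n. n * (ln (real p) / real p + 4 * real p powr - (3 / 2)))"
    unfolding sum_ln_eq
  proof (rule sum_mono)
    fix p assume "p \<in> {p. prime p \<and> p \<le> n}"
    then have p: "real p \<ge> 2" using prime_ge_2_nat[of p] by auto
    have geo: "(\<Sum>k=1..n. (1 / real p) ^ k) \<le> 1 / (real p - 1)"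
    proof -
      have "(\<Sum>k=1..n. (1 / real p) ^ k) = (1 / p) * (\<Sum>k<n. (1 / real p) ^ k)"
        by (simp add: sum_distrib_left sum.atLeast1_atMost_eq)
      also have "\<dots> = (1 / p) * ((1 - (1 / real p) ^ n) / (1 - 1 / p))"
        using p by (subst sum_gp_strict) auto
      also have "\<dots> \<le> (1 / p) * (1 / (1 - 1 / p))"
        using p by (intro mult_left_mono divide_right_mono) auto
      also have "\<dots> = 1 / (real p - 1)" using p by (simp add: field_simps)
      finally show ?thesis .
    qed
    have "(\<Sum>k=1..n. real (n div p ^ k)) \<le> (\<Sum>k=1..n. n * (1 / real p) ^ k)"
    proof (rule sum_mono)
      fix k
      have "real (n div p ^ k) \<le> real n / real (p ^ k)"
        by (rule of_nat_div_le_of_nat)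
      then show "real (n div p ^ k) \<le> n * (1 / real p) ^ k" by (simp add: power_one_over)
    qed
    also have "\<dots> = n * (\<Sum>k=1..n. (1 / real p) ^ k)" by (simp add: sum_distrib_left)
    also have "\<dots> \<le> n * (1 / (real p - 1))" by (intro mult_left_mono geo) auto
    finally have "ln (real p) * (\<Sum>k=1..n. real (n div p ^ k)) \<le> ln (real p) * (n * (1 / (real p - 1)))"
      using p by (intro mult_left_mono) auto
    also have "\<dots> = n * (ln (real p) / real p + ln (real p) / (p * (real p - 1)))" using p by (simp add: field_simps)
    also have "\<dots> \<le> n * (ln (real p) / real p + 4 * real p powr - (3 / 2))"
    proof (intro mult_left_mono add_left_mono)
      have "ln (real p) / (p * (real p - 1)) \<le> 2 * real p powr (1 / 2) / (p * (p / 2))"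
        using p ln_le_two_sqrt[of p] by (intro frac_le mult_left_mono) auto
      also have "\<dots> = 4 * (real p powr (1 / 2) / (real p powr 2))" using p by (simp add: power2_eq_square)
      also have "\<dots> = 4 * real p powr - (3 / 2)" unfolding powr_diff[symmetric] by simp
      finally show "ln (real p) / (p * (real p - 1)) \<le> 4 * real p powr - (3 / 2)" .
    qed auto
    finally show "ln (real p) * (\<Sum>k=1..n. real (n div p ^ k)) \<le> n * (ln (real p) / real p + 4 * real p powr - (3 / 2))" .
  qed
  also have "\<dots> = n * ((\<Sum>p | prime p \<and> p \<le> n. ln (real p) / real p) + 4 * (\<Sum>p | prime p \<and> p \<le> n. real p powr - (3 / 2)))"
    by (simp add: sum.distrib flip: sum_distrib_left)
  also have "\<dots> \<le> n * ((\<Sum>p | prime p \<and> p \<le> n. ln (real p) / real p) + 4 * (\<Sum>n. real n powr - (3 / 2)))"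
    using sm by (intro mult_left_mono add_left_mono sum_le_suminf) auto
  finally have "n * (ln n - 1) \<le> n * ((\<Sum>p | prime p \<and> p \<le> n. ln (real p) / real p) + 4 * (\<Sum>n. real n powr - (3 / 2)))"
    using sum_ln_lower[OF n] by (simp add: right_diff_distrib)
  then show ?thesis using n by simp
qed

text \<open>The finitely many primes dividing \<open>l\<close> change the sum by a constant, and
  replacing the integer part by \<open>x\<close> costs at most \<open>ln 2\<close>.\<close>

lemma mertens_bound:
  assumes l: "l > 0"
  obtains C where "\<And>x. x \<ge> 1 \<Longrightarrow> \<bar>(\<Sum>p | p \<in> primes_to l \<and> real p \<le> x. ln (real p) / real p) - ln x\<bar> \<le> C"
proof -
  define G where "G = (\<Sum>p | prime p \<and> \<not> coprime p l. ln (real p) / real p)"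
  define D where "D = 4 * (\<Sum>n. real n powr - (3 / 2))"
  have "\<bar>(\<Sum>p | p \<in> primes_to l \<and> real p \<le> x. ln (real p) / real p) - ln x\<bar> \<le> 4 * ln 2 + 1 + D + G + ln 2"
    if x: "x \<ge> 1" for x
  proof -
    define n where "n = nat \<lfloor>x\<rfloor>"
    have n: "n > 0" "real n \<le> x" "x < real n + 1" using x by (auto simp: n_def le_nat_iff le_floor_iff)
    have le_iff: "real p \<le> x \<longleftrightarrow> p \<le> n" for p using x by (auto simp: n_def le_nat_iff le_floor_iff)
    have nonneg: "0 \<le> ln (real p) / real p" for p :: nat by (cases "p = 0") auto
    define Bad where "Bad = {p. prime p \<and> \<not> coprime p l \<and> p \<le> n}"
    have fin: "finite {p. prime p \<and> p \<le> n}" "finite Bad" "finite {p \<in> primes_to l. real p \<le> x}"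
      by (rule finite_subset[of _ "{..n}"]; auto simp: Bad_def le_iff)+
    have "{p. prime p \<and> p \<le> n} = {p \<in> primes_to l. real p \<le> x} \<union> Bad"
      by (auto simp: primes_to_def Bad_def le_iff)
    then have eq: "(\<Sum>p | prime p \<and> p \<le> n. ln (real p) / real p) = (\<Sum>p | p \<in> primes_to l \<and> real p \<le> x. ln (real p) / real p) + (\<Sum>p\<in>Bad. ln (real p) / real p)"
      using fin by (subst sum.union_disjoint[symmetric]) (auto simp: primes_to_def Bad_def)
    have "(\<Sum>p\<in>Bad. ln (real p) / real p) \<le> G"
      unfolding G_def using nonneg finite_primes_not_to[OF l] by (intro sum_mono2) (auto simp: Bad_def)
    moreover have "(\<Sum>p\<in>Bad. ln (real p) / real p) \<ge> 0" using nonneg by (intro sum_nonneg)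
    moreover have "ln n \<le> ln x" using n by (intro ln_mono) auto
    moreover have "ln x \<le> ln (2 * real n)" using n by (intro ln_mono) auto
    moreover have "ln (2 * real n) = ln 2 + ln n" using n by (simp add: ln_mult)
    moreover have "ln 2 \<ge> (0 :: real)" "D \<ge> 0"
      by (auto simp: D_def summable_real_powr_iff intro!: suminf_nonneg)
    ultimately show ?thesis using mertens_upper[OF n(1)] mertens_lower[OF n(1)] eq
      unfolding D_def[symmetric] abs_le_iff by linarith
  qed
  then show thesis by (rule that)
qed

section \<open>Dirichlet characters\<close>

definition dirichlet_char :: "nat \<Rightarrow> (nat \<Rightarrow> complex) \<Rightarrow> bool" where
  "dirichlet_char l \<psi> \<longleftrightarrow> (\<forall>m n. \<psi> (m * n) = \<psi> m * \<psi> n) \<and>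
     (\<forall>m n. [m = n] (mod l) \<longrightarrow> \<psi> m = \<psi> n) \<and> (\<forall>n. \<psi> n \<noteq> 0 \<longleftrightarrow> coprime n l)"

text \<open>
  For a maximal proper subgroup \<open>S\<close> containing \<open>H\<close>, the quotient is cyclic, generated by any \<open>x \<notin> S\<close>,
  so a character is obtained by sending \<open>x\<close> to a primitive root of unity of the order \<open>r\<close> of \<open>x\<close> modulo \<open>S\<close>.
\<close>
lemma separating_character:
  assumes l: "l > 0" and H: "1 \<in> H" "\<And>m n. m \<in> H \<Longrightarrow> n \<in> H \<Longrightarrow> m * n \<in> H"
    "\<And>m n. m \<in> H \<Longrightarrow> [m = n] (mod l) \<Longrightarrow> n \<in> H" "\<And>n. n \<in> H \<Longrightarrow> coprime n l"
    "\<exists>n. coprime n l \<and> n \<notin> H"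
  obtains \<psi> where "dirichlet_char l \<psi>" "\<And>h. h \<in> H \<Longrightarrow> \<psi> h = 1" "\<exists>n. coprime n l \<and> \<psi> n \<noteq> 1"
proof -
  \<comment> \<open>Proper subgroups of the units modulo \<open>l\<close> that contain
    \<open>H\<close>, represented as sets of naturals closed under congruence. The number of
    residues is bounded by \<open>l\<close>, which yields a maximal one.\<close>
  define ok where "ok S \<longleftrightarrow> H \<subseteq> S \<and> (\<forall>m\<in>S. \<forall>n\<in>S. m * n \<in> S) \<and> (\<forall>m\<in>S. \<forall>n. [m = n] (mod l) \<longrightarrow> n \<in> S)
      \<and> (\<forall>n\<in>S. coprime n l) \<and> (\<exists>n. coprime n l \<and> n \<notin> S)" for S
  have "ok H" unfolding ok_def using H by blast
  moreover have "card (S \<inter> {..<l}) < Suc l" for S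
    using card_mono[of "{..<l}" "S \<inter> {..<l}"] by simp
  ultimately obtain S where S: "ok S" and S_max: "\<And>S'. ok S' \<Longrightarrow> card (S' \<inter> {..<l}) \<le> card (S \<inter> {..<l})"
    using ex_has_greatest_nat[of ok H "\<lambda>S. card (S \<inter> {..<l})" "Suc l"] by blast
  have SH: "H \<subseteq> S" and Smult: "\<And>m n. m \<in> S \<Longrightarrow> n \<in> S \<Longrightarrow> m * n \<in> S"
    and Scong: "\<And>m n. m \<in> S \<Longrightarrow> [m = n] (mod l) \<Longrightarrow> n \<in> S" and Scop: "\<And>n. n \<in> S \<Longrightarrow> coprime n l"
    using S by (auto simp: ok_def)
  obtain x where x: "coprime x l" "x \<notin> S" using S by (auto simp: ok_def)
  have S1: "1 \<in> S" using SH H(1) by auto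
  have Spow: "s ^ k \<in> S" if "s \<in> S" for s k using that S1 Smult by (induction k) auto
  have Sinv: "inv_mod l s \<in> S" if "s \<in> S" for s unfolding inv_mod_def using that by (rule Spow)
  have Scancel: "n \<in> S" if "s * n \<in> S" "s \<in> S" for s n
  proof (rule Scong)
    show "inv_mod l s * (s * n) \<in> S" using that Sinv Smult by blast
    show "[inv_mod l s * (s * n) = n] (mod l)"
      using inv_mod_cancel(2)[OF l Scop[OF that(2)], of n] by (simp add: mult_ac)
  qed
  define r where "r = (LEAST r. r > 0 \<and> x ^ r \<in> S)"
  have "x ^ totient l \<in> S" using Scong[OF S1 cong_sym[OF euler_theorem[OF x(1)]]] .
  then have "totient l > 0 \<and> x ^ totient l \<in> S" using l by simp
  then have r: "r > 0" "x ^ r \<in> S" unfolding r_def by (metis (mono_tags, lifting) LeastI)+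
  have r_least: "r \<le> j" if "j > 0" "x ^ j \<in> S" for j unfolding r_def using that by (intro Least_le) auto
  have r_dvd: "r dvd m" if "x ^ m \<in> S" for m
  proof -
    have "x ^ m = (x ^ r) ^ (m div r) * x ^ (m mod r)" by (simp flip: power_mult power_add)
    then have "x ^ (m mod r) \<in> S" using that Scancel Spow[OF r(2)] by metis
    then have "m mod r = 0" using r_least[of "m mod r"] r(1) by (meson mod_less_divisor neq0_conv not_le)
    then show ?thesis by auto
  qed
  have r2: "r \<noteq> 1" using r(2) x(2) by auto
  have all: "\<exists>s\<in>S. \<exists>k. [n = s * x ^ k] (mod l)" if n: "coprime n l" for n
  proof -
    \<comment> \<open>The subgroup generated by \<open>S\<close> and \<open>x\<close>. It is
      strictly larger than \<open>S\<close>, so by maximality it is not proper.\<close>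
    define S' where "S' = {n. \<exists>s\<in>S. \<exists>k. [n = s * x ^ k] (mod l)}"
    have SS': "S \<subseteq> S'" unfolding S'_def by (force intro: exI[of _ 0])
    have xS': "x \<in> S'" unfolding S'_def using S1 by (force intro: bexI[of _ 1] exI[of _ 1])
    have cong': "n \<in> S'" if "m \<in> S'" "[m = n] (mod l)" for m n
      using that unfolding S'_def by (blast intro: cong_trans cong_sym)
    have "\<not> ok S'"
    proof
      assume "ok S'"
      then have "card (S' \<inter> {..<l}) \<le> card (S \<inter> {..<l})" by (rule S_max)
      then have "S \<inter> {..<l} = S' \<inter> {..<l}" using SS' by (intro card_seteq) auto
      moreover have "x mod l \<in> S' \<inter> {..<l}" using cong'[OF xS', of "x mod l"] l by (simp add: cong_def)
      ultimately have "x mod l \<in> S" by auto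
      then show False using Scong[of "x mod l" x] x(2) by (simp add: cong_def)
    qed
    moreover have "m * n \<in> S'" if mn: "m \<in> S'" "n \<in> S'" for m n
    proof -
      obtain s k s' k' where s: "s \<in> S" "[m = s * x ^ k] (mod l)" "s' \<in> S" "[n = s' * x ^ k'] (mod l)"
        using mn unfolding S'_def by blast
      have "[m * n = (s * s') * x ^ (k + k')] (mod l)"
        using cong_mult[OF s(2,4)] by (simp add: power_add mult_ac)
      then show ?thesis unfolding S'_def using Smult s by blast
    qed
    moreover have "coprime n l" if n: "n \<in> S'" for n
    proof -
      obtain s k where s: "s \<in> S" "[n = s * x ^ k] (mod l)" using n unfolding S'_def by blast
      have "coprime (s * x ^ k) l" using Scop[OF s(1)] x(1) by simp
      then show ?thesis using cong_imp_coprime[OF cong_sym[OF s(2)]] by blast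
    qed
    ultimately have "n \<in> S'" using n SH SS' cong' unfolding ok_def by blast
    then show ?thesis by (simp add: S'_def)
  qed
  define e where "e k = exp (2 * of_real pi * \<i> * of_nat k / of_nat r)" for k
  have e_add: "e (j + k) = e j * e k" for j k
    by (simp add: e_def add_divide_distrib ring_distribs flip: exp_add)
  \<comment> \<open>Two representations of one class differ by a power \<open>x ^ (k - k')\<close>
    in \<open>S\<close>, so the exponents agree modulo \<open>r\<close> and give the same root of
    unity.\<close>
  have unique: "e k = e k'" if "[s * x ^ k = s' * x ^ k'] (mod l)" "s \<in> S" "s' \<in> S" for s s' k k'
  proof -
    have le: "e k = e k'" if kk: "k' \<le> k" and c: "[s * x ^ k = s' * x ^ k'] (mod l)" and s: "s \<in> S" "s' \<in> S" for s s' k k'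
    proof -
      have "[(s * x ^ (k - k')) * x ^ k' = s' * x ^ k'] (mod l)"
        using c kk by (simp add: mult.assoc flip: power_add)
      then have "[s * x ^ (k - k') = s'] (mod l)"
        using x(1) by (subst (asm) cong_mult_rcancel_nat) auto
      then have "s * x ^ (k - k') \<in> S" using Scong s cong_sym by blast
      then have "r dvd k - k'" using r_dvd Scancel s by blast
      then have "k mod r = k' mod r" using kk by (simp add: mod_eq_dvd_iff_nat)
      then show ?thesis unfolding e_def using r(1) by (subst complex_root_unity_eq) auto
    qed
    show ?thesis using le[of k' k s s'] le[of k k' s' s] that cong_sym[OF that(1)] by (cases "k' \<le> k") auto
  qed
  define \<psi> where "\<psi> n = (if coprime n l then e (SOME k. \<exists>s\<in>S. [n = s * x ^ k] (mod l)) else 0)" for n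
  have \<psi>: "\<psi> n = e k" if "s \<in> S" "[n = s * x ^ k] (mod l)" for n s k
  proof -
    have "coprime (s * x ^ k) l" using Scop[OF that(1)] x(1) by simp
    then have n: "coprime n l" using cong_imp_coprime[OF cong_sym[OF that(2)]] by blast
    have "\<exists>k. \<exists>s\<in>S. [n = s * x ^ k] (mod l)" using that by blast
    from someI_ex[OF this] obtain s' where s': "s' \<in> S" "[n = s' * x ^ (SOME k. \<exists>s\<in>S. [n = s * x ^ k] (mod l))] (mod l)" by blast
    show ?thesis unfolding \<psi>_def using n unique[OF cong_trans[OF cong_sym[OF s'(2)] that(2)] s'(1) that(1)] by simp
  qed
  show thesis
  proof (rule that)
    show "dirichlet_char l \<psi>"
      unfolding dirichlet_char_def
    proof (intro conjI allI impI)
      fix m n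
      show "\<psi> (m * n) = \<psi> m * \<psi> n"
      proof (cases "coprime m l \<and> coprime n l")
        case True
        then obtain s k s' k' where s: "s \<in> S" "[m = s * x ^ k] (mod l)" "s' \<in> S" "[n = s' * x ^ k'] (mod l)"
          using all by metis
        have "[m * n = (s * s') * x ^ (k + k')] (mod l)"
          using cong_mult[OF s(2,4)] by (simp add: power_add mult_ac)
        from \<psi>[OF Smult[OF s(1,3)] this] show ?thesis using \<psi>[OF s(1,2)] \<psi>[OF s(3,4)] by (simp add: e_add)
      next
        case False
        then show ?thesis by (auto simp: \<psi>_def)
      qed
    next
      fix m n assume mn: "[m = n] (mod l)"
      show "\<psi> m = \<psi> n"
      proof (cases "coprime m l")
        case True
        then obtain s k where s: "s \<in> S" "[m = s * x ^ k] (mod l)" using all by metis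
        then show ?thesis using \<psi>[OF s] \<psi>[OF s(1) cong_trans[OF cong_sym[OF mn] s(2)]] by simp
      next
        case False
        then have "\<not> coprime n l" using cong_imp_coprime[OF cong_sym[OF mn]] by blast
        then show ?thesis using False by (simp add: \<psi>_def)
      qed
    next
      fix n show "(\<psi> n \<noteq> 0) = coprime n l" by (simp add: \<psi>_def e_def)
    qed
    show "\<psi> h = 1" if "h \<in> H" for h
      using \<psi>[of h h 0] that SH by (auto simp: e_def)
    have "\<psi> x = e 1" using \<psi>[OF S1, of x 1] by simp
    moreover have "e 1 \<noteq> 1"
      using complex_root_unity_eq_1[of r 1] r(1) r2 by (simp add: e_def)
    ultimately show "\<exists>n. coprime n l \<and> \<psi> n \<noteq> 1" using x(1) by auto
  qed
qed

section \<open>L-functions of nonprincipal characters on the positive real axis\<close>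

lemma sum_lessThan_add: "(\<Sum>n<l + m. f n) = (\<Sum>n<l. f n) + (\<Sum>n<m. f (l + n))"
  for f :: "nat \<Rightarrow> 'a::comm_monoid_add"
  by (induction m) (auto simp: add.assoc)

locale nonprincipal_char =
  fixes l :: nat and \<psi> :: "nat \<Rightarrow> complex"
  assumes l_pos: "l > 0" and char: "dirichlet_char l \<psi>" and nonprincipal: "\<exists>n. coprime n l \<and> \<psi> n \<noteq> 1"
begin

lemma mult: "\<psi> (m * n) = \<psi> m * \<psi> n" using char by (simp add: dirichlet_char_def)
lemma periodic: "[m = n] (mod l) \<Longrightarrow> \<psi> m = \<psi> n" using char by (simp add: dirichlet_char_def)
lemma nonzero_iff: "\<psi> n \<noteq> 0 \<longleftrightarrow> coprime n l" using char by (simp add: dirichlet_char_def)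
lemma one: "\<psi> 1 = 1" using mult[of 1 1] nonzero_iff[of 1] by simp
lemma power: "\<psi> (n ^ k) = \<psi> n ^ k" using one by (induction k) (auto simp: mult)

lemma norm_one: "coprime n l \<Longrightarrow> cmod (\<psi> n) = 1"
proof -
  assume n: "coprime n l"
  have "\<psi> n ^ totient l = 1"
    using periodic[OF euler_theorem[OF n]] one by (simp add: power)
  then have "cmod (\<psi> n) ^ totient l = 1 ^ totient l" by (metis norm_one norm_power power_one)
  then show ?thesis by (rule power_eq_imp_eq_base) (use l_pos in auto)
qed

lemma norm_le_one: "cmod (\<psi> n) \<le> 1"
  using norm_one[of n] nonzero_iff[of n] by (cases "coprime n l") auto

lemma l_gt_1: "l \<noteq> 1"
proof
  assume "l = 1"
  then have "\<psi> n = 1" for n using periodic[of n 1] one by (simp add: cong_def)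
  then show False using nonprincipal by auto
qed

lemma zero: "\<psi> 0 = 0" using nonzero_iff[of 0] l_gt_1 by auto

text \<open>Multiplication by \<open>a\<close> permutes the residues and multiplies the sum by
  \<open>\<psi> a \<noteq> 1\<close>.\<close>

lemma sum_period: "(\<Sum>n<l. \<psi> n) = 0"
proof -
  obtain a where a: "coprime a l" "\<psi> a \<noteq> 1" using nonprincipal by auto
  have inj: "inj_on (\<lambda>n. a * n mod l) {..<l}"
  proof (rule inj_onI)
    fix m n assume mn: "m \<in> {..<l}" "n \<in> {..<l}" "a * m mod l = a * n mod l"
    then have "[a * m = a * n] (mod l)" by (simp add: cong_def)
    then have "[m = n] (mod l)" using a(1) by (simp add: cong_mult_lcancel_nat)
    then show "m = n" using mn by (simp add: cong_def)
  qed
  moreover have "(\<lambda>n. a * n mod l) ` {..<l} = {..<l}"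
    by (rule endo_inj_surj[OF _ _ inj]) (use l_pos in auto)
  ultimately have "bij_betw (\<lambda>n. a * n mod l) {..<l} {..<l}" by (simp add: bij_betw_def)
  then have "(\<Sum>n<l. \<psi> n) = (\<Sum>n<l. \<psi> (a * n mod l))" by (rule sum.reindex_bij_betw[symmetric])
  also have "\<dots> = (\<Sum>n<l. \<psi> a * \<psi> n)"
    by (intro sum.cong refl) (simp add: periodic[of "a * _ mod l" "a * _"] cong_def flip: mult)
  also have "\<dots> = \<psi> a * (\<Sum>n<l. \<psi> n)" by (rule sum_distrib_left[symmetric])
  finally have "(\<Sum>n<l. \<psi> n) = \<psi> a * (\<Sum>n<l. \<psi> n)" .
  then have "(1 - \<psi> a) * (\<Sum>n<l. \<psi> n) = 0" by (simp add: left_diff_distrib)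
  then show ?thesis using a(2) by simp
qed

lemma partial_sum_bound: "cmod (\<Sum>n<N. \<psi> n) \<le> l"
proof (induction N rule: less_induct)
  case (less N)
  show ?case
  proof (cases "N < l")
    case True
    have "cmod (\<Sum>n<N. \<psi> n) \<le> real (card {..<N}) * 1" by (rule sum_norm_bound) (rule norm_le_one)
    then show ?thesis using True by simp
  next
    case False
    then have N: "N = l + (N - l)" by simp
    have "(\<Sum>n<N. \<psi> n) = (\<Sum>n<N - l. \<psi> (l + n))"
      by (subst N, subst sum_lessThan_add) (simp add: sum_period)
    also have "\<dots> = (\<Sum>n<N - l. \<psi> n)" by (intro sum.cong refl periodic) (simp add: cong_def)
    finally show ?thesis using less.IH[of "N - l"] False l_pos by simp
  qed
qed

lemma abel_summation:
  fixes b :: "nat \<Rightarrow> real"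
  assumes b: "b \<longlonglongrightarrow> 0" and var: "summable (\<lambda>n. \<bar>b n - b (Suc n)\<bar>)"
  shows "summable (\<lambda>n. \<psi> n * of_real (b n))"
    and "cmod (\<Sum>n. \<psi> n * of_real (b n)) \<le> l * (\<Sum>n. \<bar>b n - b (Suc n)\<bar>)"
proof -
  define A where "A N = (\<Sum>n<N. \<psi> n)" for N
  define c where "c n = A (Suc n) * of_real (b n - b (Suc n))" for n
  have parts: "(\<Sum>n<N. \<psi> n * of_real (b n)) = A N * of_real (b N) + (\<Sum>n<N. c n)" for N
    by (induction N) (auto simp: A_def c_def algebra_simps)
  have cn: "cmod (c n) \<le> l * \<bar>b n - b (Suc n)\<bar>" for n
    unfolding c_def norm_mult norm_of_real A_def by (intro mult_right_mono partial_sum_bound) auto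
  have sl: "summable (\<lambda>n. l * \<bar>b n - b (Suc n)\<bar>)" using var by (rule summable_mult)
  have sn: "summable (\<lambda>n. cmod (c n))" by (rule summable_comparison_test'[OF sl, of 0]) (use cn in auto)
  have "(\<lambda>N. A N * of_real (b N)) \<longlonglongrightarrow> 0"
  proof (rule Lim_null_comparison)
    show "\<forall>\<^sub>F N in sequentially. cmod (A N * of_real (b N)) \<le> l * \<bar>b N\<bar>"
      unfolding norm_mult norm_of_real A_def by (intro always_eventually allI mult_right_mono partial_sum_bound) auto
    show "(\<lambda>N. l * \<bar>b N\<bar>) \<longlonglongrightarrow> 0" using tendsto_mult_left[OF tendsto_rabs_zero[OF b]] by simp
  qed
  from tendsto_add[OF this summable_LIMSEQ[OF summable_norm_cancel[OF sn]]]
  have sums: "(\<lambda>n. \<psi> n * of_real (b n)) sums (\<Sum>n. c n)" unfolding sums_def parts by simp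
  then show "summable (\<lambda>n. \<psi> n * of_real (b n))" by (rule sums_summable)
  have "cmod (\<Sum>n. c n) \<le> (\<Sum>n. l * \<bar>b n - b (Suc n)\<bar>)" by (rule norm_suminf_le[OF cn sl])
  then show "cmod (\<Sum>n. \<psi> n * of_real (b n)) \<le> l * (\<Sum>n. \<bar>b n - b (Suc n)\<bar>)"
    using sums_unique[OF sums] suminf_mult[OF var, of "real l"] by simp
qed

lemma abel_decreasing:
  fixes b :: "nat \<Rightarrow> real"
  assumes b: "b \<longlonglongrightarrow> 0" and dec: "\<And>n. n > 0 \<Longrightarrow> b (Suc n) \<le> b n"
  shows "summable (\<lambda>n. \<psi> n * of_real (b n))" and "cmod (\<Sum>n. \<psi> n * of_real (b n)) \<le> l * b 1"
proof -
  \<comment> \<open>\<open>\<psi> 0 = 0\<close> allows \<open>b 0\<close> to be replaced by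
    \<open>b 1\<close>. This repairs the monotonicity at the start, where
    \<open>0 powr - \<sigma>\<close> has the default value 0.\<close>
  define b' where "b' n = (if n = 0 then b 1 else b n)" for n
  have eq: "\<psi> n * of_real (b n) = \<psi> n * of_real (b' n)" for n using zero by (simp add: b'_def)
  have "eventually (\<lambda>n. b n = b' n) sequentially"
    using eventually_gt_at_top[of 0] by eventually_elim (simp add: b'_def)
  with b have b'0: "b' \<longlonglongrightarrow> 0" by (rule Lim_transform_eventually)
  have "\<bar>b' n - b' (Suc n)\<bar> = b' n - b' (Suc n)" for n using dec[of n] by (simp add: b'_def)
  moreover have "(\<lambda>n. b' n - b' (Suc n)) sums (b' 0 - 0)" by (rule telescope_sums'[OF b'0])
  ultimately have s: "(\<lambda>n. \<bar>b' n - b' (Suc n)\<bar>) sums b 1" by (simp add: b'_def)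
  from abel_summation[OF b'0 sums_summable[OF s]] sums_unique[OF s]
  show "summable (\<lambda>n. \<psi> n * of_real (b n))" "cmod (\<Sum>n. \<psi> n * of_real (b n)) \<le> l * b 1"
    unfolding eq by simp_all
qed

definition L :: "real \<Rightarrow> complex" where "L \<sigma> = (\<Sum>n. \<psi> n * of_real (real n powr - \<sigma>))"

lemma powr_tendsto_0: "\<sigma> > 0 \<Longrightarrow> (\<lambda>n. real n powr - \<sigma>) \<longlonglongrightarrow> 0"
  by (intro tendsto_neg_powr filterlim_real_sequentially) auto

lemma L_summable: "\<sigma> > 0 \<Longrightarrow> summable (\<lambda>n. \<psi> n * of_real (real n powr - \<sigma>))"
  by (intro abel_decreasing powr_tendsto_0 powr_mono2') auto

lemma L_bound: "\<sigma> > 0 \<Longrightarrow> cmod (L \<sigma>) \<le> l"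
  using abel_decreasing(2)[OF powr_tendsto_0, of \<sigma>] by (force simp: L_def intro!: powr_mono2')

lemma completely_multiplicative_char:
  assumes "\<sigma> > 1"
  shows "completely_multiplicative (\<lambda>n. \<psi> n * of_real (real n powr - \<sigma>)) \<sigma>"
proof
  show "\<psi> (m * n) * of_real (real (m * n) powr - \<sigma>) = \<psi> m * of_real (real m powr - \<sigma>) * (\<psi> n * of_real (real n powr - \<sigma>))" for m n
    by (simp add: mult powr_mult)
  show "cmod (\<psi> n * of_real (real n powr - \<sigma>)) \<le> real n powr - \<sigma>" for n
    using mult_right_mono[OF norm_le_one[of n], of "real n powr - \<sigma>"] by (simp add: norm_mult)
qed (use assms one in auto)

lemma log_L:
  assumes "\<sigma> > 1"
  shows "L \<sigma> \<noteq> 0"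
    and "\<bar>ln (cmod (L \<sigma>)) - (\<Sum>p. of_bool (prime p) * (Re (\<psi> p) * real p powr - \<sigma>))\<bar> \<le> 4 * (\<Sum>n. 1 / real n ^ 2)"
proof -
  interpret completely_multiplicative "\<lambda>n. \<psi> n * of_real (real n powr - \<sigma>)" \<sigma>
    by (rule completely_multiplicative_char[OF assms])
  have "prime_sum = (\<Sum>p. of_bool (prime p) * (Re (\<psi> p) * real p powr - \<sigma>))"
    unfolding prime_sum_def by simp
  with log_bound show "L \<sigma> \<noteq> 0"
    "\<bar>ln (cmod (L \<sigma>)) - (\<Sum>p. of_bool (prime p) * (Re (\<psi> p) * real p powr - \<sigma>))\<bar> \<le> 4 * (\<Sum>n. 1 / real n ^ 2)"
    unfolding L_def by simp_all
qed

lemma prime_sum_upper: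
  assumes "\<sigma> > 1"
  shows "(\<Sum>p. of_bool (prime p) * (Re (\<psi> p) * real p powr - \<sigma>)) \<le> ln l + 4 * (\<Sum>n. 1 / real n ^ 2)"
proof -
  have "ln (cmod (L \<sigma>)) \<le> ln l" using L_bound[of \<sigma>] log_L(1)[OF assms] assms by (intro ln_mono) auto
  then show ?thesis using log_L(2)[OF assms] by linarith
qed

text \<open>Partial summation: along the integers, \<open>x powr - 1 - x powr - \<sigma>\<close> has
  total variation \<open>O(\<sigma> - 1)\<close>. The bound serves twice: to exploit a hypothetical
  zero at 1, and to keep \<open>L\<close> away from 0 near 1 once
  \<open>L 1 \<noteq> 0\<close>.\<close>

lemma L_near_1:
  assumes \<sigma>: "1 < \<sigma>"
  shows "cmod (L 1 - L \<sigma>) \<le> l * (\<Sum>n. 2 * real n powr - (3 / 2)) * (\<sigma> - 1)"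
proof -
  define f where "f x = x powr - 1 - x powr - \<sigma>" for x :: real
  have step: "\<bar>f (real n) - f (real (Suc n))\<bar> \<le> (\<sigma> - 1) * (2 * real n powr - (3 / 2))" for n
  proof (cases "n = 0")
    case False
    have "\<exists>z>real n. z < real (Suc n) \<and> f (real (Suc n)) - f (real n) = (real (Suc n) - real n) * (\<sigma> * z powr (- \<sigma> - 1) - z powr - 2)"
    proof (rule MVT2)
      fix x assume "real n \<le> x" "x \<le> real (Suc n)"
      then have "x > 0" using False by simp
      then show "(f has_real_derivative \<sigma> * x powr (- \<sigma> - 1) - x powr - 2) (at x)"
        unfolding f_def[abs_def]
        using DERIV_diff[OF has_real_derivative_powr[of x "- 1"] has_real_derivative_powr[of x "- \<sigma>"]] by simp
    qed simp
    then obtain z where z: "real n < z" "f (real (Suc n)) - f (real n) = \<sigma> * z powr (- \<sigma> - 1) - z powr - 2" by auto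
    have z1: "z \<ge> 1" "z > 0" using z False by simp_all
    \<comment> \<open>The derivative becomes \<open>z powr - 2\<close> times a difference of two
      small terms, \<open>(\<sigma> - 1) * y\<close> and
      \<open>1 - y \<le> (\<sigma> - 1) * ln z\<close>. Half a power of \<open>z\<close> then
      absorbs the logarithm.\<close>
    define y where "y = z powr (1 - \<sigma>)"
    have "z powr (- \<sigma> - 1) = z powr - 2 * y" unfolding y_def powr_add[symmetric] by (rule arg_cong) simp
    then have eq: "\<sigma> * z powr (- \<sigma> - 1) - z powr - 2 = z powr - 2 * ((\<sigma> - 1) * y - (1 - y))" by (simp add: algebra_simps)
    have y: "0 \<le> y" "y \<le> 1" unfolding y_def using z1 \<sigma> powr_mono[of "1 - \<sigma>" 0 z] by auto
    have "1 + (1 - \<sigma>) * ln z \<le> y" unfolding y_def using z1 by (simp add: powr_def)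
    then have "\<bar>(\<sigma> - 1) * y - (1 - y)\<bar> \<le> (\<sigma> - 1) * 1 + (\<sigma> - 1) * ln z"
      using y \<sigma> mult_left_mono[OF y(2), of "\<sigma> - 1"] mult_nonneg_nonneg[of "\<sigma> - 1" y]
      by (auto simp: abs_le_iff algebra_simps)
    also have "\<dots> = (\<sigma> - 1) * (1 + ln z)" by (simp add: algebra_simps)
    also have "\<dots> \<le> (\<sigma> - 1) * (2 * z powr (1 / 2))"
    proof (rule mult_left_mono)
      have "ln (z powr (1 / 2)) \<le> z powr (1 / 2) - 1" using z1 by (intro ln_le_minus_one) auto
      then show "1 + ln z \<le> 2 * z powr (1 / 2)" using z1 by (simp add: ln_powr)
    qed (use \<sigma> in auto)
    finally have "\<bar>\<sigma> * z powr (- \<sigma> - 1) - z powr - 2\<bar> \<le> z powr - 2 * ((\<sigma> - 1) * (2 * z powr (1 / 2)))"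
      unfolding eq abs_mult by (intro mult_mono) auto
    also have "\<dots> = (\<sigma> - 1) * (2 * (z powr - 2 * z powr (1 / 2)))" by simp
    also have "z powr - 2 * z powr (1 / 2) = z powr - (3 / 2)" unfolding powr_add[symmetric] by simp
    also have "(\<sigma> - 1) * (2 * z powr - (3 / 2)) \<le> (\<sigma> - 1) * (2 * real n powr - (3 / 2))"
      using z False \<sigma> by (intro mult_left_mono powr_mono2') auto
    finally show ?thesis using z(2) by (simp add: abs_minus_commute)
  qed (simp add: f_def)
  have s32: "summable (\<lambda>n. 2 * real n powr - (3 / 2))" by (intro summable_mult) (simp add: summable_real_powr_iff)
  note s = summable_mult[OF s32, of "\<sigma> - 1"]
  have var: "summable (\<lambda>n. \<bar>f (real n) - f (real (Suc n))\<bar>)"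
    by (rule summable_comparison_test'[OF s, of 0]) (use step in auto)
  have f0: "(\<lambda>n. f (real n)) \<longlonglongrightarrow> 0"
    unfolding f_def using tendsto_diff[OF powr_tendsto_0[of 1] powr_tendsto_0[of \<sigma>]] \<sigma> by simp
  have "L 1 - L \<sigma> = (\<Sum>n. \<psi> n * of_real (f (real n)))"
    unfolding L_def using suminf_diff[OF L_summable[of 1] L_summable[of \<sigma>]] \<sigma>
    by (simp add: f_def right_diff_distrib)
  also have "cmod \<dots> \<le> l * (\<Sum>n. \<bar>f (real n) - f (real (Suc n))\<bar>)" by (rule abel_summation(2)[OF f0 var])
  also have "\<dots> \<le> l * (\<Sum>n. (\<sigma> - 1) * (2 * real n powr - (3 / 2)))"
    by (intro mult_left_mono suminf_le step var s) auto
  also have "\<dots> = l * (\<Sum>n. 2 * real n powr - (3 / 2)) * (\<sigma> - 1)" using suminf_mult[OF s32, of "\<sigma> - 1"] by simp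
  finally show ?thesis .
qed

text \<open>
  As \<open>L 1 = 0\<close>, a multiple of \<open>1 / n\<close> may be subtracted from the Lambert coefficients \<open>t\<^sup>n / (1 - t\<^sup>n)\<close>; the
  differences are monotone in \<open>n\<close>, so partial summation bounds the series uniformly in \<open>t\<close> (Monsky).
\<close>
lemma lambert_bound:
  assumes t: "0 < s" "s < 1" "t = s ^ 2" and L1: "L 1 = 0"
  shows "summable (\<lambda>n. \<psi> n * of_real (t ^ n / (1 - t ^ n)))" "cmod (\<Sum>n. \<psi> n * of_real (t ^ n / (1 - t ^ n))) \<le> l"
proof -
  have t01: "0 < t" "t < 1" using t by (auto simp: power_less_one_iff)
  define S where "S n = (\<Sum>i<n. t ^ i)" for n
  have S: "S n = (1 - t ^ n) / (1 - t)" for n unfolding S_def using t01 by (subst sum_gp_strict) auto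
  have S_pos: "S n > 0" if "n > 0" for n unfolding S using t01 that by (simp add: power_less_one_iff)
  \<comment> \<open>AM-GM on the pairs \<open>t ^ i\<close> and \<open>t ^ (n - 1 - i)\<close>.
    Writing \<open>t\<close> as the square of \<open>s\<close> makes the geometric means powers of
    \<open>s\<close>.\<close>
  have amgm: "real n * s ^ n \<le> s * S n" for n
  proof (cases n)
    case (Suc k)
    have "S n = (\<Sum>i<n. s ^ (2 * i))" by (simp add: S_def t(3) power_mult)
    then have "2 * S n = (\<Sum>i<n. s ^ (2 * i)) + (\<Sum>i<n. s ^ (2 * (n - Suc i)))"
      using sum.nat_diff_reindex[of "\<lambda>i. s ^ (2 * i)" n] by simp
    also have "\<dots> = (\<Sum>i<n. s ^ (2 * i) + s ^ (2 * (n - Suc i)))" by (simp add: sum.distrib)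
    also have "\<dots> \<ge> (\<Sum>i<n. 2 * s ^ k)"
    proof (rule sum_mono)
      fix i assume i: "i \<in> {..<n}"
      have "2 * (s ^ i * s ^ (n - Suc i)) \<le> (s ^ i)\<^sup>2 + (s ^ (n - Suc i))\<^sup>2"
        using sum_squares_bound[of "s ^ i" "s ^ (n - Suc i)"] by simp
      moreover have "s ^ i * s ^ (n - Suc i) = s ^ k" using i Suc by (simp flip: power_add)
      ultimately show "2 * s ^ k \<le> s ^ (2 * i) + s ^ (2 * (n - Suc i))" by (simp add: power_even_eq)
    qed
    finally have "real n * s ^ k \<le> S n" by simp
    then have "s * (real n * s ^ k) \<le> s * S n" using t by (intro mult_left_mono) auto
    then show ?thesis by (simp add: Suc mult_ac)
  qed (simp add: S_def)
  define b where "b n = 1 / (real n * (1 - t)) - t ^ n / (1 - t ^ n)" for n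
  have bS: "(1 - t) * b n = 1 / n - t ^ n / S n" for n
  proof -
    have "(1 - t) * (1 / (real n * (1 - t))) = 1 / n" using t01 by simp
    moreover have "(1 - t) * (t ^ n / (1 - t ^ n)) = t ^ n / S n" by (simp add: S mult.commute)
    ultimately show ?thesis by (simp only: b_def right_diff_distrib)
  qed
  \<comment> \<open>Monotonicity amounts to
    \<open>t ^ n / (S n * S (Suc n)) \<le> 1 / (n * (n + 1))\<close>, which follows by multiplying
    the AM-GM bounds for \<open>n\<close> and \<open>n + 1\<close>.\<close>
  have "b (Suc n) \<le> b n" if n: "n > 0" for n
  proof -
    have "real n * s ^ n * (real (Suc n) * s ^ Suc n) \<le> s * S n * (s * S (Suc n))"
      using t S_pos[of "Suc n"] S_pos[OF n] by (intro mult_mono amgm) auto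
    moreover have e: "s ^ Suc (2 * n) = s * (s ^ n * s ^ n)" by (simp add: mult_2 power_add)
    ultimately have "s ^ Suc (2 * n) * (real n * real (Suc n)) \<le> s ^ 2 * (S n * S (Suc n))"
      unfolding e by (simp add: power2_eq_square mult_ac del: of_nat_Suc)
    moreover have "s ^ (2 * n) * s ^ 2 \<le> s ^ Suc (2 * n)" using t by (simp add: power2_eq_square mult_left_le)
    ultimately have "s ^ (2 * n) * s ^ 2 * (real n * real (Suc n)) \<le> s ^ 2 * (S n * S (Suc n))"
      by (meson mult_right_mono order_trans of_nat_0_le_iff mult_nonneg_nonneg)
    then have "t ^ n * (real n * real (Suc n)) \<le> S n * S (Suc n)"
      using t(1) unfolding t(3) power_mult[symmetric] by (simp add: mult_ac)
    then have le: "t ^ n / (S n * S (Suc n)) \<le> 1 / (real n * real (Suc n))"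
      using S_pos[of "Suc n"] S_pos[OF n] n by (simp add: field_simps del: of_nat_Suc)
    have "S (Suc n) = 1 + t * S n" unfolding S using t01 by (simp add: field_simps)
    then have "t ^ n / S n - t ^ Suc n / S (Suc n) = t ^ n / (S n * S (Suc n))"
      using S_pos[of "Suc n"] S_pos[OF n] by (simp add: field_simps)
    moreover have "1 / real n - 1 / real (Suc n) = 1 / (real n * real (Suc n))" using n by (simp add: field_simps)
    ultimately have "(1 - t) * b (Suc n) \<le> (1 - t) * b n" unfolding bS using le by linarith
    then show ?thesis using t01 by simp
  qed
  moreover have "b \<longlonglongrightarrow> 0"
  proof -
    have "(\<lambda>n. 1 / (1 - t) * (1 / real n) - t ^ n / (1 - t ^ n)) \<longlonglongrightarrow> 1 / (1 - t) * 0 - 0 / (1 - 0)"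
      using t01 by (intro tendsto_intros LIMSEQ_power_zero lim_1_over_n) auto
    then show ?thesis by (simp add: b_def[abs_def] mult.commute)
  qed
  ultimately have sb: "summable (\<lambda>n. \<psi> n * of_real (b n))" and bd: "cmod (\<Sum>n. \<psi> n * of_real (b n)) \<le> l * b 1"
    by (intro abel_decreasing; simp)+
  have b1: "b 1 = 1" using t01 by (simp add: b_def field_simps)
  have sL: "summable (\<lambda>n. \<psi> n * of_real (real n powr - 1))" by (rule L_summable) simp
  have eq: "\<psi> n * of_real (t ^ n / (1 - t ^ n)) = of_real (1 / (1 - t)) * (\<psi> n * of_real (real n powr - 1)) - \<psi> n * of_real (b n)" for n
    using zero by (cases "n = 0") (simp_all add: b_def powr_minus_divide algebra_simps)
  show "summable (\<lambda>n. \<psi> n * of_real (t ^ n / (1 - t ^ n)))"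
    unfolding eq by (intro summable_diff summable_mult sL sb)
  have "(\<Sum>n. \<psi> n * of_real (t ^ n / (1 - t ^ n)))
      = (\<Sum>n. of_real (1 / (1 - t)) * (\<psi> n * of_real (real n powr - 1))) - (\<Sum>n. \<psi> n * of_real (b n))"
    unfolding eq by (rule suminf_diff[OF summable_mult[OF sL] sb, symmetric])
  also have "(\<Sum>n. of_real (1 / (1 - t)) * (\<psi> n * of_real (real n powr - 1))) = of_real (1 / (1 - t)) * L 1"
    unfolding L_def by (rule suminf_mult[OF sL])
  finally have "(\<Sum>n. \<psi> n * of_real (t ^ n / (1 - t ^ n))) = of_real (1 / (1 - t)) * L 1 - (\<Sum>n. \<psi> n * of_real (b n))" .
  then show "cmod (\<Sum>n. \<psi> n * of_real (t ^ n / (1 - t ^ n))) \<le> l" using bd b1 L1 by simp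
qed

end

section \<open>Nonvanishing of L at 1\<close>

lemma sum_divisors_prime_power_mult:
  fixes c :: "nat \<Rightarrow> real"
  assumes c: "\<And>m n. c (m * n) = c m * c n" "c 1 = 1" and p: "prime p" "\<not> p dvd M" "M > 0"
  shows "(\<Sum>d | d dvd p ^ e * M. c d) = (\<Sum>i\<le>e. c p ^ i) * (\<Sum>d | d dvd M. c d)"
proof -
  have "c (Suc 0) = 1" using c(2) by simp
  then have cp: "c (p ^ i) = c p ^ i" for i by (induction i) (auto simp: c(1))
  have mult: "multiplicity p (p ^ i * d) = i" if "d dvd M" for i d
  proof -
    have "\<not> p dvd d" "d \<noteq> 0" using that p dvd_trans by auto
    then have "\<not> p ^ Suc i dvd p ^ i * d" using prime_gt_0_nat[OF p(1)] by (simp add: mult.commute[of p])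
    then show ?thesis by (intro multiplicity_eqI) auto
  qed
  have "inj_on (\<lambda>(i, d). p ^ i * d) ({..e} \<times> {d. d dvd M})"
  proof (rule inj_onI, clarify)
    fix i d j d' assume "d dvd M" "d' dvd M" and eq: "p ^ i * d = p ^ j * d'"
    then have "i = j" using mult by metis
    then show "i = j \<and> d = d'" using eq p prime_gt_0_nat[of p] by simp
  qed
  moreover have "{d. d dvd p ^ e * M} = (\<lambda>(i, d). p ^ i * d) ` ({..e} \<times> {d. d dvd M})"
  proof (intro equalityI subsetI)
    fix x assume "x \<in> {d. d dvd p ^ e * M}"
    then obtain a b where ab: "x = a * b" "a dvd p ^ e" "b dvd M" using division_decomp[of x "p ^ e" M] by auto
    then obtain i where "i \<le> e" "a = p ^ i" using divides_primepow_nat[OF p(1)] by auto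
    then show "x \<in> (\<lambda>(i, d). p ^ i * d) ` ({..e} \<times> {d. d dvd M})" using ab by force
  next
    fix x assume "x \<in> (\<lambda>(i, d). p ^ i * d) ` ({..e} \<times> {d. d dvd M})"
    then show "x \<in> {d. d dvd p ^ e * M}" by (auto intro!: mult_dvd_mono le_imp_power_dvd)
  qed
  ultimately have "(\<Sum>d | d dvd p ^ e * M. c d) = (\<Sum>(i, d)\<in>{..e} \<times> {d. d dvd M}. c (p ^ i * d))"
    by (simp add: sum.reindex split_def)
  also have "\<dots> = (\<Sum>i\<le>e. \<Sum>d | d dvd M. c p ^ i * c d)" by (simp add: sum.cartesian_product c cp)
  finally show ?thesis by (simp add: sum_product)
qed

text \<open>By multiplicativity everything reduces to prime powers, where the sum consists of powers
  of \<open>0\<close>, \<open>1\<close> or \<open>- 1\<close>: it is never negative, and at least 1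
  for an even exponent.\<close>

lemma sum_divisors_bounds:
  fixes c :: "nat \<Rightarrow> real"
  assumes c: "\<And>m n. c (m * n) = c m * c n" "c 1 = 1" and v: "\<And>n. c n \<in> {0, 1, -1}" and n: "n > 0"
  shows "(\<Sum>d | d dvd n. c d) \<ge> 0" "(\<Sum>d | d dvd n ^ 2. c d) \<ge> 1"
proof -
  have geo: "(\<Sum>i\<le>e. c p ^ i) \<ge> 0 \<and> (even e \<longrightarrow> (\<Sum>i\<le>e. c p ^ i) \<ge> 1)" for p e
  proof -
    have pm: "(\<Sum>i\<le>e. (- 1 :: real) ^ i) = (if even e then 1 else 0)" by (induction e) auto
    have z: "(\<Sum>i\<le>e. (0 :: real) ^ i) = 1" by (induction e) auto
    show ?thesis using v[of p] by (auto simp: pm z)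
  qed
  have "(\<Sum>d | d dvd n. c d) \<ge> 0 \<and> (\<Sum>d | d dvd n ^ 2. c d) \<ge> 1"
    using n
  proof (induction n rule: less_induct)
    case (less n)
    show ?case
    proof (cases "n = 1")
      case True
      have "{d. d dvd (1::nat)} = {1}" by auto
      then show ?thesis using True c(2) by simp
    next
      case False
      then obtain p where p: "prime p" "p dvd n" using prime_factor_nat by blast
      obtain M where M: "n = p ^ multiplicity p n * M" "\<not> p dvd M"
        using multiplicity_decompose'[of n p] p less.prems not_prime_unit by (metis neq0_conv)
      define e where "e = multiplicity p n"
      have M0: "M > 0" using M less.prems by (auto intro: Nat.gr0I)
      have "M dvd n" using M(1) dvd_triv_right by metis
      moreover have "M \<noteq> n" using M(2) p(2) by auto
      ultimately have "M < n" using less.prems by (meson dvd_imp_le le_neq_implies_less)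
      note IH = less.IH[OF this M0]
      have 1: "(\<Sum>d | d dvd n. c d) = (\<Sum>i\<le>e. c p ^ i) * (\<Sum>d | d dvd M. c d)"
        using sum_divisors_prime_power_mult[OF c p(1) M(2) M0, of e] M(1) by (simp add: e_def)
      have "n ^ 2 = p ^ (2 * e) * M ^ 2" using arg_cong[OF M(1), of "\<lambda>x. x ^ 2"] by (simp add: e_def power_mult_distrib power_mult power_even_eq mult.commute)
      moreover have "\<not> p dvd M ^ 2" using M(2) p(1) prime_dvd_power by blast
      ultimately have 2: "(\<Sum>d | d dvd n ^ 2. c d) = (\<Sum>i\<le>2 * e. c p ^ i) * (\<Sum>d | d dvd M ^ 2. c d)"
        using sum_divisors_prime_power_mult[OF c p(1), of "M ^ 2" "2 * e"] M0 by simp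
      have "1 * 1 \<le> (\<Sum>i\<le>2 * e. c p ^ i) * (\<Sum>d | d dvd M ^ 2. c d)"
        using geo[of p "2 * e"] IH by (intro mult_mono) auto
      then show ?thesis using 1 2 geo[of p e] IH by auto
    qed
  qed
  then show "(\<Sum>d | d dvd n. c d) \<ge> 0" "(\<Sum>d | d dvd n ^ 2. c d) \<ge> 1" by auto
qed

lemma sum_divisors_swap:
  fixes F :: "nat \<Rightarrow> nat \<Rightarrow> real"
  shows "(\<Sum>N=1..K. \<Sum>d | d dvd N. F d N) = (\<Sum>d=1..K. \<Sum>m=1..K div d. F d (d * m))"
proof -
  have "(\<Sum>N=1..K. \<Sum>d | d dvd N. F d N) = (\<Sum>N=1..K. \<Sum>d=1..K. if d dvd N then F d N else 0)"
  proof (rule sum.cong[OF refl])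
    fix N assume N: "N \<in> {1..K}"
    have "{1..K} \<inter> {d. d dvd N} = {d. d dvd N}"
    proof (intro equalityI subsetI)
      fix d assume d: "d \<in> {d. d dvd N}"
      then have "d \<le> N" "d > 0" using N by (auto intro: dvd_imp_le Nat.gr0I)
      then show "d \<in> {1..K} \<inter> {d. d dvd N}" using N d by simp
    qed auto
    then show "(\<Sum>d | d dvd N. F d N) = (\<Sum>d=1..K. if d dvd N then F d N else 0)"
      using sum.inter_restrict[where A = "{1..K}" and g = "\<lambda>d. F d N" and B = "{d. d dvd N}"] by simp
  qed
  also have "\<dots> = (\<Sum>d=1..K. \<Sum>N=1..K. if d dvd N then F d N else 0)" by (rule sum.swap)
  also have "\<dots> = (\<Sum>d=1..K. \<Sum>m=1..K div d. F d (d * m))"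
  proof (rule sum.cong[OF refl])
    fix d assume d: "d \<in> {1..K}"
    have "(\<Sum>N=1..K. if d dvd N then F d N else 0) = (\<Sum>N\<in>(\<lambda>m. d * m) ` {1..K div d}. F d N)"
    proof (rule sum.mono_neutral_cong_right)
      show "(\<lambda>m. d * m) ` {1..K div d} \<subseteq> {1..K}"
        using d by (auto simp: less_eq_div_iff_mult_less_eq mult.commute)
      show "\<forall>i\<in>{1..K} - (\<lambda>m. d * m) ` {1..K div d}. (if d dvd i then F d i else 0) = 0"
      proof
        fix i assume i: "i \<in> {1..K} - (\<lambda>m. d * m) ` {1..K div d}"
        have "\<not> d dvd i"
        proof
          assume "d dvd i"
          then obtain m where m: "i = d * m" by (elim dvdE)
          then have "m \<in> {1..K div d}" using i d by (auto simp: less_eq_div_iff_mult_less_eq mult.commute intro!: Suc_leI Nat.gr0I)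
          then show False using i m by auto
        qed
        then show "(if d dvd i then F d i else 0) = 0" by simp
      qed
    qed auto
    also have "\<dots> = (\<Sum>m=1..K div d. F d (d * m))"
      using d by (subst sum.reindex) (auto intro!: inj_onI)
    finally show "(\<Sum>N=1..K. if d dvd N then F d N else 0) = (\<Sum>m=1..K div d. F d (d * m))" .
  qed
  finally show ?thesis .
qed

context nonprincipal_char
begin

text \<open>Expanding the geometric series turns the Lambert series into a power series with the
  divisor sums of \<open>\<psi>\<close> as coefficients. For real \<open>\<psi>\<close> these are
  nonnegative and at least 1 at squares, so the bound \<open>l\<close> passes to the sum of
  \<open>t ^ (k ^ 2)\<close>.\<close>

lemma lambert_lower_bound:
  assumes real: "\<And>n. \<psi> n \<in> {0, 1, - 1}" and L1: "L 1 = 0" and s: "0 < s" "s < (1 :: real)"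
  shows "(\<Sum>k=1..K. (s ^ 2) ^ (k ^ 2)) \<le> l"
proof -
  define t where "t = s ^ 2"
  have t: "0 < t" "t < 1" using s by (auto simp: t_def power_less_one_iff)
  define c where "c n = Re (\<psi> n)" for n
  have c_eq: "\<psi> n = of_real (c n)" for n using real[of n] by (auto simp: c_def)
  have cmult: "c (m * n) = c m * c n" for m n using mult[of m n] unfolding c_eq by (metis of_real_eq_iff of_real_mult)
  have c1: "c 1 = 1" by (simp only: c_def one) simp
  have cv: "c n \<in> {0, 1, - 1}" for n using real[of n] by (auto simp: c_def)
  have c_abs: "\<bar>c n\<bar> \<le> 1" for n using cv[of n] by auto
  define g where "g n = c n * (t ^ n / (1 - t ^ n))" for n
  note lb = lambert_bound[OF s t_def L1]
  have eq: "\<psi> n * of_real (t ^ n / (1 - t ^ n)) = of_real (g n)" for n by (simp add: c_eq g_def)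
  have sg: "summable g" using summable_Re[OF lb(1)] unfolding eq by simp
  have "suminf g = Re (\<Sum>n. of_real (g n))" using Re_suminf[OF lb(1)] unfolding eq by simp
  then have g_le: "suminf g \<le> l" using lb(2) complex_Re_le_cmod[of "\<Sum>n. of_real (g n)"] unfolding eq by simp
  define P where "P M = (\<Sum>N=1..M. \<Sum>d | d dvd N. c d * t ^ N)" for M
  \<comment> \<open>The rearrangement is done on finite sums: cutting the geometric series of
    \<open>d\<close> at \<open>M div d\<close> leaves at most \<open>t ^ M / (1 - t)\<close> for
    each of the \<open>M\<close> values of \<open>d\<close>.\<close>
  have diff: "\<bar>P M - (\<Sum>n<Suc M. g n)\<bar> \<le> (1 / (1 - t)) * (real M * t ^ M)" for M
  proof -
    have g0: "g 0 = 0" by (simp add: g_def)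
    have "(\<Sum>n<Suc M. g n) = (\<Sum>d=1..M. g d)"
      by (rule sum.mono_neutral_right) (auto simp: g0 Suc_le_eq)
    moreover have "P M = (\<Sum>d=1..M. \<Sum>m=1..M div d. c d * t ^ (d * m))" unfolding P_def by (rule sum_divisors_swap)
    ultimately have "P M - (\<Sum>n<Suc M. g n) = (\<Sum>d=1..M. (\<Sum>m=1..M div d. c d * t ^ (d * m)) - g d)"
      by (simp add: sum_subtractf)
    also have "\<bar>\<dots>\<bar> \<le> (\<Sum>d=1..M. t ^ M / (1 - t))"
    proof (rule order_trans[OF sum_abs], rule sum_mono)
      fix d assume d: "d \<in> {1..M}"
      define q where "q = M div d"
      have td: "t ^ d < 1" "t ^ d \<le> t" using t d power_decreasing[of 1 d t] by (auto simp: power_less_one_iff)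
      have "(\<Sum>m=1..q. t ^ (d * m)) = t ^ d * (\<Sum>m<q. (t ^ d) ^ m)"
        by (simp add: sum.atLeast1_atMost_eq sum_distrib_left power_mult power_add)
      also have "\<dots> = t ^ d * ((1 - (t ^ d) ^ q) / (1 - t ^ d))" using td by (subst sum_gp_strict) auto
      finally have "(\<Sum>m=1..q. c d * t ^ (d * m)) - g d = c d * (t ^ d * ((1 - (t ^ d) ^ q) / (1 - t ^ d))) - g d"
        by (simp flip: sum_distrib_left)
      also have "\<dots> = - (c d * (t ^ (d * Suc q) / (1 - t ^ d)))"
      proof -
        have "t ^ d * ((1 - (t ^ d) ^ q) / (1 - t ^ d)) = t ^ d / (1 - t ^ d) - t ^ d * (t ^ d) ^ q / (1 - t ^ d)"
          by (simp add: diff_divide_distrib right_diff_distrib)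
        moreover have "t ^ (d * Suc q) = t ^ d * (t ^ d) ^ q" by (simp add: power_mult power_add)
        ultimately show ?thesis by (simp only: g_def right_diff_distrib)
      qed
      finally have "\<bar>(\<Sum>m=1..q. c d * t ^ (d * m)) - g d\<bar> = \<bar>c d\<bar> * (t ^ (d * Suc q) / (1 - t ^ d))"
        using t td by (simp add: abs_mult)
      also have "\<dots> \<le> 1 * (t ^ M / (1 - t))"
      proof (intro mult_mono frac_le power_decreasing c_abs)
        have "M = d * q + M mod d" "M mod d < d" using d by (auto simp: q_def)
        then show "M \<le> d * Suc q" by simp
      qed (use t td in auto)
      finally show "\<bar>(\<Sum>m=1..M div d. c d * t ^ (d * m)) - g d\<bar> \<le> t ^ M / (1 - t)" by (simp add: q_def)
    qed
    finally show ?thesis by simp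
  qed
  have "(\<lambda>M. P M - (\<Sum>n<Suc M. g n)) \<longlonglongrightarrow> 0"
  proof (rule Lim_null_comparison)
    show "\<forall>\<^sub>F M in sequentially. norm (P M - (\<Sum>n<Suc M. g n)) \<le> (1 / (1 - t)) * (real M * t ^ M)"
      using diff by (intro always_eventually) simp
    have "(\<lambda>M. (1 / (1 - t)) * (real M * t ^ M)) \<longlonglongrightarrow> (1 / (1 - t)) * 0"
      using t by (intro tendsto_mult_left powser_times_n_limit_0) auto
    then show "(\<lambda>M. (1 / (1 - t)) * (real M * t ^ M)) \<longlonglongrightarrow> 0" by simp
  qed
  from tendsto_add[OF this LIMSEQ_Suc[OF summable_LIMSEQ[OF sg]]]
  have P: "P \<longlonglongrightarrow> suminf g" by (simp del: sum.lessThan_Suc)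
  have "\<forall>\<^sub>F M in sequentially. (\<Sum>k=1..K. t ^ (k ^ 2)) \<le> P M"
    using eventually_ge_at_top[of "K ^ 2"]
  proof eventually_elim
    case (elim M)
    have sub: "(\<lambda>k. k ^ 2) ` {1..K} \<subseteq> {1..M}"
    proof
      fix N assume "N \<in> (\<lambda>k. k ^ 2) ` {1..K}"
      then obtain k where k: "N = k ^ 2" "1 \<le> k" "k \<le> K" by auto
      then have "k ^ 2 \<le> K ^ 2" "1 \<le> k ^ 2" by (auto intro: power_mono)
      then show "N \<in> {1..M}" using k(1) order_trans[OF \<open>k ^ 2 \<le> K ^ 2\<close> elim] by simp
    qed
    have "(\<Sum>k=1..K. t ^ (k ^ 2)) \<le> (\<Sum>k=1..K. \<Sum>d | d dvd k ^ 2. c d * t ^ (k ^ 2))"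
    proof (rule sum_mono)
      fix k assume "k \<in> {1..K}"
      then have "(\<Sum>d | d dvd k ^ 2. c d) \<ge> 1" by (intro sum_divisors_bounds(2) cmult c1 cv) auto
      then show "t ^ (k ^ 2) \<le> (\<Sum>d | d dvd k ^ 2. c d * t ^ (k ^ 2))"
        using t mult_right_mono[of 1 "\<Sum>d | d dvd k ^ 2. c d" "t ^ (k ^ 2)"] by (simp add: sum_distrib_right)
    qed
    also have "\<dots> = (\<Sum>N\<in>(\<lambda>k. k ^ 2) ` {1..K}. \<Sum>d | d dvd N. c d * t ^ N)"
      by (subst sum.reindex) (auto intro!: inj_onI)
    also have "\<dots> \<le> P M"
      unfolding P_def
    proof (rule sum_mono2[OF _ sub])
      fix N assume "N \<in> {1..M} - (\<lambda>k. k ^ 2) ` {1..K}"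
      then have "(\<Sum>d | d dvd N. c d) \<ge> 0" by (intro sum_divisors_bounds(1) cmult c1 cv) auto
      then show "0 \<le> (\<Sum>d | d dvd N. c d * t ^ N)" using t by (simp flip: sum_distrib_right)
    qed simp
    finally show ?case .
  qed
  then have "(\<Sum>k=1..K. t ^ (k ^ 2)) \<le> suminf g"
    by (intro tendsto_lowerbound[OF P]) auto
  then show ?thesis using g_le by (simp add: t_def)
qed

text \<open>Each \<open>(s ^ 2) ^ (k ^ 2)\<close> tends to 1 as \<open>s\<close> does, so
  \<open>l + 1\<close> such terms exceed the bound \<open>l\<close>.\<close>

lemma L1_nonzero_real:
  assumes real: "\<And>n. \<psi> n \<in> {0, 1, - 1}"
  shows "L 1 \<noteq> 0"
proof
  assume L1: "L 1 = 0"
  define h where "h s = (\<Sum>k=1..Suc l. (s ^ 2) ^ (k ^ 2))" for s :: real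
  have "h s \<le> l" if "0 < s" "s < 1" for s
    unfolding h_def by (rule lambert_lower_bound[OF real L1 that])
  then have "\<forall>\<^sub>F s in at_left 1. h s \<le> l"
    unfolding eventually_at_left_field by (intro exI[of _ 0]) auto
  moreover have "(h \<longlongrightarrow> h 1) (at_left 1)" unfolding h_def by (intro tendsto_intros)
  ultimately have "h 1 \<le> l" by (intro tendsto_upperbound[where F = "at_left (1::real)" and f = h]) auto
  then show False by (simp add: h_def)
qed

text \<open>The pole at 1 in logarithmic form;
  \<open>\<zeta>(\<sigma>) \<le> 1 + 1 / (\<sigma> - 1)\<close> comes from a telescoping comparison
  with \<open>x powr (1 - \<sigma>)\<close>.\<close>

lemma zeta_prime_sum_upper:
  assumes \<sigma>: "1 < \<sigma>"
  shows "(\<Sum>p. of_bool (prime p) * (1 * real p powr - \<sigma>)) \<le> ln (1 + 1 / (\<sigma> - 1)) + 4 * (\<Sum>n. 1 / real n ^ 2)"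
proof -
  have sm: "summable (\<lambda>n. real n powr - \<sigma>)" using \<sigma> by (simp add: summable_real_powr_iff)
  define f where "f x = x powr (1 - \<sigma>)" for x :: real
  have step: "(\<sigma> - 1) * real (n + 2) powr - \<sigma> \<le> f (real (n + 1)) - f (real (n + 2))" for n
  proof -
    have "\<exists>z>real (n + 1). z < real (n + 2) \<and> f (real (n + 2)) - f (real (n + 1)) = (real (n + 2) - real (n + 1)) * ((1 - \<sigma>) * z powr - \<sigma>)"
    proof (rule MVT2)
      fix x assume "real (n + 1) \<le> x" "x \<le> real (n + 2)"
      then have "x > 0" by simp
      then show "(f has_real_derivative (1 - \<sigma>) * x powr - \<sigma>) (at x)"
        unfolding f_def[abs_def] using has_real_derivative_powr[of x "1 - \<sigma>"] by simp
    qed simp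
    then obtain z where z: "real (n + 1) < z" "z < real (n + 2)" "f (real (n + 2)) - f (real (n + 1)) = (1 - \<sigma>) * z powr - \<sigma>" by auto
    have "(\<sigma> - 1) * real (n + 2) powr - \<sigma> \<le> (\<sigma> - 1) * z powr - \<sigma>"
      using z \<sigma> by (intro mult_left_mono powr_mono2') auto
    then show ?thesis using z(3) by (simp add: algebra_simps)
  qed
  have f0: "(\<lambda>n. f (real (n + 1))) \<longlonglongrightarrow> 0"
    unfolding f_def using LIMSEQ_ignore_initial_segment[OF powr_tendsto_0[of "\<sigma> - 1"], of 1] \<sigma> by simp
  have "(\<lambda>n. f (real (n + 1)) - f (real (Suc n + 1))) sums (f (real (0 + 1)) - 0)" by (rule telescope_sums'[OF f0])
  then have tel: "(\<lambda>n. f (real (n + 1)) - f (real (n + 2))) sums 1" by (simp add: f_def)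
  have s2: "summable (\<lambda>n. real (n + 2) powr - \<sigma>)" using sm by (rule summable_ignore_initial_segment)
  have "(\<Sum>n. (\<sigma> - 1) * real (n + 2) powr - \<sigma>) \<le> 1"
    using suminf_le[OF step summable_mult[OF s2] sums_summable[OF tel]] sums_unique[OF tel] by simp
  then have "(\<sigma> - 1) * (\<Sum>n. real (n + 2) powr - \<sigma>) \<le> 1" using suminf_mult[OF s2] by simp
  then have "(\<Sum>n. real (n + 2) powr - \<sigma>) \<le> 1 / (\<sigma> - 1)" using \<sigma> by (simp add: field_simps)
  moreover have "(\<Sum>n. real n powr - \<sigma>) = (\<Sum>n. real (n + 2) powr - \<sigma>) + 1"
    using suminf_split_initial_segment[OF sm, of 2] by (simp add: numeral_2_eq_2)
  ultimately have Z: "(\<Sum>n. real n powr - \<sigma>) \<le> 1 + 1 / (\<sigma> - 1)" by simp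
  interpret Z: completely_multiplicative "\<lambda>n. of_nat n powr - Complex \<sigma> 0" \<sigma>
    by (rule completely_multiplicative_zeta(1)[OF \<sigma>])
  have "cmod (\<Sum>n. of_nat n powr - Complex \<sigma> 0) \<le> (\<Sum>n. real n powr - \<sigma>)"
    by (rule norm_suminf_le[OF Z.bound sm])
  then have "ln (cmod (\<Sum>n. of_nat n powr - Complex \<sigma> 0)) \<le> ln (1 + 1 / (\<sigma> - 1))"
    using Z zeta_prime_sum_bound(2)[OF \<sigma>, of 0] by (intro ln_mono) auto
  then show ?thesis using zeta_prime_sum_bound(1)[OF \<sigma>, of 0] by simp
qed

text \<open>
  If \<open>L 1 = 0\<close>, then \<open>L \<sigma> = O(\<sigma> - 1)\<close> cancels the pole of \<open>\<zeta>\<close>, so \<open>\<psi>(p)\<close> is close to \<open>-1\<close> for most primes.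
\<close>
lemma biased_if_L1_zero:
  assumes L1: "L 1 = 0"
  shows "(\<lambda>p. (1 + Re (\<psi> p)) / real p) summable_on {p. prime p}"
proof -
  define K where "K = l * (\<Sum>n. 2 * real n powr - (3 / 2))"
  define E where "E = 4 * (\<Sum>n. 1 / real n ^ 2)"
  have near: "cmod (L \<sigma>) \<le> K * (\<sigma> - 1)" if "\<sigma> > 1" for \<sigma>
    using L_near_1[OF that] L1 by (simp add: K_def)
  have "0 < K * (2 - 1)" using near[of 2] log_L(1)[of 2] by (metis less_le_trans one_less_numeral_iff semiring_norm(76) zero_less_norm_iff)
  then have K: "K > 0" by simp
  have Re_abs: "\<bar>Re (\<psi> p)\<bar> \<le> 1" for p using abs_Re_le_cmod[of "\<psi> p"] norm_le_one[of p] by linarith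
  show ?thesis
  proof (rule summable_on_reciprocals_of_powr_bound[of 1 _ _ "ln (2 * K) + 2 * E"])
    fix F :: "nat set" and \<sigma> :: real
    assume F: "finite F" "F \<subseteq> {p. prime p}" and \<sigma>: "1 < \<sigma>" "\<sigma> < 1 + 1"
    have s1: "summable (\<lambda>p. of_bool (prime p) * (1 * real p powr - \<sigma>))"
      by (rule summable_prime_powr[OF \<sigma>(1), of "\<lambda>_. 1" 1]) simp
    have s2: "summable (\<lambda>p. of_bool (prime p) * (Re (\<psi> p) * real p powr - \<sigma>))"
      by (rule summable_prime_powr[OF \<sigma>(1) Re_abs])
    have "(\<Sum>p\<in>F. (1 + Re (\<psi> p)) * real p powr - \<sigma>) =
        (\<Sum>p\<in>F. of_bool (prime p) * (1 * real p powr - \<sigma>) + of_bool (prime p) * (Re (\<psi> p) * real p powr - \<sigma>))"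
      using F by (intro sum.cong refl) (auto simp: distrib_right)
    also have "\<dots> \<le> (\<Sum>p. of_bool (prime p) * (1 * real p powr - \<sigma>) + of_bool (prime p) * (Re (\<psi> p) * real p powr - \<sigma>))"
    proof (rule sum_le_suminf[OF summable_add[OF s1 s2] F(1)])
      fix p
      have "0 \<le> (1 + Re (\<psi> p)) * real p powr - \<sigma>" using Re_abs[of p] by (intro mult_nonneg_nonneg) auto
      then show "0 \<le> of_bool (prime p) * (1 * real p powr - \<sigma>) + of_bool (prime p) * (Re (\<psi> p) * real p powr - \<sigma>)"
        by (auto simp: distrib_right)
    qed
    also have "\<dots> = (\<Sum>p. of_bool (prime p) * (1 * real p powr - \<sigma>)) + (\<Sum>p. of_bool (prime p) * (Re (\<psi> p) * real p powr - \<sigma>))"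
      by (rule suminf_add[OF s1 s2, symmetric])
    also have "\<dots> \<le> (ln (1 + 1 / (\<sigma> - 1)) + E) + (ln (K * (\<sigma> - 1)) + E)"
    proof (rule add_mono)
      have "ln (cmod (L \<sigma>)) \<le> ln (K * (\<sigma> - 1))"
        using near[OF \<sigma>(1)] log_L(1)[OF \<sigma>(1)] by (intro ln_mono) auto
      then show "(\<Sum>p. of_bool (prime p) * (Re (\<psi> p) * real p powr - \<sigma>)) \<le> ln (K * (\<sigma> - 1)) + E"
        using log_L(2)[OF \<sigma>(1)] unfolding E_def by linarith
    qed (use zeta_prime_sum_upper[OF \<sigma>(1)] E_def in simp)
    also have "\<dots> = ln ((1 + 1 / (\<sigma> - 1)) * (K * (\<sigma> - 1))) + 2 * E"
    proof -
      have "1 + 1 / (\<sigma> - 1) > 0" "K * (\<sigma> - 1) > 0" using \<sigma> K by (auto intro: add_pos_pos)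
      then have "ln ((1 + 1 / (\<sigma> - 1)) * (K * (\<sigma> - 1))) = ln (1 + 1 / (\<sigma> - 1)) + ln (K * (\<sigma> - 1))"
        by (rule ln_mult_pos)
      then show ?thesis by (simp only:)
    qed
    also have "(1 + 1 / (\<sigma> - 1)) * (K * (\<sigma> - 1)) = K * \<sigma>" using \<sigma> by (simp add: field_simps)
    also have "ln (K * \<sigma>) + 2 * E \<le> ln (2 * K) + 2 * E" using \<sigma> K by simp
    finally show "(\<Sum>p\<in>F. (1 + Re (\<psi> p)) * real p powr - \<sigma>) \<le> ln (2 * K) + 2 * E" .
  next
    fix p show "0 \<le> 1 + Re (\<psi> p)" using Re_abs[of p] by linarith
  qed (auto dest: prime_gt_0_nat)
qed

lemma dirichlet_char_square: "dirichlet_char l (\<lambda>n. \<psi> n ^ 2)"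
  unfolding dirichlet_char_def using mult periodic nonzero_iff by (auto simp: power_mult_distrib)

text \<open>If \<open>L 1 = 0\<close>, then \<open>\<psi> p\<close> is near \<open>- 1\<close>, and
  so \<open>\<psi> p ^ 2\<close> near 1, for most primes. Such a bias is impossible if the square of
  \<open>\<psi>\<close> is nonprincipal; otherwise \<open>\<psi>\<close> is real and the Lambert
  series argument applies.\<close>

lemma L1_nonzero: "L 1 \<noteq> 0"
proof
  assume L1: "L 1 = 0"
  have Re_abs: "\<bar>Re (\<psi> p)\<bar> \<le> 1" for p using abs_Re_le_cmod[of "\<psi> p"] norm_le_one[of p] by linarith
  show False
  proof (cases "\<exists>n. coprime n l \<and> \<psi> n ^ 2 \<noteq> 1")
    case True
    interpret S: nonprincipal_char l "\<lambda>n. \<psi> n ^ 2"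
      by unfold_locales (use l_pos dirichlet_char_square True in auto)
    show False
    proof (rule no_bias[of "\<lambda>p. Re (\<psi> p ^ 2)" 1 "1 / 2"])
      show "\<bar>Re (\<psi> p ^ 2)\<bar> \<le> 1" for p using abs_Re_le_cmod[of "\<psi> p ^ 2"] S.norm_le_one[of p] by linarith
      show "(\<Sum>p. of_bool (prime p) * (Re (\<psi> p ^ 2) * real p powr - \<sigma>)) \<le> ln l + 4 * (\<Sum>n. 1 / real n ^ 2)" if "1 < \<sigma>" for \<sigma>
        by (rule S.prime_sum_upper[OF that])
      \<comment> \<open>The factor 8: for \<open>a = Re (\<psi> p)\<close>,
        \<open>Re (\<psi> p ^ 2) < 1 / 2\<close> means \<open>a\<^sup>2 < 3 / 4\<close>, so that
        \<open>2 * (1 + a) \<ge> 1 - a\<^sup>2 > 1 / 4\<close>.\<close>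
      have "(\<lambda>p. 8 * ((1 + Re (\<psi> p)) / real p)) summable_on {p. prime p}"
        by (rule summable_on_cmult_right[OF biased_if_L1_zero[OF L1]])
      then have "(\<lambda>p. 8 * ((1 + Re (\<psi> p)) / real p)) summable_on {p. prime p \<and> Re (\<psi> p ^ 2) < 1 / 2 \<and> coprime p l}"
        by (rule summable_on_subset_banach) auto
      then have "(\<lambda>p. 1 / real p) summable_on {p. prime p \<and> Re (\<psi> p ^ 2) < 1 / 2 \<and> coprime p l}"
      proof (rule summable_on_comparison_test)
        fix p assume p: "p \<in> {p. prime p \<and> Re (\<psi> p ^ 2) < 1 / 2 \<and> coprime p l}"
        define a where "a = Re (\<psi> p)"
        have "a\<^sup>2 + (Im (\<psi> p))\<^sup>2 = 1" using norm_one[of p] p cmod_power2[of "\<psi> p"] by (simp add: a_def)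
        moreover have "Re (\<psi> p ^ 2) = a\<^sup>2 - (Im (\<psi> p))\<^sup>2" by (simp add: a_def power2_eq_square)
        ultimately have "2 * a\<^sup>2 < 3 / 2" using p by auto
        moreover have "1 - a\<^sup>2 \<le> 2 * (1 + a)"
        proof -
          have "(1 - a) * (1 + a) \<le> 2 * (1 + a)" using Re_abs[of p] unfolding a_def by (intro mult_right_mono) auto
          then show ?thesis by (simp add: power2_eq_square algebra_simps)
        qed
        ultimately have "1 \<le> 8 * (1 + a)" by linarith
        then have "1 / real p \<le> 8 * (1 + a) / real p" by (intro divide_right_mono) auto
        then show "1 / real p \<le> 8 * ((1 + Re (\<psi> p)) / real p)" by (simp add: a_def)
      qed auto
      then have 1: "(\<lambda>p. 1 / real p) summable_on {p\<in>{p. prime p \<and> Re (\<psi> p ^ 2) < 1 / 2}. coprime p l}"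
        by (simp add: conj_ac)
      have "finite {p\<in>{p. prime p \<and> Re (\<psi> p ^ 2) < 1 / 2}. \<not> coprime p l}"
        by (rule finite_subset[OF _ finite_primes_not_to[OF l_pos]]) auto
      then have 2: "(\<lambda>p. 1 / real p) summable_on {p\<in>{p. prime p \<and> Re (\<psi> p ^ 2) < 1 / 2}. \<not> coprime p l}" by simp
      show "(\<lambda>p. 1 / real p) summable_on {p. prime p \<and> Re (\<psi> p ^ 2) < 1 / 2}"
        by (rule summable_on_split[OF 1 2])
    qed auto
  next
    case False
    have "\<psi> n \<in> {0, 1, - 1}" for n
      using False nonzero_iff[of n] by (cases "coprime n l") (auto simp: power2_eq_1_iff)
    from L1_nonzero_real[OF this] L1 show False by contradiction
  qed
qed

lemma prime_sum_lower:
  obtains \<delta> C where "\<delta> > 0"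
    "\<forall>\<sigma>. 1 < \<sigma> \<longrightarrow> \<sigma> < 1 + \<delta> \<longrightarrow> C \<le> (\<Sum>p. of_bool (prime p) * (Re (\<psi> p) * real p powr - \<sigma>))"
proof -
  \<comment> \<open>The maximum keeps \<open>K\<close> positive. \<open>\<delta>\<close> is then
    chosen so that \<open>L\<close> moves by at most half of \<open>cmod (L 1)\<close>.\<close>
  define K where "K = max 1 (l * (\<Sum>n. 2 * real n powr - (3 / 2)))"
  define m where "m = cmod (L 1)"
  have m: "m > 0" using L1_nonzero by (simp add: m_def)
  define \<delta> where "\<delta> = m / (2 * K)"
  have K: "K > 0" by (simp add: K_def)
  show thesis
  proof (rule that[of \<delta> "ln (m / 2) - 4 * (\<Sum>n. 1 / real n ^ 2)"], goal_cases)
    case 1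
    show "\<delta> > 0" using m K by (simp add: \<delta>_def)
  next
    case 2
    show ?case
    proof (intro allI impI)
    fix \<sigma> :: real assume \<sigma>: "1 < \<sigma>" "\<sigma> < 1 + \<delta>"
    have "cmod (L 1 - L \<sigma>) \<le> l * (\<Sum>n. 2 * real n powr - (3 / 2)) * (\<sigma> - 1)" by (rule L_near_1[OF \<sigma>(1)])
    also have "\<dots> \<le> K * \<delta>" using \<sigma> K by (intro mult_mono) (auto simp: K_def)
    also have "\<dots> = m / 2" using K by (simp add: \<delta>_def)
    finally have "m / 2 \<le> cmod (L \<sigma>)"
      using norm_triangle_ineq2[of "L 1" "L 1 - L \<sigma>"] unfolding m_def by simp
    then have "ln (m / 2) \<le> ln (cmod (L \<sigma>))" using m by (intro ln_mono) auto
    then show "ln (m / 2) - 4 * (\<Sum>n. 1 / real n ^ 2) \<le> (\<Sum>p. of_bool (prime p) * (Re (\<psi> p) * real p powr - \<sigma>))"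
      using log_L(2)[OF \<sigma>(1)] by linarith
    qed
  qed
qed

text \<open>The sums of \<open>Re (\<psi> p) * p powr - \<sigma>\<close> stay bounded on both sides
  as \<open>\<sigma> \<rightarrow> 1\<close>: above because \<open>L\<close> is bounded, below
  because \<open>L 1 \<noteq> 0\<close>. So neither sign of the real part can dominate.\<close>

lemma not_biased:
  assumes \<kappa>: "\<kappa> > 0" and s: "s = 1 \<or> s = (- 1 :: real)"
  shows "\<not> (\<lambda>p. 1 / real p) summable_on {p\<in>primes_to l. s * Re (\<psi> p) < \<kappa>}"
proof
  assume "(\<lambda>p. 1 / real p) summable_on {p\<in>primes_to l. s * Re (\<psi> p) < \<kappa>}"
  then have 1: "(\<lambda>p. 1 / real p) summable_on {p\<in>{p. prime p \<and> s * Re (\<psi> p) < \<kappa>}. coprime p l}"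
    by (simp add: primes_to_def conj_ac)
  have "finite {p\<in>{p. prime p \<and> s * Re (\<psi> p) < \<kappa>}. \<not> coprime p l}"
    by (rule finite_subset[OF _ finite_primes_not_to[OF l_pos]]) auto
  then have 2: "(\<lambda>p. 1 / real p) summable_on {p\<in>{p. prime p \<and> s * Re (\<psi> p) < \<kappa>}. \<not> coprime p l}" by simp
  note bad = summable_on_split[OF 1 2]
  have abs: "\<bar>s * Re (\<psi> p)\<bar> \<le> 1" for p using s abs_Re_le_cmod[of "\<psi> p"] norm_le_one[of p] by auto
  show False using s
  proof
    assume s1: "s = 1"
    show False
      by (rule no_bias[OF abs zero_less_one \<kappa> _ bad]) (use s1 prime_sum_upper in simp)
  next
    assume s1: "s = - 1"
    obtain \<delta> C where dC: "\<delta> > 0"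
      "\<forall>\<sigma>. 1 < \<sigma> \<longrightarrow> \<sigma> < 1 + \<delta> \<longrightarrow> C \<le> (\<Sum>p. of_bool (prime p) * (Re (\<psi> p) * real p powr - \<sigma>))"
      by (rule prime_sum_lower)
    show False
    proof (rule no_bias[OF abs dC(1) \<kappa> _ bad])
      fix \<sigma> :: real assume \<sigma>: "1 < \<sigma>" "\<sigma> < 1 + \<delta>"
      have "summable (\<lambda>p. of_bool (prime p) * (Re (\<psi> p) * real p powr - \<sigma>))"
        using abs s1 by (intro summable_prime_powr[OF \<sigma>(1), of _ 1]) auto
      then show "(\<Sum>p. of_bool (prime p) * (s * Re (\<psi> p) * real p powr - \<sigma>)) \<le> - C"
        using dC(2)[rule_format, OF \<sigma>] s1 by (simp add: suminf_minus)
    qed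
  qed
qed

end

text \<open>A value \<open>z\<close> with nonzero real part at most primes would bias
  \<open>\<psi>\<close> itself. Otherwise \<open>z\<close> is \<open>i\<close> or \<open>-i\<close>,
  so the square of \<open>\<psi>\<close> is nonprincipal and equals \<open>- 1\<close> at most
  primes, which is a bias as well.\<close>

lemma character_not_constant:
  assumes l: "l > 0" and \<psi>: "dirichlet_char l \<psi>" "\<exists>n. coprime n l \<and> \<psi> n \<noteq> 1"
  shows "\<not> (\<lambda>p. 1 / real p) summable_on {p\<in>primes_to l. \<psi> p \<noteq> z}"
proof
  assume s: "(\<lambda>p. 1 / real p) summable_on {p\<in>primes_to l. \<psi> p \<noteq> z}"
  interpret nonprincipal_char l \<psi> by unfold_locales (use assms in auto)
  have "\<not> primes_to l \<subseteq> {p\<in>primes_to l. \<psi> p \<noteq> z}"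
    using summable_on_subset_banach[OF s] nonsummable_primes_to[OF l] by blast
  then obtain p0 where p0: "coprime p0 l" "\<psi> p0 = z" by (auto simp: primes_to_def)
  have case1: "Re z = 0"
  proof (rule ccontr)
    assume "Re z \<noteq> 0"
    then obtain s' where s': "s' = 1 \<or> s' = (- 1 :: real)" "s' * Re z > 0" by (cases "Re z > 0") force+
    have "(\<lambda>p. 1 / real p) summable_on {p\<in>primes_to l. s' * Re (\<psi> p) < s' * Re z}"
      by (rule summable_on_subset_banach[OF s]) auto
    with not_biased[OF s'(2,1)] show False by contradiction
  qed
  have "cmod z = 1" using norm_one[OF p0(1)] p0(2) by simp
  then have "(Im z)\<^sup>2 = 1" using case1 cmod_power2[of z] by simp
  then have z2: "z ^ 2 = - 1" using case1 by (simp add: complex_eq_iff power2_eq_square)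
  interpret S: nonprincipal_char l "\<lambda>n. \<psi> n ^ 2"
  proof
    show "\<exists>n. coprime n l \<and> \<psi> n ^ 2 \<noteq> 1" using p0 z2 by (intro exI[of _ p0]) auto
  qed (use l dirichlet_char_square in auto)
  have "(\<lambda>p. 1 / real p) summable_on {p\<in>primes_to l. - 1 * Re (\<psi> p ^ 2) < 1}"
    by (rule summable_on_subset_banach[OF s]) (use z2 in auto)
  with S.not_biased[of 1 "- 1"] show False by simp
qed

section \<open>Shift invariance of limit profiles\<close>

text \<open>
  The value \<open>\<Phi> k c u\<close> models a limit of means of \<open>f(\<Omega>(n) + k)\<close> over \<open>n \<le> N e\<^sup>u\<close>, \<open>n \<equiv> c (mod l)\<close>.
\<close>

locale profile =
  fixes l :: nat and \<Phi> :: "nat \<Rightarrow> nat \<Rightarrow> real \<Rightarrow> real"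
  assumes l_pos: "l > 0"
    and class_cong: "[c = c'] (mod l) \<Longrightarrow> \<Phi> k c u = \<Phi> k c' u"
    and lipschitz: "\<bar>\<Phi> k c u - \<Phi> k c v\<bar> \<le> 2 * \<bar>u - v\<bar>"
    and turan_kubilius: "finite A \<Longrightarrow> A \<subseteq> primes_to l \<Longrightarrow>
      (\<Sum>p\<in>A. (\<Phi> k c u - \<Phi> (Suc k) (c * inv_mod l p) (u - ln p))\<^sup>2 / p) \<le> 1"
begin

text \<open>If the discrepancy exceeded \<open>e\<close> by \<open>\<eta>\<close>, every finite part
  of \<open>A\<close> would contribute \<open>\<eta>\<^sup>2\<close> times its sum of reciprocals to
  \<open>turan_kubilius\<close>, which bounds that sum by \<open>1 / \<eta>\<^sup>2\<close>. Thus
  \<open>\<Phi> k c u\<close> can be read off from any divergent set of primes.\<close>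

lemma limit_relation:
  assumes A: "A \<subseteq> primes_to l" and ns: "\<not> (\<lambda>p. 1 / real p) summable_on A"
    and close: "\<And>p. p \<in> A \<Longrightarrow> \<bar>\<Phi> (Suc k) (c * inv_mod l p) (u - ln p) - v\<bar> \<le> e"
  shows "\<bar>\<Phi> k c u - v\<bar> \<le> e"
proof (rule ccontr)
  assume neg: "\<not> ?thesis"
  define \<eta> where "\<eta> = \<bar>\<Phi> k c u - v\<bar> - e"
  have \<eta>: "\<eta> > 0" using neg by (simp add: \<eta>_def)
  have "(\<lambda>p. 1 / real p) summable_on A"
  proof (rule nonneg_bdd_above_summable_on)
    show "bdd_above (sum (\<lambda>p. 1 / real p) ` {F. F \<subseteq> A \<and> finite F})"
    proof (rule bdd_aboveI2)
      fix F assume F: "F \<in> {F. F \<subseteq> A \<and> finite F}"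
      have "\<eta>\<^sup>2 * (\<Sum>p\<in>F. 1 / real p) \<le> (\<Sum>p\<in>F. (\<Phi> k c u - \<Phi> (Suc k) (c * inv_mod l p) (u - ln p))\<^sup>2 / p)"
        unfolding sum_distrib_left
      proof (rule sum_mono)
        fix p assume "p \<in> F"
        then have "\<eta> \<le> \<bar>\<Phi> k c u - \<Phi> (Suc k) (c * inv_mod l p) (u - ln p)\<bar>"
          using close[of p] F unfolding \<eta>_def by fastforce
        then have "\<eta>\<^sup>2 \<le> (\<Phi> k c u - \<Phi> (Suc k) (c * inv_mod l p) (u - ln p))\<^sup>2"
          using \<eta> by (metis abs_of_pos power2_abs power_mono less_imp_le)
        then show "\<eta>\<^sup>2 * (1 / real p) \<le> (\<Phi> k c u - \<Phi> (Suc k) (c * inv_mod l p) (u - ln p))\<^sup>2 / p"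
          by (simp add: divide_right_mono)
      qed
      also have "\<dots> \<le> 1" using F A by (intro turan_kubilius) auto
      finally show "(\<Sum>p\<in>F. 1 / real p) \<le> 1 / \<eta>\<^sup>2" using \<eta> by (simp add: field_simps)
    qed
  qed auto
  with ns show False by contradiction
qed

text \<open>
  If \<open>p < p'\<close> are primes, the relations for \<open>(c, u)\<close> at \<open>p\<close> and for \<open>(c p'/p, u + ln p' - ln p)\<close> at \<open>p'\<close>
  have the same right-hand side. By Mertens' theorem, the pairs with \<open>p'/p\<close> between \<open>e\<^sup>K\<close> and
  \<open>e\<^sup>2\<^sup>K\<close> have infinite total weight for \<open>w(p, p') = ln p' / (p p')\<close>, while each of the two relations fails
  only on pairs of finite weight. Hence any cluster value \<open>(b, q)\<close> of \<open>(p'/p mod l, ln p' - ln p)\<close> is a period.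
\<close>
lemma twisted_period:
  obtains b q where "coprime b l" "q > 0" "\<forall>k c u. \<Phi> k c u = \<Phi> k (c * b) (u + q)"
proof -
  define P where "P = primes_to l"
  define S where "S x = (\<Sum>p | p \<in> P \<and> real p \<le> x. ln p / p)" for x :: real
  obtain C where C: "\<And>x. x \<ge> 1 \<Longrightarrow> \<bar>S x - ln x\<bar> \<le> C"
    using mertens_bound[OF l_pos] unfolding S_def P_def by metis
  have C0: "C \<ge> 0" using C[of 1] by simp
  \<comment> \<open>Mertens' theorem errs by at most \<open>C\<close> at each end of a window, so
    logarithmic length \<open>2 * C + 1\<close> guarantees weight at least 1.\<close>
  define K where "K = 2 * C + 1"
  have K: "K \<ge> 1" "K > 0" using C0 by (auto simp: K_def)
  define W where "W a b = {p \<in> P. a < real p \<and> real p \<le> b}" for a b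
  have finW: "finite (W a b)" for a b
    by (rule finite_subset[of _ "{..nat \<lfloor>b\<rfloor>}"]) (auto simp: W_def le_nat_floor)
  have finS: "finite {p. p \<in> P \<and> real p \<le> x}" for x
    by (rule finite_subset[of _ "{..nat \<lfloor>x\<rfloor>}"]) (auto simp: le_nat_floor)
  have P1: "real p > 1" if "p \<in> P" for p
    using that prime_gt_1_nat by (auto simp: P_def primes_to_def)
  have sumW: "\<bar>(\<Sum>p\<in>W (x * exp s) (x * exp t). ln p / p) - (t - s)\<bar> \<le> 2 * C"
    if "x * exp s \<ge> 1" "s \<le> t" "x > 0" for x s t
  proof -
    have le: "x * exp s \<le> x * exp t" using that by simp
    have "{p. p \<in> P \<and> real p \<le> x * exp t} = {p. p \<in> P \<and> real p \<le> x * exp s} \<union> W (x * exp s) (x * exp t)"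
      using le by (auto simp: W_def)
    then have "S (x * exp t) = S (x * exp s) + (\<Sum>p\<in>W (x * exp s) (x * exp t). ln p / p)"
      unfolding S_def by (subst sum.union_disjoint[symmetric]) (use finS finW in \<open>auto simp: W_def\<close>)
    moreover have "ln (x * exp t) = ln x + t" "ln (x * exp s) = ln x + s"
      using that by (auto simp: ln_mult)
    ultimately show ?thesis using C[of "x * exp t"] C[of "x * exp s"] that le by linarith
  qed
  \<comment> \<open>For \<open>p\<close> this large its partners satisfy
    \<open>ln p' \<le> ln p + 2 * K \<le> 2 * ln p\<close>, and the windows below \<open>p'\<close>
    start beyond 1, where Mertens' theorem applies.\<close>
  define P' where "P' = {p \<in> P. ln p \<ge> 2 * K}"
  define Q where "Q p = W (p * exp K) (p * exp (2 * K))" for p :: nat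
  define R where "R = Sigma P' Q"
  \<comment> \<open>The factor \<open>ln p'\<close> balances the weight: summed over the partners
    \<open>p'\<close> it is comparable with \<open>1 / p\<close>, and summed over \<open>p\<close>
    it is at most a constant times \<open>1 / p'\<close>.\<close>
  define w where "w = (\<lambda>(p :: nat, p' :: nat). ln p' / (real p * real p'))"
  have sumQ: "(\<Sum>p'\<in>Q p. ln p' / p') \<ge> 1" "(\<Sum>p'\<in>Q p. ln p' / p') \<le> 2 * K" if "p \<in> P" for p
  proof -
    have "real p * exp K \<ge> 1" using P1[OF that] K by (simp add: mult_ge1_I)
    then have "\<bar>(\<Sum>p'\<in>Q p. ln p' / p') - (2 * K - K)\<bar> \<le> 2 * C"
      unfolding Q_def using P1[OF that] K by (intro sumW) auto
    then show "(\<Sum>p'\<in>Q p. ln p' / p') \<ge> 1" "(\<Sum>p'\<in>Q p. ln p' / p') \<le> 2 * K"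
      by (auto simp: K_def)
  qed
  have w0: "w x \<ge> 0" if "x \<in> R" for x
    using that P1 by (force simp: w_def R_def Q_def W_def intro!: divide_nonneg_nonneg)
  have nsP': "\<not> (\<lambda>p. 1 / real p) summable_on P'"
  proof
    assume s1: "(\<lambda>p. 1 / real p) summable_on P'"
    have "finite {p \<in> P. \<not> ln p \<ge> 2 * K}"
    proof (rule finite_subset)
      show "{p \<in> P. \<not> ln p \<ge> 2 * K} \<subseteq> {p. p \<in> P \<and> real p \<le> exp (2 * K)}"
      proof safe
        fix p assume "p \<in> P" "\<not> ln (real p) \<ge> 2 * K"
        then show "real p \<le> exp (2 * K)" using P1[of p] by (metis exp_less_cancel_iff exp_ln less_imp_le not_le order_less_trans zero_less_one)
      qed
    qed (rule finS)
    then have "(\<lambda>p. 1 / real p) summable_on P"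
      using s1 by (intro summable_on_split[of _ P "\<lambda>p. ln p \<ge> 2 * K"]) (auto simp: P'_def)
    with nonsummable_primes_to[OF l_pos] show False by (simp add: P_def)
  qed
  have ns: "\<not> w summable_on R"
  proof
    assume "w summable_on R"
    then have "(\<lambda>p. infsum (\<lambda>p'. w (p, p')) (Q p)) summable_on P'"
      unfolding R_def by (rule summable_on_Sigma_banach[of "\<lambda>p p'. w (p, p')", simplified])
    then have s: "(\<lambda>p. \<Sum>p'\<in>Q p. w (p, p')) summable_on P'"
      by (simp add: Q_def finW)
    have "(\<lambda>p. 1 / real p) summable_on P'"
    proof (rule summable_on_comparison_test[OF s])
      fix p assume p: "p \<in> P'"
      have "(\<Sum>p'\<in>Q p. w (p, p')) = (\<Sum>p'\<in>Q p. ln p' / p') / p"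
        by (simp add: w_def sum_divide_distrib mult.commute)
      also have "\<dots> \<ge> 1 / p" using sumQ(1)[of p] p by (intro divide_right_mono) (auto simp: P'_def)
      finally show "1 / real p \<le> (\<Sum>p'\<in>Q p. w (p, p'))" .
    qed auto
    with nsP' show False by contradiction
  qed
  obtain b where b: "\<not> w summable_on {x\<in>R. (snd x * inv_mod l (fst x)) mod l = b}"
    by (rule nonsummable_on_fiber[OF ns, of "\<lambda>x. (snd x * inv_mod l (fst x)) mod l" "{..<l}"]) (use l_pos in auto)
  define R1 where "R1 = {x\<in>R. (snd x * inv_mod l (fst x)) mod l = b}"
  have g: "ln (real (snd x)) - ln (real (fst x)) \<in> {K..2 * K}" if "x \<in> R1" for x
  proof -
    have x: "fst x \<in> P" "fst x * exp K < snd x" "snd x \<le> fst x * exp (2 * K)"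
      using that by (auto simp: R1_def R_def P'_def Q_def W_def)
    have pos: "0 < fst x * exp K" using P1[OF x(1)] by simp
    then have pos': "0 < real (snd x)" using x(2) by linarith
    have "ln (fst x * exp K) \<le> ln (real (snd x))" "ln (real (snd x)) \<le> ln (fst x * exp (2 * K))"
      using ln_mono[OF less_imp_le[OF x(2)] pos] ln_mono[OF x(3) pos'] by auto
    then show ?thesis using P1[OF x(1)] by (simp add: ln_mult)
  qed
  obtain q where q: "q \<in> {K..2 * K}"
    "\<And>e. e > 0 \<Longrightarrow> \<not> w summable_on {x\<in>R1. \<bar>ln (real (snd x)) - ln (real (fst x)) - q\<bar> < e}"
    by (rule nonsummable_on_cluster[of w R1 "\<lambda>x. ln (real (snd x)) - ln (real (fst x))" K "2 * K"])
      (use b g in \<open>auto simp: R1_def\<close>)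
  have cop: "coprime b l"
  proof -
    have "{x\<in>R. (snd x * inv_mod l (fst x)) mod l = b} \<noteq> {}"
      using b by (metis summable_on_empty)
    then obtain p p' where "p \<in> P" "p' \<in> P" "(p' * inv_mod l p) mod l = b"
      by (auto simp: R_def P'_def Q_def W_def)
    then show ?thesis using coprime_inv_mod[of p l] l_pos
      by (auto simp: P_def primes_to_def)
  qed
  have eq: "\<Phi> k c u = \<Phi> k (c * b) (u + q)" for k c u
  proof (rule ccontr)
    assume ne: "\<Phi> k c u \<noteq> \<Phi> k (c * b) (u + q)"
    define \<eta> where "\<eta> = \<bar>\<Phi> k c u - \<Phi> k (c * b) (u + q)\<bar>"
    have \<eta>: "\<eta> > 0" using ne by (simp add: \<eta>_def)
    define \<alpha> where "\<alpha> p = \<Phi> k c u - \<Phi> (Suc k) (c * inv_mod l p) (u - ln p)" for p :: nat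
    define \<beta> where "\<beta> p = \<Phi> k (c * b) (u + q) - \<Phi> (Suc k) (c * b * inv_mod l p) (u + q - ln p)" for p :: nat
    define G where "G = {x\<in>R1. \<bar>ln (real (snd x)) - ln (real (fst x)) - q\<bar> < \<eta> / 8}"
    have nsG: "\<not> w summable_on G" unfolding G_def using \<eta> by (intro q(2)) auto
    \<comment> \<open>As \<open>c * b / p'\<close> and \<open>c / p\<close> are the same class, both
      relations meet in one value of \<open>\<Phi> (Suc k)\<close> up to \<open>\<eta> / 4\<close>.
      So \<open>\<alpha> p\<close> and \<open>\<beta> p'\<close> cannot both be small.\<close>
    have key: "\<eta>\<^sup>2 / 4 \<le> (\<alpha> p)\<^sup>2 + (\<beta> p')\<^sup>2" if "(p, p') \<in> G" for p p'
    proof -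
      have pp: "p \<in> P" "p' \<in> P" "(p' * inv_mod l p) mod l = b" "\<bar>ln p' - ln p - q\<bar> < \<eta> / 8"
        using that by (auto simp: G_def R1_def R_def P'_def Q_def W_def)
      have "[c * b * inv_mod l p' = c * (p' * inv_mod l p) * inv_mod l p'] (mod l)"
        unfolding pp(3)[symmetric] by (intro cong_mult cong_refl) (simp add: cong_def)
      also have "c * (p' * inv_mod l p) * inv_mod l p' = c * inv_mod l p * p' * inv_mod l p'"
        by (simp add: mult_ac)
      also have "[\<dots> = c * inv_mod l p] (mod l)"
        using inv_mod_cancel[of l p'] pp(2) l_pos by (simp add: P_def primes_to_def)
      finally have "\<beta> p' = \<Phi> k (c * b) (u + q) - \<Phi> (Suc k) (c * inv_mod l p) (u + q - ln p')"
        unfolding \<beta>_def by (simp add: class_cong)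
      then have "\<eta> \<le> \<bar>\<alpha> p\<bar> + \<bar>\<beta> p'\<bar>
          + \<bar>\<Phi> (Suc k) (c * inv_mod l p) (u + q - ln p') - \<Phi> (Suc k) (c * inv_mod l p) (u - ln p)\<bar>"
        unfolding \<eta>_def \<alpha>_def by arith
      also have "\<bar>\<Phi> (Suc k) (c * inv_mod l p) (u + q - ln p') - \<Phi> (Suc k) (c * inv_mod l p) (u - ln p)\<bar>
          \<le> 2 * \<bar>(u + q - ln p') - (u - ln p)\<bar>"
        by (rule lipschitz)
      also have "\<bar>(u + q - ln p') - (u - ln p)\<bar> = \<bar>ln p' - ln p - q\<bar>"
        by arith
      finally have "\<eta> \<le> \<bar>\<alpha> p\<bar> + \<bar>\<beta> p'\<bar> + 2 * \<bar>ln p' - ln p - q\<bar>"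
        by simp
      moreover have "2 * \<bar>ln p' - ln p - q\<bar> \<le> \<eta> / 4"
        using less_imp_le[OF pp(4)] by simp
      ultimately have "\<eta> \<le> \<bar>\<alpha> p\<bar> + \<bar>\<beta> p'\<bar> + \<eta> / 4"
        by (rule order_trans[OF _ add_left_mono])
      then have "3 * \<eta> / 4 \<le> \<bar>\<alpha> p\<bar> + \<bar>\<beta> p'\<bar>" by simp
      then have sq: "(3 * \<eta> / 4)\<^sup>2 \<le> (\<bar>\<alpha> p\<bar> + \<bar>\<beta> p'\<bar>)\<^sup>2" using \<eta> by (intro power_mono) auto
      have "(\<bar>\<alpha> p\<bar> + \<bar>\<beta> p'\<bar>)\<^sup>2 \<le> 2 * ((\<alpha> p)\<^sup>2 + (\<beta> p')\<^sup>2)"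
        using sum_squares_bound[of "\<bar>\<alpha> p\<bar>" "\<bar>\<beta> p'\<bar>"] by (simp add: power2_eq_square algebra_simps)
      with sq have "9 / 16 * \<eta>\<^sup>2 \<le> 2 * ((\<alpha> p)\<^sup>2 + (\<beta> p')\<^sup>2)"
        by (simp add: power_divide power_mult_distrib)
      then have "9 / 16 * \<eta>\<^sup>2 / 2 \<le> (\<alpha> p)\<^sup>2 + (\<beta> p')\<^sup>2" by simp
      moreover have "\<eta>\<^sup>2 / 4 \<le> 9 / 16 * \<eta>\<^sup>2 / 2" by simp
      ultimately show ?thesis by (rule order_trans[rotated])
    qed
    have "w summable_on G"
    proof (rule nonneg_bdd_above_summable_on)
      show "bdd_above (sum w ` {F. F \<subseteq> G \<and> finite F})"
      proof (rule bdd_aboveI2)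
        fix F assume F: "F \<in> {F. F \<subseteq> G \<and> finite F}"
        then have FG: "F \<subseteq> G" and fF: "finite F" by auto
        have FP: "x \<in> R" if "x \<in> F" for x using FG that by (auto simp: G_def R1_def)
        \<comment> \<open>The partners \<open>p'\<close> are summed first: the window above
          \<open>p\<close> has weight at most \<open>2 * K\<close>, and
          \<open>turan_kubilius\<close> handles the sum over \<open>p\<close>.\<close>
        have A: "(\<Sum>x\<in>F. w x * (\<alpha> (fst x))\<^sup>2) \<le> 2 * K"
        proof -
          have "(\<Sum>x\<in>F. w x * (\<alpha> (fst x))\<^sup>2) \<le> (\<Sum>x\<in>Sigma (fst ` F) Q. w x * (\<alpha> (fst x))\<^sup>2)"
          proof (rule sum_mono2)
            show "finite (Sigma (fst ` F) Q)" using fF finW by (auto simp: Q_def)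
            show "F \<subseteq> Sigma (fst ` F) Q" using FP by (force simp: R_def)
            fix x assume "x \<in> Sigma (fst ` F) Q - F"
            then have "x \<in> R" using FP by (force simp: R_def)
            then show "0 \<le> w x * (\<alpha> (fst x))\<^sup>2" using w0 by simp
          qed
          also have "\<dots> = (\<Sum>p\<in>fst ` F. \<Sum>p'\<in>Q p. w (p, p') * (\<alpha> p)\<^sup>2)"
            using fF finW by (subst sum.Sigma) (auto simp: Q_def split_def)
          also have "\<dots> = (\<Sum>p\<in>fst ` F. (\<alpha> p)\<^sup>2 / p * (\<Sum>p'\<in>Q p. ln p' / p'))"
            by (simp add: w_def sum_distrib_left mult_ac)
          also have "\<dots> \<le> (\<Sum>p\<in>fst ` F. (\<alpha> p)\<^sup>2 / p * (2 * K))"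
            using FP by (intro sum_mono mult_left_mono sumQ) (force simp: R_def P'_def)+
          also have "\<dots> = (\<Sum>p\<in>fst ` F. (\<alpha> p)\<^sup>2 / p) * (2 * K)"
            by (simp add: sum_distrib_right)
          also have "\<dots> \<le> 1 * (2 * K)"
            unfolding \<alpha>_def using fF FP K
            by (intro mult_right_mono turan_kubilius) (force simp: R_def P'_def P_def)+
          finally show ?thesis by simp
        qed
        have B: "(\<Sum>x\<in>F. w x * (\<beta> (snd x))\<^sup>2) \<le> 6 * K"
        proof -
          \<comment> \<open>Dually, \<open>p'\<close> is fixed and the primes \<open>p\<close> with
            partner \<open>p'\<close> are summed first. They lie in a window of logarithmic length
            \<open>2 * K\<close> below \<open>p'\<close>.\<close>
          define V where "V p' = {p \<in> P'. p' \<in> Q p}" for p'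
          have VW: "V p' \<subseteq> W (p' * exp (- 3 * K)) (p' * exp (- K))" for p'
          proof
            fix p assume "p \<in> V p'"
            then have p: "p \<in> P" "p * exp K < p'" "p' \<le> p * exp (2 * K)"
              by (auto simp: V_def P'_def Q_def W_def)
            have "p' * exp (- 3 * K) \<le> p * exp (2 * K) * exp (- 3 * K)"
              using p(3) by (intro mult_right_mono) auto
            also have "\<dots> = p * exp (- K)" by (simp add: mult.assoc flip: exp_add)
            also have "\<dots> < p" using P1[OF p(1)] K by simp
            finally have 1: "p' * exp (- 3 * K) < p" .
            have "p = p * exp K * exp (- K)" by (simp add: mult.assoc flip: exp_add)
            also have "\<dots> \<le> p' * exp (- K)" using p(2) by (intro mult_right_mono) auto
            finally show "p \<in> W (p' * exp (- 3 * K)) (p' * exp (- K))" using 1 p(1) by (simp add: W_def)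
          qed
          have finV: "finite (V p')" for p' using finite_subset[OF VW finW] .
          have sumV: "ln p' * (\<Sum>p\<in>V p'. 1 / real p) \<le> 6 * K" if p'F: "p' \<in> snd ` F" for p'
          proof -
            obtain p0 where "(p0, p') \<in> F" using p'F by force
            then have p0: "p0 \<in> P" "ln p0 \<ge> 2 * K" "p0 * exp K < p'"
              using FP by (force simp: R_def P'_def Q_def W_def)+
            have "exp (2 * K) \<le> p0" using p0 P1[OF p0(1)] by (metis exp_le_cancel_iff exp_ln order_less_trans zero_less_one)
            then have "exp (2 * K) * exp K * exp (- 3 * K) \<le> p0 * exp K * exp (- 3 * K)"
              by (intro mult_right_mono) auto
            also have "\<dots> \<le> p' * exp (- 3 * K)" using p0(3) by (intro mult_right_mono) auto
            finally have ge1: "p' * exp (- 3 * K) \<ge> 1" by (simp flip: exp_add)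
            have p'0: "real p' > 0" using ge1 by (metis mult_eq_0_iff not_one_le_zero of_nat_0_less_iff of_nat_eq_0_iff neq0_conv)
            have "ln p' * (\<Sum>p\<in>V p'. 1 / real p) \<le> (\<Sum>p\<in>V p'. 2 * (ln p / p))"
              unfolding sum_distrib_left
            proof (rule sum_mono)
              fix p assume "p \<in> V p'"
              then have p: "p \<in> P" "ln p \<ge> 2 * K" "p' \<le> p * exp (2 * K)"
                by (auto simp: V_def P'_def Q_def W_def)
              have "ln p' \<le> ln (p * exp (2 * K))" using p(3) p'0 P1[OF p(1)] by (subst ln_le_cancel_iff) auto
              also have "\<dots> = ln p + 2 * K" using P1[OF p(1)] by (simp add: ln_mult)
              finally have "ln p' \<le> 2 * ln p" using p(2) by simp
              then show "ln p' * (1 / p) \<le> 2 * (ln p / p)" using P1[OF p(1)] by (simp add: divide_simps)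
            qed
            also have "\<dots> \<le> (\<Sum>p\<in>W (p' * exp (- 3 * K)) (p' * exp (- K)). 2 * (ln p / p))"
            proof (rule sum_mono2[OF finW VW])
              fix p assume "p \<in> W (p' * exp (- 3 * K)) (p' * exp (- K)) - V p'"
              then have "real p > 1" using P1 by (auto simp: W_def)
              then show "0 \<le> 2 * (ln p / p)" by simp
            qed
            also have "\<dots> = 2 * (\<Sum>p\<in>W (p' * exp (- 3 * K)) (p' * exp (- K)). ln p / p)"
              by (simp add: sum_distrib_left)
            also have "\<dots> \<le> 2 * (2 * K + 2 * C)"
              using sumW[of p' "- 3 * K" "- K"] ge1 p'0 K by simp
            also have "\<dots> \<le> 6 * K" by (simp add: K_def)
            finally show ?thesis .
          qed
          have "(\<Sum>x\<in>F. w x * (\<beta> (snd x))\<^sup>2) \<le> (\<Sum>x\<in>prod.swap ` Sigma (snd ` F) V. w x * (\<beta> (snd x))\<^sup>2)"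
          proof (rule sum_mono2)
            show "finite (prod.swap ` Sigma (snd ` F) V)" using fF finV by auto
            show "F \<subseteq> prod.swap ` Sigma (snd ` F) V"
            proof
              fix x assume x: "x \<in> F"
              then have "prod.swap x \<in> Sigma (snd ` F) V" using FP[OF x] by (force simp: R_def V_def)
              then show "x \<in> prod.swap ` Sigma (snd ` F) V" by (metis image_eqI swap_swap)
            qed
            fix x assume "x \<in> prod.swap ` Sigma (snd ` F) V - F"
            then have "x \<in> R" by (auto simp: R_def V_def)
            then show "0 \<le> w x * (\<beta> (snd x))\<^sup>2" using w0 by simp
          qed
          also have "\<dots> = (\<Sum>x\<in>Sigma (snd ` F) V. w (prod.swap x) * (\<beta> (fst x))\<^sup>2)"
            by (subst sum.reindex) (auto intro: inj_onI)
          also have "\<dots> = (\<Sum>p'\<in>snd ` F. \<Sum>p\<in>V p'. w (p, p') * (\<beta> p')\<^sup>2)"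
            using fF finV by (subst sum.Sigma) (auto simp: split_def prod.swap_def)
          also have "\<dots> = (\<Sum>p'\<in>snd ` F. (\<beta> p')\<^sup>2 / p' * (ln p' * (\<Sum>p\<in>V p'. 1 / real p)))"
            by (simp add: w_def sum_distrib_left mult_ac)
          also have "\<dots> \<le> (\<Sum>p'\<in>snd ` F. (\<beta> p')\<^sup>2 / p' * (6 * K))"
            by (intro sum_mono mult_left_mono sumV) auto
          also have "\<dots> = (\<Sum>p'\<in>snd ` F. (\<beta> p')\<^sup>2 / p') * (6 * K)"
            by (simp add: sum_distrib_right)
          also have "\<dots> \<le> 1 * (6 * K)"
            unfolding \<beta>_def using fF FP K
            by (intro mult_right_mono turan_kubilius) (force simp: R_def Q_def W_def P_def)+
          finally show ?thesis by simp
        qed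
        have "\<eta>\<^sup>2 / 4 * sum w F \<le> (\<Sum>x\<in>F. w x * (\<alpha> (fst x))\<^sup>2 + w x * (\<beta> (snd x))\<^sup>2)"
          unfolding sum_distrib_left
        proof (rule sum_mono)
          fix x assume x: "x \<in> F"
          have "w x * (\<eta>\<^sup>2 / 4) \<le> w x * ((\<alpha> (fst x))\<^sup>2 + (\<beta> (snd x))\<^sup>2)"
            using key[of "fst x" "snd x"] x FG w0[OF FP[OF x]] by (intro mult_left_mono) auto
          then show "\<eta>\<^sup>2 / 4 * w x \<le> w x * (\<alpha> (fst x))\<^sup>2 + w x * (\<beta> (snd x))\<^sup>2"
            by (simp add: algebra_simps)
        qed
        also have "\<dots> \<le> 8 * K" using A B by (simp add: sum.distrib)
        finally show "sum w F \<le> 8 * K / (\<eta>\<^sup>2 / 4)" using \<eta> by (simp add: field_simps)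
      qed
    qed (use w0 in \<open>auto simp: G_def R1_def\<close>)
    with nsG show False by contradiction
  qed
  show thesis
  proof (rule that[OF cop])
    show "q > 0" using q(1) K by auto
    show "\<forall>k c u. \<Phi> k c u = \<Phi> k (c * b) (u + q)" using eq by (intro allI)
  qed
qed

lemma twisted_iterate:
  assumes "\<And>c u. \<Phi> k c u = \<Phi> k (c * b) (u + q)"
  shows "\<Phi> k c u = \<Phi> k (c * b ^ n) (u + of_nat n * q)"
proof (induction n)
  case (Suc n)
  also have "\<Phi> k (c * b ^ n) (u + of_nat n * q) = \<Phi> k (c * b ^ n * b) (u + of_nat n * q + q)"
    by (rule assms)
  finally show ?case by (simp add: algebra_simps)
qed auto

text \<open>After \<open>totient l\<close> iterations the twist is congruent to 1, and a plain
  period in \<open>u\<close> remains.\<close>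

lemma twisted_totient:
  assumes "\<And>c u. \<Phi> k c u = \<Phi> k (c * b) (u + q)" "coprime b l"
  shows "\<Phi> k c (u + of_nat (totient l) * q) = \<Phi> k c u"
proof -
  have "[c * b ^ totient l = c * 1] (mod l)"
    using euler_theorem[OF assms(2)] by (rule cong_mult[OF cong_refl])
  then show ?thesis using twisted_iterate[OF assms(1), of c u "totient l"] by (simp add: class_cong)
qed

text \<open>
  The periods in \<open>u\<close> form a nontrivial closed subgroup \<open>H\<close> of the reals. If it were \<open>\<kappa>0 \<int>\<close>, then \<open>ln p\<close>
  would be close to a fixed value modulo \<open>\<kappa>0 / totient l\<close> for most primes \<open>p\<close>, contradicting the behaviour of \<open>\<zeta>\<close>
  near \<open>1 + i \<tau>\<close>.
\<close>
lemma translation_invariant: "\<Phi> k c u = \<Phi> k c v"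
proof (rule ccontr)
  assume ne: "\<Phi> k c u \<noteq> \<Phi> k c v"
  define P where "P = primes_to l"
  define H where "H = {h. \<forall>k c u. \<Phi> k c (u + h) = \<Phi> k c u}"
  have HD: "\<Phi> k c (u + h) = \<Phi> k c u" if "h \<in> H" for k c u h using that by (simp add: H_def)
  have Hadd: "h + h' \<in> H" if "h \<in> H" "h' \<in> H" for h h'
    using HD[OF that(1)] HD[OF that(2)] unfolding H_def by (simp flip: add.assoc)
  have Hneg: "- h \<in> H" if "h \<in> H" for h
    unfolding H_def using HD[OF that, of _ _ "_ - h"] by simp
  have Hnat: "of_nat n * h \<in> H" if "h \<in> H" for n h
    using that by (induction n) (auto simp: ring_distribs intro!: Hadd, simp add: H_def)
  have Hint: "of_int n * h \<in> H" if "h \<in> H" for n h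
    using Hnat[OF that, of "nat n"] Hneg[OF Hnat[OF that, of "nat (- n)"]] by (cases "n \<ge> 0") auto
  \<comment> \<open>The Lipschitz bound makes \<open>\<Phi>\<close> continuous in \<open>u\<close>,
    so limits of periods are periods.\<close>
  have Hclosed: "h \<in> H" if h: "\<And>e. e > 0 \<Longrightarrow> \<exists>h'\<in>H. \<bar>h - h'\<bar> < e" for h
  proof -
    have "\<Phi> k c (u + h) = \<Phi> k c u" for k c u
    proof (rule ccontr)
      assume "\<Phi> k c (u + h) \<noteq> \<Phi> k c u"
      then obtain h' where h': "h' \<in> H" "\<bar>h - h'\<bar> < \<bar>\<Phi> k c (u + h) - \<Phi> k c u\<bar> / 2"
        using h[of "\<bar>\<Phi> k c (u + h) - \<Phi> k c u\<bar> / 2"] by auto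
      then show False using lipschitz[of k c "u + h" "u + h'"] HD[OF h'(1), of k c u] by simp
    qed
    then show ?thesis by (simp add: H_def)
  qed
  have not_H: "v - u \<notin> H" using HD[of "v - u" k c u] ne by auto
  obtain \<kappa> where \<kappa>: "\<kappa> > 0" "\<kappa> \<in> H"
  proof -
    obtain b q where b: "coprime b l" "q > 0" "\<forall>k c u. \<Phi> k c u = \<Phi> k (c * b) (u + q)"
      by (rule twisted_period)
    have "of_nat (totient l) * q \<in> H"
      unfolding H_def by (intro CollectI allI twisted_totient[OF _ b(1)] b(3)[rule_format])
    then show thesis using that[of "of_nat (totient l) * q"] b(2) l_pos by simp
  qed
  define D where "D = H \<inter> {0<..}"
  have D: "D \<noteq> {}" "bdd_below D" using \<kappa> by (auto simp: D_def intro!: bdd_belowI[of _ 0])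
  \<comment> \<open>If this infimum of the positive periods is 0, the group is dense, hence contains
    \<open>v - u\<close>; if it is positive, it generates the group.\<close>
  define \<kappa>0 where "\<kappa>0 = Inf D"
  have near: "\<exists>h\<in>D. \<kappa>0 \<le> h \<and> h < \<kappa>0 + e" if "e > 0" for e
    using cInf_less_iff[OF D, of "\<kappa>0 + e"] cInf_lower[OF _ D(2)] that unfolding \<kappa>0_def by auto
  have "\<kappa>0 \<ge> 0" unfolding \<kappa>0_def using D(1) by (intro cInf_greatest) (auto simp: D_def)
  moreover have "\<kappa>0 \<noteq> 0"
  proof
    assume 0: "\<kappa>0 = 0"
    have "v - u \<in> H"
    proof (rule Hclosed)
      fix e :: real assume "e > 0"
      then obtain h where h: "h \<in> D" "h < e" using near[of e] 0 by auto
      then have h0: "h > 0" "h \<in> H" by (auto simp: D_def)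
      have "\<bar>(v - u) - of_int \<lfloor>(v - u) / h\<rfloor> * h\<bar> < e"
        using floor_divide_lower[OF h0(1), of "v - u"] floor_divide_upper[OF h0(1), of "v - u"] h(2)
        by (simp add: algebra_simps)
      then show "\<exists>h'\<in>H. \<bar>(v - u) - h'\<bar> < e" using Hint[OF h0(2)] by blast
    qed
    with not_H show False by contradiction
  qed
  ultimately have \<kappa>0: "\<kappa>0 > 0" by simp
  have \<kappa>0H: "\<kappa>0 \<in> H"
  proof (rule Hclosed)
    fix e :: real assume "e > 0"
    then show "\<exists>h'\<in>H. \<bar>\<kappa>0 - h'\<bar> < e" using near[of e] by (force simp: D_def)
  qed
  have lattice: "\<exists>n. h = of_int n * \<kappa>0" if h: "h \<in> H" for h
  proof -
    define r where "r = h + - (of_int \<lfloor>h / \<kappa>0\<rfloor> * \<kappa>0)"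
    have "r \<in> H" unfolding r_def by (intro Hadd h Hneg Hint \<kappa>0H)
    moreover have "0 \<le> r" "r < \<kappa>0"
      using floor_divide_lower[OF \<kappa>0, of h] floor_divide_upper[OF \<kappa>0, of h] by (auto simp: r_def algebra_simps)
    ultimately have "r = 0" using cInf_lower[OF _ D(2), of r] unfolding \<kappa>0_def[symmetric]
      by (force simp: D_def)
    then show ?thesis by (auto simp: r_def)
  qed
  \<comment> \<open>\<open>ln p\<close> reduced modulo the period: this is all that
    \<open>\<Phi>\<close> sees of \<open>ln p\<close>, and it is bounded, so cluster values
    exist.\<close>
  define g where "g p = ln p - of_int \<lfloor>ln p / \<kappa>0\<rfloor> * \<kappa>0" for p :: nat
  have g: "g p \<in> {0..\<kappa>0}" for p
    using floor_divide_lower[OF \<kappa>0, of "ln p"] floor_divide_upper[OF \<kappa>0, of "ln p"] by (auto simp: g_def algebra_simps)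
  have per: "\<Phi> k c (u - ln p) = \<Phi> k c (u - g p)" for k c u and p :: nat
    using HD[OF Hneg[OF Hint[OF \<kappa>0H]], of k c "u - g p" "\<lfloor>ln p / \<kappa>0\<rfloor>"] by (simp add: g_def)
  \<comment> \<open>On a divergent set of primes, fix the class of the inverse of \<open>p\<close>
    and a cluster value \<open>q\<close> of \<open>g p\<close>. Then \<open>limit_relation\<close>
    holds with every \<open>e > 0\<close>, which makes it an exact identity.\<close>
  have cluster: "\<exists>a q. coprime a l \<and> (\<forall>e>0. \<exists>p\<in>A. \<bar>g p - q\<bar> < e) \<and>
      (\<forall>k c u. \<Phi> k c u = \<Phi> (Suc k) (c * a) (u - q))"
    if A: "A \<subseteq> P" "\<not> (\<lambda>p. 1 / real p) summable_on A" for A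
  proof -
    obtain a where a: "\<not> (\<lambda>p. 1 / real p) summable_on {p\<in>A. inv_mod l p mod l = a}"
      by (rule nonsummable_on_fiber[OF A(2), of "\<lambda>p. inv_mod l p mod l" "{..<l}"]) (use l_pos in auto)
    define A' where "A' = {p\<in>A. inv_mod l p mod l = a}"
    obtain q where q: "\<And>e. e > 0 \<Longrightarrow> \<not> (\<lambda>p. 1 / real p) summable_on {p\<in>A'. \<bar>g p - q\<bar> < e}"
      by (rule nonsummable_on_cluster[of "\<lambda>p. 1 / real p" A' g 0 \<kappa>0]) (use a g in \<open>auto simp: A'_def\<close>)
    have ex: "\<exists>p\<in>A'. \<bar>g p - q\<bar> < e" if "e > 0" for e
    proof -
      have "{p\<in>A'. \<bar>g p - q\<bar> < e} \<noteq> {}" using q[OF that] by (metis summable_on_empty)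
      then show ?thesis by auto
    qed
    have "coprime a l"
    proof -
      obtain p where "p \<in> A'" using ex[of 1] by auto
      then have "coprime (inv_mod l p mod l) l" "inv_mod l p mod l = a"
        using A l_pos coprime_inv_mod[of p l] by (auto simp: A'_def P_def primes_to_def)
      then show ?thesis by simp
    qed
    moreover have "\<forall>e>0. \<exists>p\<in>A. \<bar>g p - q\<bar> < e" using ex by (auto simp: A'_def)
    moreover have "\<Phi> k c u = \<Phi> (Suc k) (c * a) (u - q)" for k c u
    proof -
      have "\<bar>\<Phi> k c u - \<Phi> (Suc k) (c * a) (u - q)\<bar> \<le> 0 + e" if e: "e > 0" for e
      proof -
        have "\<bar>\<Phi> k c u - \<Phi> (Suc k) (c * a) (u - q)\<bar> \<le> e"
        proof (rule limit_relation)
          show "{p\<in>A'. \<bar>g p - q\<bar> < e / 2} \<subseteq> primes_to l" using A by (auto simp: A'_def P_def)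
          show "\<not> (\<lambda>p. 1 / real p) summable_on {p\<in>A'. \<bar>g p - q\<bar> < e / 2}" using e by (intro q) auto
          fix p assume p: "p \<in> {p\<in>A'. \<bar>g p - q\<bar> < e / 2}"
          have "[c * inv_mod l p = c * a] (mod l)"
            using p by (intro cong_mult cong_refl) (auto simp: A'_def cong_def)
          then have "\<Phi> (Suc k) (c * inv_mod l p) (u - ln p) = \<Phi> (Suc k) (c * a) (u - g p)"
            unfolding per by (rule class_cong)
          then show "\<bar>\<Phi> (Suc k) (c * inv_mod l p) (u - ln p) - \<Phi> (Suc k) (c * a) (u - q)\<bar> \<le> e"
            using lipschitz[of "Suc k" "c * a" "u - g p" "u - q"] p by (auto simp: abs_minus_commute[of q])
        qed
        then show ?thesis by simp
      qed
      then have "\<bar>\<Phi> k c u - \<Phi> (Suc k) (c * a) (u - q)\<bar> \<le> 0" by (rule field_le_epsilon)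
      then show ?thesis by simp
    qed
    ultimately show ?thesis by blast
  qed
  obtain a1 q1 where 1: "coprime a1 l" "\<And>k c u. \<Phi> k c u = \<Phi> (Suc k) (c * a1) (u - q1)"
    using cluster[of P] nonsummable_primes_to[OF l_pos] unfolding P_def by blast
  \<comment> \<open>The factor \<open>totient l\<close> is there because two cluster values are only
    known to differ by a period after multiplication by \<open>totient l\<close>, which removes the
    twist.\<close>
  define \<tau> where "\<tau> = 2 * pi * totient l / \<kappa>0"
  have \<tau>: "\<tau> > 0" using \<kappa>0 l_pos by (simp add: \<tau>_def)
  have cis_period: "cis (x + \<tau> * (of_int n * \<kappa>0)) = cis x" for x n
  proof -
    have "\<tau> * (of_int n * \<kappa>0) = 2 * pi * of_int (int (totient l) * n)" using \<kappa>0 by (simp add: \<tau>_def)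
    then show ?thesis by (simp only: cis_mult[symmetric] cis_multiple_2pi Ints_of_int mult_1_right)
  qed
  show False
  proof (rule prime_rotation[OF l_pos, of \<tau> "\<tau> * q1"])
    fix e :: real assume e: "e > 0"
    define A where "A = {p\<in>primes_to l. \<not> cmod (cis (\<tau> * ln p) - cis (\<tau> * q1)) < e}"
    show "(\<lambda>p. 1 / real p) summable_on A"
    proof (rule ccontr)
      assume ns: "\<not> ?thesis"
      have "A \<subseteq> P" by (auto simp: A_def P_def)
      from cluster[OF this ns] obtain a2 q2 where 2: "coprime a2 l"
        "\<And>e. e > 0 \<Longrightarrow> \<exists>p\<in>A. \<bar>g p - q2\<bar> < e" "\<And>k c u. \<Phi> k c u = \<Phi> (Suc k) (c * a2) (u - q2)" by metis
      \<comment> \<open>The relations with data \<open>(a1, q1)\<close> and \<open>(a2, q2)\<close>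
        start from the same level \<open>k\<close>; eliminating that level leaves a twisted period
        \<open>q1 - q2\<close> at level \<open>Suc k\<close>.\<close>
      have tw: "\<Phi> (Suc k) c u = \<Phi> (Suc k) (c * (inv_mod l a1 * a2)) (u + (q1 - q2))" for k c u
      proof -
        have "\<Phi> (Suc k) c u = \<Phi> (Suc k) (c * inv_mod l a1 * a1) (u + q1 - q1)"
          using inv_mod_cancel(1)[OF l_pos 1(1), of c] by (simp add: class_cong)
        also have "\<dots> = \<Phi> k (c * inv_mod l a1) (u + q1)" by (rule 1(2)[symmetric])
        also have "\<dots> = \<Phi> (Suc k) (c * inv_mod l a1 * a2) (u + q1 - q2)" by (rule 2(3))
        finally show ?thesis by (simp add: mult_ac algebra_simps)
      qed
      have "coprime (inv_mod l a1 * a2) l" using 1(1) 2(1) coprime_inv_mod by simp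
      note tt = twisted_totient[OF tw this]
      \<comment> \<open>The period was found at levels \<open>Suc k\<close>; the first relation
        carries it down to every level \<open>k\<close>, as membership in \<open>H\<close>
        requires.\<close>
      have "of_nat (totient l) * (q1 - q2) \<in> H"
        unfolding H_def
      proof (intro CollectI allI)
        fix k c u
        show "\<Phi> k c (u + of_nat (totient l) * (q1 - q2)) = \<Phi> k c u"
          using tt[of k "c * a1" "u - q1"] 1(2)[of k c u] 1(2)[of k c "u + of_nat (totient l) * (q1 - q2)"]
          by (simp add: algebra_simps)
      qed
      then obtain n where n: "of_nat (totient l) * (q1 - q2) = of_int n * \<kappa>0" using lattice by blast
      have "\<tau> * q1 = \<tau> * q2 + 2 * pi * of_int n"
      proof -
        have "\<tau> * (q1 - q2) = 2 * pi * (of_nat (totient l) * (q1 - q2)) / \<kappa>0" by (simp add: \<tau>_def)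
        also have "\<dots> = 2 * pi * of_int n" unfolding n using \<kappa>0 by simp
        finally show ?thesis by (simp add: algebra_simps)
      qed
      then have cq: "cis (\<tau> * q1) = cis (\<tau> * q2)"
        by (simp only: cis_mult[symmetric] cis_multiple_2pi Ints_of_int mult_1_right)
      obtain p where p: "p \<in> A" "\<bar>g p - q2\<bar> < e / \<tau>" using 2(2)[of "e / \<tau>"] e \<tau> by auto
      have "cis (\<tau> * ln p) = cis (\<tau> * g p + \<tau> * (of_int \<lfloor>ln p / \<kappa>0\<rfloor> * \<kappa>0))"
        by (simp add: g_def algebra_simps)
      then have "cis (\<tau> * ln p) = cis (\<tau> * g p)" by (simp only: cis_period)
      moreover have "cmod (cis (\<tau> * g p) - cis (\<tau> * q2)) \<le> \<bar>\<tau> * g p - \<tau> * q2\<bar>"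
        by (rule cmod_cis_diff_le)
      moreover have "\<bar>\<tau> * g p - \<tau> * q2\<bar> = \<bar>g p - q2\<bar> * \<tau>"
        using \<tau> unfolding right_diff_distrib[symmetric] abs_mult by simp
      moreover have "\<bar>g p - q2\<bar> * \<tau> < e" using p(2) \<tau> by (simp add: pos_less_divide_eq)
      ultimately have "cmod (cis (\<tau> * ln p) - cis (\<tau> * q1)) < e" using cq by simp
      with p(1) show False by (simp add: A_def)
    qed
  qed (use \<tau> in auto)
qed

text \<open>With \<open>u\<close> gone, every divergent set of primes yields
  \<open>\<Phi> k c = \<Phi> (Suc k) (c * a)\<close> for a class \<open>a\<close>, and two such
  \<open>a\<close> differ by an element of the stabiliser \<open>H\<close>. Were \<open>H\<close>
  not the whole group, a character trivial on \<open>H\<close> would take one value at most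
  primes.\<close>

lemma shift_invariant: "\<Phi> k c u = \<Phi> (Suc k) c u"
proof -
  define P where "P = primes_to l"
  define H where "H = {n. coprime n l \<and> (\<forall>k c u. \<Phi> k (c * n) u = \<Phi> k c u)}"
  have fib: "\<exists>a. coprime a l \<and> (\<exists>p\<in>A. [a = inv_mod l p] (mod l)) \<and> (\<forall>k c u. \<Phi> k c u = \<Phi> (Suc k) (c * a) u)"
    if A: "A \<subseteq> P" "\<not> (\<lambda>p. 1 / real p) summable_on A" for A
  proof -
    obtain a where a: "\<not> (\<lambda>p. 1 / real p) summable_on {p\<in>A. inv_mod l p mod l = a}"
      by (rule nonsummable_on_fiber[OF A(2), of "\<lambda>p. inv_mod l p mod l" "{..<l}"]) (use l_pos in auto)
    then have "{p\<in>A. inv_mod l p mod l = a} \<noteq> {}" by (metis summable_on_empty)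
    then obtain p where p: "p \<in> A" "inv_mod l p mod l = a" by auto
    have "coprime a l"
      using p A l_pos coprime_inv_mod[of p l] by (auto simp: P_def primes_to_def)
    moreover have "[a = inv_mod l p] (mod l)" using p(2) by (auto simp: cong_def)
    moreover have "\<Phi> k c u = \<Phi> (Suc k) (c * a) u" for k c u
    proof -
      have "\<bar>\<Phi> k c u - \<Phi> (Suc k) (c * a) u\<bar> \<le> 0"
      proof (rule limit_relation[OF _ a])
        show "{p\<in>A. inv_mod l p mod l = a} \<subseteq> primes_to l" using A by (auto simp: P_def)
        fix p assume p: "p \<in> {p\<in>A. inv_mod l p mod l = a}"
        have "[c * inv_mod l p = c * a] (mod l)"
          using p by (intro cong_mult cong_refl) (auto simp: cong_def)
        then have "\<Phi> (Suc k) (c * inv_mod l p) (u - ln p) = \<Phi> (Suc k) (c * a) (u - ln p)"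
          by (rule class_cong)
        then show "\<bar>\<Phi> (Suc k) (c * inv_mod l p) (u - ln p) - \<Phi> (Suc k) (c * a) u\<bar> \<le> 0"
          using translation_invariant[of "Suc k" "c * a" "u - ln p" u] by simp
      qed
      then show ?thesis by simp
    qed
    ultimately show ?thesis using p(1) by blast
  qed
  obtain a1 where a1: "coprime a1 l" "\<And>k c u. \<Phi> k c u = \<Phi> (Suc k) (c * a1) u"
    using fib[of P] nonsummable_primes_to[OF l_pos] unfolding P_def by blast
  show ?thesis
  proof (cases "\<forall>n. coprime n l \<longrightarrow> n \<in> H")
    case True
    then have "a1 \<in> H" using a1(1) by simp
    then show ?thesis using a1(2)[of k c u] by (simp add: H_def)
  next
    case False
    obtain \<psi> where \<psi>: "dirichlet_char l \<psi>" "\<And>h. h \<in> H \<Longrightarrow> \<psi> h = 1" "\<exists>n. coprime n l \<and> \<psi> n \<noteq> 1"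
    proof (rule separating_character[OF l_pos, of H])
      show "1 \<in> H" by (simp add: H_def)
      show "m * n \<in> H" if "m \<in> H" "n \<in> H" for m n
        using that by (auto simp: H_def simp flip: mult.assoc)
      show "n \<in> H" if "m \<in> H" "[m = n] (mod l)" for m n
        using that class_cong[OF cong_mult[OF cong_refl that(2)]] cong_imp_coprime[OF that(2)] by (auto simp: H_def)
    qed (use False in \<open>auto simp: H_def\<close>)
    have mult: "\<psi> (m * n) = \<psi> m * \<psi> n" and cng: "[m = n] (mod l) \<Longrightarrow> \<psi> m = \<psi> n" for m n
      using \<psi>(1) by (auto simp: dirichlet_char_def)
    have one: "\<psi> 1 = 1" using \<psi>(2)[of 1] by (simp add: H_def)
    have inv: "\<psi> n * \<psi> (inv_mod l n) = 1" if "coprime n l" for n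
      using cng[OF inv_mod_cong[OF l_pos that]] mult one by simp
    \<comment> \<open>The primes at which \<open>\<psi>\<close> differs from its value at
      \<open>1 / a1\<close>. They form a divergent set and yield a class \<open>a2\<close>; but
      \<open>a2 / a1\<close> lies in \<open>H\<close>, so \<open>\<psi>\<close> cannot tell
      \<open>a2\<close> from \<open>a1\<close>.\<close>
    define A where "A = {p\<in>primes_to l. \<psi> p \<noteq> \<psi> (inv_mod l a1)}"
    have "\<not> (\<lambda>p. 1 / real p) summable_on A"
      unfolding A_def by (rule character_not_constant[OF l_pos \<psi>(1,3)])
    then obtain a2 p where a2: "coprime a2 l" "p \<in> A" "[a2 = inv_mod l p] (mod l)"
      "\<And>k c u. \<Phi> k c u = \<Phi> (Suc k) (c * a2) u"
      using fib[of A] unfolding A_def P_def by blast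
    have eq: "\<Phi> (Suc k) (c * (a2 * inv_mod l a1)) u = \<Phi> (Suc k) c u" for k c u
    proof -
      have "\<Phi> (Suc k) (c * (a2 * inv_mod l a1)) u = \<Phi> (Suc k) (c * inv_mod l a1 * a2) u" by (simp add: mult_ac)
      also have "\<dots> = \<Phi> (Suc k) (c * inv_mod l a1 * a1) u" using a1(2) a2(4) by metis
      also have "\<dots> = \<Phi> (Suc k) c u" using inv_mod_cancel(1)[OF l_pos a1(1)] by (rule class_cong)
      finally show ?thesis .
    qed
    have "\<Phi> k (c * (a2 * inv_mod l a1)) u = \<Phi> k c u" for k c u
      using eq[of k "c * a1" u] a1(2)[of k c u] a1(2)[of k "c * (a2 * inv_mod l a1)" u] by (simp add: mult_ac)
    then have "a2 * inv_mod l a1 \<in> H" using a1(1) a2(1) coprime_inv_mod by (simp add: H_def)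
    then have "\<psi> a2 * \<psi> (inv_mod l a1) = 1" using \<psi>(2) mult by metis
    moreover have "\<psi> p * \<psi> a2 = 1"
      using inv[of p] cng[OF a2(3)] a2(2) by (simp add: A_def primes_to_def)
    ultimately have "\<psi> p = \<psi> (inv_mod l a1)" by (metis mult.assoc mult.commute mult_1_right)
    with a2(2) show ?thesis by (simp add: A_def)
  qed
qed

end

section \<open>The dual Turan-Kubilius inequality\<close>

text \<open>The cutoff is real because \<open>N * exp u\<close> and \<open>x / p\<close> occur as
  cutoffs.\<close>

definition upto_real :: "real \<Rightarrow> nat set" where "upto_real x = {n. 0 < n \<and> real n \<le> x}"

lemma finite_upto_real [simp]: "finite (upto_real x)"
  by (rule finite_subset[of _ "{..nat \<lfloor>x\<rfloor>}"]) (auto simp: upto_real_def le_nat_floor)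

lemma card_multiples_upto_real:
  assumes "d > 0" "x \<ge> 0"
  shows "real (card {n\<in>upto_real x. d dvd n}) = of_int \<lfloor>x / d\<rfloor>"
proof -
  have "bij_betw (\<lambda>m. d * m) {1..nat \<lfloor>x / d\<rfloor>} {n\<in>upto_real x. d dvd n}"
  proof (rule bij_betwI')
    fix m assume m: "m \<in> {1..nat \<lfloor>x / d\<rfloor>}"
    then have "real m \<le> x / d"
      using order_trans[OF _ of_nat_floor[of "x / d"], of "real m"] assms m by auto
    then show "d * m \<in> {n\<in>upto_real x. d dvd n}"
      using assms m by (auto simp: upto_real_def field_simps)
  next
    fix n assume n: "n \<in> {n\<in>upto_real x. d dvd n}"
    then obtain m where m: "n = d * m" by auto
    then have "real m \<le> x / d" using n assms by (auto simp: upto_real_def field_simps)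
    then show "\<exists>m\<in>{1..nat \<lfloor>x / d\<rfloor>}. n = d * m"
      using n m by (intro bexI[of _ m]) (auto simp: upto_real_def le_nat_iff le_floor_iff)
  qed (use assms in auto)
  then have "card {n\<in>upto_real x. d dvd n} = nat \<lfloor>x / d\<rfloor>"
    using bij_betw_same_card by fastforce
  then show ?thesis using assms by simp
qed

lemma card_upto_real: "x \<ge> 0 \<Longrightarrow> real (card (upto_real x)) \<le> x"
  using card_multiples_upto_real[of 1 x] by simp

lemma multiples_density:
  fixes d :: nat
  assumes "d > 0"
  shows "((\<lambda>x. real (card {n\<in>upto_real x. d dvd n}) / x) \<longlongrightarrow> 1 / d) at_top"
proof (rule Lim_transform_eventually)
  have "((\<lambda>x::real. of_int \<lfloor>x / d\<rfloor> / x) \<longlongrightarrow> inverse (real d)) at_top"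
    using assms by real_asymp
  then show "((\<lambda>x::real. of_int \<lfloor>x / d\<rfloor> / x) \<longlongrightarrow> 1 / d) at_top"
    by (simp add: inverse_eq_divide)
  show "\<forall>\<^sub>F x::real in at_top. of_int \<lfloor>x / d\<rfloor> / x = real (card {n\<in>upto_real x. d dvd n}) / x"
    using eventually_ge_at_top[of 0] by eventually_elim (use assms card_multiples_upto_real in simp)
qed

text \<open>The covariance is \<open>1 / lcm p q - 1 / (p * q)\<close>, so divisibility by distinct
  primes is asymptotically uncorrelated.\<close>

lemma divisor_covariance:
  assumes "prime p" "prime q"
  shows "((\<lambda>x. (\<Sum>n\<in>upto_real x. (of_bool (p dvd n) - 1 / real p) * (of_bool (q dvd n) - 1 / real q)) / x)
     \<longlongrightarrow> (if p = q then 1 / real p - 1 / real p ^ 2 else 0)) at_top"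
proof -
  define N where "N d x = real (card {n\<in>upto_real x. d dvd n})" for d x
  have sumN: "(\<Sum>n\<in>upto_real x. of_bool (d dvd n)) = N d x" for d x
    by (simp add: N_def Int_def)
  have pos: "p > 0" "q > 0" using assms prime_gt_0_nat by auto
  have eq: "(\<Sum>n\<in>upto_real x. (of_bool (p dvd n) - 1 / real p) * (of_bool (q dvd n) - 1 / real q)) / x
      = N (lcm p q) x / x - N p x / x / q - N q x / x / p + N 1 x / x / (p * q)" for x
  proof -
    have "(of_bool (p dvd n) - 1 / real p) * (of_bool (q dvd n) - 1 / real q)
        = of_bool (lcm p q dvd n) - of_bool (p dvd n) / q - of_bool (q dvd n) / p
          + of_bool (1 dvd n) / (real p * real q)" for n
      using pos by (auto simp: lcm_least_iff field_simps)
    then show ?thesis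
      by (simp only: sum.distrib sum_subtractf sum_divide_distrib[symmetric] sumN)
        (simp add: add_divide_distrib diff_divide_distrib mult_ac)
  qed
  have lim: "((\<lambda>x. N (lcm p q) x / x - N p x / x / q - N q x / x / p + N 1 x / x / (p * q))
      \<longlongrightarrow> 1 / real (lcm p q) - 1 / p / q - 1 / q / p + 1 / real 1 / (p * q)) at_top"
  proof -
    have N: "((\<lambda>x. N d x / x) \<longlongrightarrow> 1 / d) at_top" if "d > 0" for d
      unfolding N_def by (rule multiples_density[OF that])
    show ?thesis
      using pos by (intro tendsto_add tendsto_diff tendsto_divide[OF N tendsto_const] N) (auto intro: lcm_pos_nat)
  qed
  have "1 / real (lcm p q) - 1 / p / q - 1 / q / p + 1 / real 1 / (p * q) =
      (if p = q then 1 / real p - 1 / real p ^ 2 else 0)"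
  proof (cases "p = q")
    case False
    then have "lcm p q = p * q" using assms by (simp add: primes_coprime lcm_coprime)
    then show ?thesis using False by (simp add: mult.commute)
  next
    case True
    then show ?thesis by (simp add: power2_eq_square)
  qed
  with lim show ?thesis unfolding eq by simp
qed

text \<open>Pairing \<open>F\<close> with the combination \<open>W\<close> of centred indicators
  with weights \<open>E x p\<close> gives \<open>- x * S\<close>. Cauchy-Schwarz and the near
  orthogonality of the indicators then yield \<open>S\<^sup>2 \<le> S + e\<close>, hence
  \<open>S \<le> 1 + e\<close>. The bound is the same for all finite \<open>A\<close>; only the
  threshold for \<open>x\<close> varies.\<close>

lemma turan_kubilius_dual:
  fixes F :: "nat \<Rightarrow> real"
  assumes F: "\<And>n. \<bar>F n\<bar> \<le> 1" and A: "finite A" "\<And>p. p \<in> A \<Longrightarrow> prime p" and e: "e > 0"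
  defines "E \<equiv> \<lambda>x p. (\<Sum>n\<in>upto_real x. F n) / x - real p * (\<Sum>n | n \<in> upto_real x \<and> p dvd n. F n) / x"
  shows "\<forall>\<^sub>F x in at_top. (\<Sum>p\<in>A. (E x p)\<^sup>2 / p) \<le> 1 + e"
proof -
  define cov where "cov p q x = (\<Sum>n\<in>upto_real x. (of_bool (p dvd n) - 1 / real p) * (of_bool (q dvd n) - 1 / real q)) / x"
    for p q :: nat and x
  define c where "c p q = (if p = q then 1 / real p - 1 / real p ^ 2 else 0)" for p q :: nat
  \<comment> \<open>The factor 4 anticipates the bound for \<open>E x p * E x q\<close>, as both
    factors are at most 2 in absolute value.\<close>
  have "((\<lambda>x. 4 * (\<Sum>p\<in>A. \<Sum>q\<in>A. \<bar>cov p q x - c p q\<bar>)) \<longlongrightarrow> 4 * (\<Sum>p\<in>A. \<Sum>q\<in>A. \<bar>c p q - c p q\<bar>)) at_top"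
    unfolding cov_def c_def using A by (intro tendsto_intros divisor_covariance) auto
  then have "\<forall>\<^sub>F x in at_top. 4 * (\<Sum>p\<in>A. \<Sum>q\<in>A. \<bar>cov p q x - c p q\<bar>) < e"
    using e by (intro order_tendstoD(2)) auto
  then show ?thesis
    using eventually_gt_at_top[of 0]
  proof eventually_elim
    case (elim x)
    then have x: "x > 0" and small: "4 * (\<Sum>p\<in>A. \<Sum>q\<in>A. \<bar>cov p q x - c p q\<bar>) < e" by auto
    define S where "S = (\<Sum>p\<in>A. (E x p)\<^sup>2 / p)"
    have pos: "real p > 0" if "p \<in> A" for p using A(2)[OF that] prime_gt_0_nat by auto
    have cardx: "real (card (upto_real x)) \<le> x" using card_upto_real x by simp
    have E2: "\<bar>E x p\<bar> \<le> 2" if "p \<in> A" for p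
    proof -
      have "\<bar>\<Sum>n\<in>upto_real x. F n\<bar> \<le> x"
        using sum_norm_bound[of "upto_real x" F 1] F cardx by simp
      then have 1: "\<bar>(\<Sum>n\<in>upto_real x. F n) / x\<bar> \<le> 1" using x by (simp add: abs_divide)
      have "\<bar>\<Sum>n | n \<in> upto_real x \<and> p dvd n. F n\<bar> \<le> real (card {n\<in>upto_real x. p dvd n})"
        using sum_norm_bound[of "{n\<in>upto_real x. p dvd n}" F 1] F by simp
      also have "\<dots> \<le> x / p" using pos[OF that] x by (simp add: card_multiples_upto_real)
      finally have "p * \<bar>\<Sum>n | n \<in> upto_real x \<and> p dvd n. F n\<bar> \<le> x" using pos[OF that] by (simp add: field_simps)
      then have 2: "\<bar>real p * (\<Sum>n | n \<in> upto_real x \<and> p dvd n. F n) / x\<bar> \<le> 1"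
        using x by (simp add: abs_divide abs_mult)
      have "\<bar>a - b\<bar> \<le> 2" if "\<bar>a\<bar> \<le> 1" "\<bar>b\<bar> \<le> 1" for a b :: real using that by linarith
      from this[OF 1 2] show "\<bar>E x p\<bar> \<le> 2" by (simp add: E_def)
    qed
    define W where "W n = (\<Sum>p\<in>A. E x p * (of_bool (p dvd n) - 1 / real p))" for n
    have "x * S = (\<Sum>p\<in>A. x * ((E x p)\<^sup>2 / p))" by (simp add: S_def sum_distrib_left)
    also have "\<dots> = (\<Sum>p\<in>A. - E x p * (\<Sum>n\<in>upto_real x. F n * (of_bool (p dvd n) - 1 / real p)))"
    proof (rule sum.cong[OF refl])
      fix p assume p: "p \<in> A"
      have "(\<Sum>n\<in>upto_real x. F n * (of_bool (p dvd n) - 1 / real p))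
          = (\<Sum>n | n \<in> upto_real x \<and> p dvd n. F n) - (\<Sum>n\<in>upto_real x. F n) / p"
        by (simp add: right_diff_distrib sum_subtractf sum_divide_distrib Int_def)
      also have "\<dots> = - (x / p * E x p)"
        using x pos[OF p] by (simp add: E_def field_simps)
      finally show "x * ((E x p)\<^sup>2 / p) = - E x p * (\<Sum>n\<in>upto_real x. F n * (of_bool (p dvd n) - 1 / real p))"
        by (simp add: power2_eq_square)
    qed
    also have "\<dots> = - (\<Sum>n\<in>upto_real x. F n * W n)"
      unfolding W_def sum_distrib_left by (subst sum.swap) (simp add: sum_negf mult_ac)
    finally have "(x * S)\<^sup>2 = (\<Sum>n\<in>upto_real x. F n * W n)\<^sup>2" by simp
    also have "\<dots> \<le> (\<Sum>n\<in>upto_real x. (F n)\<^sup>2) * (\<Sum>n\<in>upto_real x. (W n)\<^sup>2)"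
      by (rule Cauchy_Schwarz_ineq_sum)
    also have "\<dots> \<le> x * (\<Sum>n\<in>upto_real x. (W n)\<^sup>2)"
    proof (intro mult_right_mono sum_nonneg)
      have "(\<Sum>n\<in>upto_real x. (F n)\<^sup>2) \<le> (\<Sum>n\<in>upto_real x. 1)"
        using F by (intro sum_mono) (simp add: abs_square_le_1)
      then show "(\<Sum>n\<in>upto_real x. (F n)\<^sup>2) \<le> x" using cardx by simp
    qed auto
    also have "(\<Sum>n\<in>upto_real x. (W n)\<^sup>2) = x * (\<Sum>p\<in>A. \<Sum>q\<in>A. E x p * E x q * cov p q x)"
    proof -
      have "(\<Sum>n\<in>upto_real x. (W n)\<^sup>2) = (\<Sum>n\<in>upto_real x. \<Sum>p\<in>A. \<Sum>q\<in>A.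
          E x p * E x q * ((of_bool (p dvd n) - 1 / real p) * (of_bool (q dvd n) - 1 / real q)))"
        by (simp add: W_def power2_eq_square sum_product mult_ac)
      also have "\<dots> = (\<Sum>p\<in>A. \<Sum>q\<in>A. \<Sum>n\<in>upto_real x.
          E x p * E x q * ((of_bool (p dvd n) - 1 / real p) * (of_bool (q dvd n) - 1 / real q)))"
        by (subst sum.swap, rule sum.cong[OF refl], rule sum.swap)
      also have "\<dots> = (\<Sum>p\<in>A. \<Sum>q\<in>A. x * (E x p * E x q * cov p q x))"
        using x by (simp add: cov_def flip: sum_distrib_left)
      finally show ?thesis by (simp add: sum_distrib_left)
    qed
    also have "(\<Sum>p\<in>A. \<Sum>q\<in>A. E x p * E x q * cov p q x) \<le> S + e"
    proof -
      have "(\<Sum>p\<in>A. \<Sum>q\<in>A. E x p * E x q * cov p q x) \<le>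
          (\<Sum>p\<in>A. \<Sum>q\<in>A. (if p = q then (E x p)\<^sup>2 / p else 0) + 4 * \<bar>cov p q x - c p q\<bar>)"
      proof (intro sum_mono)
        fix p q assume pq: "p \<in> A" "q \<in> A"
        have "\<bar>E x p * E x q\<bar> \<le> 2 * 2" unfolding abs_mult using E2 pq by (intro mult_mono) auto
        then have "\<bar>E x p * E x q * (cov p q x - c p q)\<bar> \<le> 4 * \<bar>cov p q x - c p q\<bar>"
          unfolding abs_mult[of _ "cov p q x - c p q"] by (intro mult_right_mono) auto
        moreover have "E x p * E x q * c p q \<le> (if p = q then (E x p)\<^sup>2 / p else 0)"
        proof (cases "p = q")
          case True
          have "c p q \<le> 1 / p" using True by (simp add: c_def)
          then have "(E x p)\<^sup>2 * c p q \<le> (E x p)\<^sup>2 * (1 / p)" by (intro mult_left_mono) auto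
          then show ?thesis using True by (simp add: power2_eq_square)
        qed (simp add: c_def)
        ultimately show "E x p * E x q * cov p q x \<le> (if p = q then (E x p)\<^sup>2 / p else 0) + 4 * \<bar>cov p q x - c p q\<bar>"
          by (simp add: algebra_simps abs_le_iff split del: if_split)
      qed
      also have "\<dots> = S + 4 * (\<Sum>p\<in>A. \<Sum>q\<in>A. \<bar>cov p q x - c p q\<bar>)"
        using A(1) by (simp add: sum.distrib S_def sum_distrib_left)
      finally show ?thesis using small by linarith
    qed
    finally have "(x * S)\<^sup>2 \<le> x * (x * (S + e))" using x by simp
    then have "x\<^sup>2 * S\<^sup>2 \<le> x\<^sup>2 * (S + e)" by (simp add: power2_eq_square mult_ac)
    then have SS: "S\<^sup>2 \<le> S + e" using x by simp
    show ?case
    proof (rule ccontr)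
      assume "\<not> ?thesis"
      then have S: "S > 1 + e" by (simp add: S_def)
      then have "S * (1 + e) < S * S" using e by (intro mult_strict_left_mono) auto
      moreover have "e * 1 < e * S" using S e by (intro mult_strict_left_mono) auto
      ultimately show False using SS by (simp add: power2_eq_square algebra_simps)
    qed
  qed
qed

section \<open>Means over residue classes and their limit profiles\<close>

lemma prime_Omega_prime_times:
  assumes "prime p" "m > 0"
  shows "prime_Omega (p * m) = Suc (prime_Omega m)"
  using assms by (simp add: prime_Omega_def prime_factorization_mult prime_factorization_prime prime_gt_0_nat)

text \<open>Divided by \<open>x\<close> and not by the size of the class, so that passing to the
  multiples of \<open>p\<close> is an exact identity at \<open>x / p\<close>.\<close>

definition class_mean :: "nat \<Rightarrow> (nat \<Rightarrow> real) \<Rightarrow> nat \<Rightarrow> nat \<Rightarrow> real \<Rightarrow> real" where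
  "class_mean l f k c x = (\<Sum>n\<in>upto_real x. of_bool ([n = c] (mod l)) * f (prime_Omega n + k)) / x"

lemma class_mean_bound:
  assumes "\<And>n. \<bar>f n\<bar> \<le> 1"
  shows "\<bar>class_mean l f k c x\<bar> \<le> 1"
proof (cases "x > 0")
  case True
  have "norm (\<Sum>n\<in>upto_real x. of_bool ([n = c] (mod l)) * f (prime_Omega n + k)) \<le> real (card (upto_real x)) * 1"
    using assms by (intro sum_norm_bound) (auto simp: abs_mult)
  also have "\<dots> \<le> x" using card_upto_real True by simp
  finally show ?thesis using True by (simp add: class_mean_def abs_divide)
next
  case False
  then have "upto_real x = {}" by (auto simp: upto_real_def)
  then show ?thesis by (simp add: class_mean_def)
qed

lemma class_mean_lipschitz:
  assumes f: "\<And>n. \<bar>f n\<bar> \<le> 1" and xy: "0 < x" "x \<le> y"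
  shows "\<bar>class_mean l f k c y - class_mean l f k c x\<bar> \<le> 2 * (1 - x / y) + 1 / y"
proof -
  define g where "g n = of_bool ([n = c] (mod l)) * f (prime_Omega n + k)" for n
  have g: "\<bar>g n\<bar> \<le> 1" for n using f by (auto simp: g_def abs_mult)
  define B where "B = upto_real y - upto_real x"
  have sub: "upto_real x \<subseteq> upto_real y" using xy by (auto simp: upto_real_def)
  have cardB: "real (card B) \<le> y - x + 1"
  proof -
    have "real (card B) = real (card (upto_real y)) - real (card (upto_real x))"
      unfolding B_def using sub card_mono[OF _ sub] by (simp add: card_Diff_subset of_nat_diff)
    also have "\<dots> = of_int \<lfloor>y\<rfloor> - of_int \<lfloor>x\<rfloor>"
      using card_multiples_upto_real[of 1 x] card_multiples_upto_real[of 1 y] xy by simp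
    also have "\<dots> \<le> y - x + 1" by linarith
    finally show ?thesis .
  qed
  have "(\<Sum>n\<in>upto_real y. g n) = (\<Sum>n\<in>upto_real x. g n) + (\<Sum>n\<in>B. g n)"
    unfolding B_def using sub by (metis add.commute finite_upto_real sum.subset_diff)
  then have eq: "class_mean l f k c y - class_mean l f k c x = (\<Sum>n\<in>upto_real x. g n) / x * (x / y - 1) + (\<Sum>n\<in>B. g n) / y"
    using xy unfolding class_mean_def g_def[symmetric] by (simp add: field_simps)
  have "\<bar>(\<Sum>n\<in>upto_real x. g n) / x\<bar> \<le> 1"
    using class_mean_bound[of f l k c x] f by (simp add: class_mean_def g_def)
  then have "\<bar>(\<Sum>n\<in>upto_real x. g n) / x * (x / y - 1)\<bar> \<le> 1 * \<bar>x / y - 1\<bar>"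
    unfolding abs_mult by (intro mult_right_mono) auto
  then have 1: "\<bar>(\<Sum>n\<in>upto_real x. g n) / x * (x / y - 1)\<bar> \<le> 1 - x / y" using xy by simp
  have "\<bar>\<Sum>n\<in>B. g n\<bar> \<le> y - x + 1"
    using sum_norm_bound[of B g 1] g cardB by simp
  then have "\<bar>(\<Sum>n\<in>B. g n) / y\<bar> \<le> (y - x + 1) / y" using xy by (simp add: abs_divide divide_right_mono)
  also have "\<dots> = 1 - x / y + 1 / y" using xy by (simp add: field_simps)
  finally have 2: "\<bar>(\<Sum>n\<in>B. g n) / y\<bar> \<le> 1 - x / y + 1 / y" .
  show ?thesis unfolding eq using order_trans[OF abs_triangle_ineq add_mono[OF 1 2]] by (simp add: algebra_simps)
qed

lemma class_mean_cong: "[c = c'] (mod l) \<Longrightarrow> class_mean l f k c = class_mean l f k c'"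
  by (auto simp: class_mean_def cong_def fun_eq_iff)

text \<open>The substitution \<open>n = p * m\<close> raises \<open>\<Omega>\<close> by exactly 1,
  whether or not \<open>p\<close> divides \<open>m\<close>, and divides the residue class by
  \<open>p\<close>.\<close>

lemma class_mean_prime:
  assumes l: "l > 0" and p: "prime p" "coprime p l"
  shows "real p * (\<Sum>n | n \<in> upto_real x \<and> p dvd n. of_bool ([n = c] (mod l)) * f (prime_Omega n + k)) / x
     = class_mean l f (Suc k) (c * inv_mod l p) (x / p)"
proof -
  have p0: "p > 0" using p prime_gt_0_nat by auto
  have set: "{n \<in> upto_real x. p dvd n} = (\<lambda>m. p * m) ` upto_real (x / p)"
    using p0 by (auto simp: upto_real_def field_simps elim!: dvdE)
  have cg: "[p * m = c] (mod l) \<longleftrightarrow> [m = c * inv_mod l p] (mod l)" for m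
  proof
    assume "[p * m = c] (mod l)"
    then have "[m * p * inv_mod l p = c * inv_mod l p] (mod l)"
      by (intro cong_mult cong_refl) (simp add: mult.commute)
    then show "[m = c * inv_mod l p] (mod l)"
      using inv_mod_cancel(2)[OF l p(2), of m] by (metis cong_sym cong_trans)
  next
    assume "[m = c * inv_mod l p] (mod l)"
    then have "[p * m = p * (c * inv_mod l p)] (mod l)" by (intro cong_mult cong_refl)
    then show "[p * m = c] (mod l)"
      using inv_mod_cancel(1)[OF l p(2), of c] by (metis cong_trans mult.commute)
  qed
  have "(\<Sum>n | n \<in> upto_real x \<and> p dvd n. of_bool ([n = c] (mod l)) * f (prime_Omega n + k))
      = (\<Sum>m\<in>upto_real (x / p). of_bool ([p * m = c] (mod l)) * f (prime_Omega (p * m) + k))"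
    unfolding set using p0 by (subst sum.reindex) (auto intro!: inj_onI)
  also have "\<dots> = (\<Sum>m\<in>upto_real (x / p). of_bool ([m = c * inv_mod l p] (mod l)) * f (prime_Omega m + Suc k))"
    using p(1) by (intro sum.cong refl) (auto simp: cg prime_Omega_prime_times upto_real_def)
  finally show ?thesis by (simp add: class_mean_def)
qed

text \<open>A failure would occur along infinitely many \<open>N\<close>. A cluster filter of these
  \<open>N\<close> gives limits for all \<open>k\<close>, \<open>c\<close>, \<open>u\<close> at
  once; they form a \<open>profile\<close>, and \<open>shift_invariant\<close> contradicts the
  failure.\<close>

theorem Omega_shift_invariant:
  fixes f :: "nat \<Rightarrow> real"
  assumes l: "l > 0" and f: "\<And>n. \<bar>f n\<bar> \<le> 1"
  shows "(\<lambda>N. class_mean l f (Suc 0) c (real N) - class_mean l f 0 c (real N)) \<longlonglongrightarrow> 0"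
proof (rule ccontr)
  assume "\<not> ?thesis"
  then obtain \<eta> where \<eta>: "\<eta> > 0"
    "\<exists>\<^sub>F N in sequentially. \<not> \<bar>class_mean l f (Suc 0) c (real N) - class_mean l f 0 c (real N)\<bar> < \<eta>"
    by (auto simp: tendsto_iff not_eventually dist_real_def)
  define bad where "bad N \<longleftrightarrow> \<not> \<bar>class_mean l f (Suc 0) c (real N) - class_mean l f 0 c (real N)\<bar> < \<eta>" for N
  define F where "F = inf sequentially (principal {N. bad N})"
  have F0: "F \<noteq> bot"
    using \<eta>(2) unfolding F_def bad_def[symmetric] trivial_limit_def eventually_inf_principal
    by (simp add: frequently_def)
  have evbad: "eventually bad F" by (simp add: F_def eventually_inf_principal)
  have lim: "filterlim (\<lambda>N. real N * exp u) at_top F" for u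
  proof -
    have "filterlim (\<lambda>N. real N * exp u) at_top sequentially"
      by (intro filterlim_at_top_mult_tendsto_pos[OF tendsto_const] filterlim_real_sequentially) auto
    then show ?thesis unfolding F_def by (rule filterlim_mono) auto
  qed
  define M where "M = (\<lambda>(k, c, u) N. class_mean l f k c (real N * exp u))"
  obtain F' \<Phi>' where F': "F' \<le> F" "F' \<noteq> bot" and \<Phi>': "\<And>i. (M i \<longlongrightarrow> \<Phi>' i) F'"
    by (rule cluster_filter[OF F0, of M "\<lambda>_. 1"]) (auto simp: M_def class_mean_bound[OF f])
  define \<Phi> where "\<Phi> k c u = \<Phi>' (k, c, u)" for k c u
  \<comment> \<open>Transfer principle: finitely many limits are approximated at one common
    \<open>N\<close>, which may in addition satisfy any property that holds eventually along
    \<open>F\<close>.\<close>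
  have approx: "\<exists>N. Q N \<and> (\<forall>(k, c, u)\<in>S. \<bar>class_mean l f k c (real N * exp u) - \<Phi> k c u\<bar> < e)"
    if "finite S" "e > 0" "eventually Q F" for S e Q
  proof -
    have "\<forall>\<^sub>F N in F'. \<forall>i\<in>S. dist (M i N) (\<Phi>' i) < e"
      using that(1) tendstoD[OF \<Phi>' that(2)] by (intro eventually_ball_finite) auto
    with filter_leD[OF F'(1) that(3)] have "\<forall>\<^sub>F N in F'. Q N \<and> (\<forall>i\<in>S. dist (M i N) (\<Phi>' i) < e)"
      by (rule eventually_conj)
    from eventually_happens'[OF F'(2) this] show ?thesis by (auto simp: M_def \<Phi>_def dist_real_def)
  qed
  interpret profile l \<Phi>
  proof
    show "l > 0" by (rule l)
  next
    fix c c' k u assume cg: "[c = c'] (mod l)"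
    show "\<Phi> k c u = \<Phi> k c' u"
    proof (rule ccontr)
      assume "\<Phi> k c u \<noteq> \<Phi> k c' u"
      then obtain N where "\<bar>class_mean l f k c (real N * exp u) - \<Phi> k c u\<bar> < \<bar>\<Phi> k c u - \<Phi> k c' u\<bar> / 2"
        "\<bar>class_mean l f k c' (real N * exp u) - \<Phi> k c' u\<bar> < \<bar>\<Phi> k c u - \<Phi> k c' u\<bar> / 2"
        using approx[of "{(k, c, u), (k, c', u)}" "\<bar>\<Phi> k c u - \<Phi> k c' u\<bar> / 2" "\<lambda>_. True"] by auto
      moreover have False if "\<bar>m - a\<bar> < \<bar>a - b\<bar> / 2" "\<bar>m - b\<bar> < \<bar>a - b\<bar> / 2" for a b m :: real
        using that by (auto simp: abs_if split: if_splits)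
      ultimately show False unfolding class_mean_cong[OF cg, of f k] by blast
    qed
  next
    have one: "\<Phi> k c v - \<Phi> k c u \<le> 2 * (v - u) \<and> \<Phi> k c u - \<Phi> k c v \<le> 2 * (v - u)" if "u \<le> v" for k c u v
    proof -
      have "\<bar>\<Phi> k c v - \<Phi> k c u\<bar> \<le> 2 * (v - u) + e" if e: "e > 0" for e
      proof -
        have "eventually (\<lambda>N. real N * exp v \<ge> max (3 / e) 1) F"
          using lim[of v] unfolding filterlim_at_top by blast
        then have "eventually (\<lambda>N. real N * exp v \<ge> 3 / e \<and> real N * exp v > 0) F"
          by eventually_elim auto
        then obtain N where N: "real N * exp v \<ge> 3 / e" "real N * exp v > 0"
          "\<bar>class_mean l f k c (real N * exp u) - \<Phi> k c u\<bar> < e / 3"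
          "\<bar>class_mean l f k c (real N * exp v) - \<Phi> k c v\<bar> < e / 3"
          using approx[of "{(k, c, u), (k, c, v)}" "e / 3"] e by auto
        have N0: "real N > 0" using N(2) by (simp add: zero_less_mult_iff)
        have "\<bar>class_mean l f k c (real N * exp v) - class_mean l f k c (real N * exp u)\<bar>
            \<le> 2 * (1 - real N * exp u / (real N * exp v)) + 1 / (real N * exp v)"
          using N0 \<open>u \<le> v\<close> by (intro class_mean_lipschitz[OF f]) auto
        also have "real N * exp u / (real N * exp v) = exp (u - v)" using N0 by (simp add: exp_diff)
        also have "2 * (1 - exp (u - v)) + 1 / (real N * exp v) \<le> 2 * (v - u) + e / 3"
        proof (rule add_mono)
          show "2 * (1 - exp (u - v)) \<le> 2 * (v - u)" using exp_ge_add_one_self[of "u - v"] by (simp add: algebra_simps)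
          show "1 / (real N * exp v) \<le> e / 3" using N(1,2) e by (simp add: field_simps)
        qed
        finally have *: "\<bar>class_mean l f k c (real N * exp v) - class_mean l f k c (real N * exp u)\<bar> \<le> 2 * (v - u) + e / 3" .
        have "\<bar>b' - a'\<bar> \<le> D + e" if "\<bar>a - a'\<bar> < e / 3" "\<bar>b - b'\<bar> < e / 3" "\<bar>b - a\<bar> \<le> D + e / 3"
          for a a' b b' D :: real using that by linarith
        from this[OF N(3,4) *] show ?thesis .
      qed
      then have "\<bar>\<Phi> k c v - \<Phi> k c u\<bar> \<le> 2 * (v - u)" by (rule field_le_epsilon)
      then show ?thesis by (simp add: abs_le_iff)
    qed
    fix k c u v
    show "\<bar>\<Phi> k c u - \<Phi> k c v\<bar> \<le> 2 * \<bar>u - v\<bar>"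
      using one[of u v k c] one[of v u k c] by (cases "u \<le> v") (auto simp: abs_le_iff)
  next
    fix A k c u assume A: "finite A" "A \<subseteq> primes_to l"
    have prm: "prime p" "coprime p l" "p > 0" if "p \<in> A" for p
      using A that prime_gt_0_nat by (auto simp: primes_to_def)
    define D where "D p = \<Phi> k c u - \<Phi> (Suc k) (c * inv_mod l p) (u - ln p)" for p :: nat
    have "(\<Sum>p\<in>A. (D p)\<^sup>2 / p) \<le> 1 + e" if e: "e > 0" for e
    proof -
      define g where "g n = of_bool ([n = c] (mod l)) * f (prime_Omega n + k)" for n
      define E where "E x p = (\<Sum>n\<in>upto_real x. g n) / x - real p * (\<Sum>n | n \<in> upto_real x \<and> p dvd n. g n) / x" for x :: real and p :: nat
      have Eeq: "E x p = class_mean l f k c x - class_mean l f (Suc k) (c * inv_mod l p) (x / p)" if "p \<in> A" for x p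
        unfolding E_def g_def using class_mean_prime[OF l prm(1,2)[OF that], where x = x and c = c and f = f and k = k] by (simp add: class_mean_def)
      have "\<forall>\<^sub>F x in at_top. (\<Sum>p\<in>A. (E x p)\<^sup>2 / p) \<le> 1 + e / 2"
        unfolding E_def using A prm e f by (intro turan_kubilius_dual) (auto simp: g_def abs_mult)
      from eventually_compose_filterlim[OF this lim]
      have ev: "\<forall>\<^sub>F N in F. (\<Sum>p\<in>A. (E (real N * exp u) p)\<^sup>2 / p) \<le> 1 + e / 2" .
      define m where "m = real (card A) + 1"
      have m: "m > 0" "real (card A) \<le> m" by (auto simp: m_def)
      \<comment> \<open>The replacement of means by limits changes a difference by at most
        \<open>2 * \<delta>\<close>, and the sum of old and new difference is at most 6, so each
        square changes by at most \<open>12 * \<delta>\<close>. Over all primes of \<open>A\<close>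
        this is at most \<open>e / 2\<close>.\<close>
      define \<delta> where "\<delta> = min 1 (e / (24 * m))"
      have \<delta>: "\<delta> > 0" "\<delta> \<le> 1" using e m by (auto simp: \<delta>_def)
      have "12 * \<delta> * card A \<le> 12 * (e / (24 * m)) * m"
        using e m by (intro mult_mono) (auto simp: \<delta>_def)
      also have "\<dots> = e / 2" using m by simp
      finally have \<delta>A: "12 * \<delta> * card A \<le> e / 2" .
      define S where "S = insert (k, c, u) ((\<lambda>p. (Suc k, c * inv_mod l p, u - ln p)) ` A)"
      obtain N where N: "(\<Sum>p\<in>A. (E (real N * exp u) p)\<^sup>2 / p) \<le> 1 + e / 2"
        "\<forall>(k, c, u)\<in>S. \<bar>class_mean l f k c (real N * exp u) - \<Phi> k c u\<bar> < \<delta>"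
        using approx[of S \<delta>, OF _ \<delta>(1) ev] A by (auto simp: S_def)
      have "(\<Sum>p\<in>A. (D p)\<^sup>2 / p) \<le> (\<Sum>p\<in>A. (E (real N * exp u) p)\<^sup>2 / p + 12 * \<delta>)"
      proof (rule sum_mono)
        fix p assume p: "p \<in> A"
        define a where "a = class_mean l f k c (real N * exp u)"
        define b where "b = class_mean l f (Suc k) (c * inv_mod l p) (real N * exp (u - ln p))"
        have E: "E (real N * exp u) p = a - b"
          using prm[OF p] by (simp add: Eeq[OF p] a_def b_def exp_diff)
        have ab: "\<bar>a\<bar> \<le> 1" "\<bar>b\<bar> \<le> 1" unfolding a_def b_def by (rule class_mean_bound[OF f])+
        have cl: "\<bar>a - \<Phi> k c u\<bar> < \<delta>" "\<bar>b - \<Phi> (Suc k) (c * inv_mod l p) (u - ln p)\<bar> < \<delta>"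
          using N(2) p by (auto simp: S_def a_def b_def)
        have d: "\<bar>D p - (a - b)\<bar> \<le> 2 * \<delta>" "\<bar>a - b\<bar> \<le> 2"
          using cl ab unfolding D_def abs_le_iff abs_less_iff by linarith+
        then have s: "\<bar>D p + (a - b)\<bar> \<le> 6" using \<delta>(2) unfolding abs_le_iff by linarith
        have "(D p)\<^sup>2 - (a - b)\<^sup>2 = (D p - (a - b)) * (D p + (a - b))" by (simp add: power2_eq_square algebra_simps)
        also have "\<dots> \<le> \<bar>D p - (a - b)\<bar> * \<bar>D p + (a - b)\<bar>" by (metis abs_ge_self abs_mult)
        also have "\<dots> \<le> 2 * \<delta> * 6" using d(1) s \<delta> by (intro mult_mono) auto
        finally have "(D p)\<^sup>2 \<le> (a - b)\<^sup>2 + 12 * \<delta>" by simp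
        then have "(D p)\<^sup>2 / p \<le> ((a - b)\<^sup>2 + 12 * \<delta>) / p" by (intro divide_right_mono) auto
        also have "\<dots> \<le> (a - b)\<^sup>2 / p + 12 * \<delta>"
        proof -
          have "12 * \<delta> / p \<le> 12 * \<delta> / 1" using prm(3)[OF p] \<delta> by (intro divide_left_mono) auto
          then show ?thesis by (simp add: add_divide_distrib)
        qed
        finally show "(D p)\<^sup>2 / p \<le> (E (real N * exp u) p)\<^sup>2 / p + 12 * \<delta>" unfolding E .
      qed
      also have "\<dots> = (\<Sum>p\<in>A. (E (real N * exp u) p)\<^sup>2 / p) + 12 * \<delta> * card A"
        by (simp add: sum.distrib)
      also have "\<dots> \<le> 1 + e" using N(1) \<delta>A by linarith
      finally show ?thesis .
    qed
    then show "(\<Sum>p\<in>A. (\<Phi> k c u - \<Phi> (Suc k) (c * inv_mod l p) (u - ln (real p)))\<^sup>2 / real p) \<le> 1"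
      unfolding D_def by (rule field_le_epsilon)
  qed
  obtain N where N: "bad N" "\<bar>class_mean l f 0 c (real N * exp 0) - \<Phi> 0 c 0\<bar> < \<eta> / 2"
      "\<bar>class_mean l f (Suc 0) c (real N * exp 0) - \<Phi> (Suc 0) c 0\<bar> < \<eta> / 2"
    using approx[of "{(0, c, 0), (Suc 0, c, 0)}" "\<eta> / 2" bad] \<eta>(1) evbad by auto
  moreover have "\<bar>b - a\<bar> < \<eta>" if "\<bar>a - m\<bar> < \<eta> / 2" "\<bar>b - m\<bar> < \<eta> / 2" for a b m :: real
    using that by linarith
  ultimately show False unfolding bad_def shift_invariant[of 0 c 0, symmetric] by simp
qed

section \<open>Equidistribution under unique ergodicity\<close>

text \<open>\<open>\<rho>\<close> will be a limit of frequencies, hence defined on all sets but only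
  finitely additive. It lives on the ambient space and is concentrated on \<open>X\<close>, so that
  open sets of the whole space can be used. Compact sets from inside and then open sets from outside
  regularise it to a Borel measure.\<close>

locale content_on_compact =
  fixes X :: "'x::metric_space set" and \<rho> :: "'x set \<Rightarrow> real"
  assumes compact_X: "compact X"
    and nonneg: "\<rho> A \<ge> 0"
    and additive: "A \<inter> B = {} \<Longrightarrow> \<rho> (A \<union> B) = \<rho> A + \<rho> B"
    and null_outside: "\<rho> (- X) = 0"
    and total: "\<rho> UNIV = 1"
begin

lemma mono: "A \<subseteq> B \<Longrightarrow> \<rho> A \<le> \<rho> B"
  using additive[of A "B - A"] nonneg[of "B - A"] by (simp add: Un_absorb1)

lemma subadd: "\<rho> (A \<union> B) \<le> \<rho> A + \<rho> B"
  using additive[of A "B - A"] mono[of "B - A" B] by simp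

lemma empty: "\<rho> {} = 0" using additive[of "{}" "{}"] by simp

lemma Int_X: "\<rho> (A \<inter> X) = \<rho> A"
proof (rule antisym)
  have "\<rho> A \<le> \<rho> (A \<inter> X \<union> - X)" by (rule mono) auto
  then show "\<rho> A \<le> \<rho> (A \<inter> X)" using subadd[of "A \<inter> X" "- X"] null_outside by simp
qed (rule mono, auto)

lemma subadd_finite: "finite I \<Longrightarrow> \<rho> (\<Union>i\<in>I. A i) \<le> (\<Sum>i\<in>I. \<rho> (A i))"
proof (induction I rule: finite_induct)
  case (insert i I)
  then show ?case using subadd[of "A i" "\<Union>i\<in>I. A i"] by simp
qed (simp add: empty)

definition inner_content :: "'x set \<Rightarrow> ennreal" where
  "inner_content U = (SUP K\<in>{K. compact K \<and> K \<subseteq> U}. ennreal (\<rho> K))"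

definition outer_content :: "'x set \<Rightarrow> ennreal" where
  "outer_content A = (INF U\<in>{U. open U \<and> A \<subseteq> U}. inner_content U)"

lemma inner_mono: "U \<subseteq> V \<Longrightarrow> inner_content U \<le> inner_content V"
  unfolding inner_content_def by (intro SUP_subset_mono) auto

lemma inner_upper: "compact K \<Longrightarrow> K \<subseteq> U \<Longrightarrow> ennreal (\<rho> K) \<le> inner_content U"
  unfolding inner_content_def by (intro SUP_upper) auto

lemma inner_le: "inner_content U \<le> ennreal (\<rho> U)"
  unfolding inner_content_def by (intro SUP_least ennreal_leI mono) auto

lemma inner_finite: "inner_content U < top_class.top"
  using inner_le[of U] ennreal_less_top order_le_less_trans by blast

lemma inner_least_add:
  assumes "\<And>K. compact K \<Longrightarrow> K \<subseteq> U \<Longrightarrow> ennreal (\<rho> K) + c \<le> b"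
  shows "inner_content U + c \<le> b"
proof -
  have "inner_content U + c = (SUP K\<in>{K. compact K \<and> K \<subseteq> U}. ennreal (\<rho> K) + c)"
    unfolding inner_content_def by (rule ennreal_SUP_add_left[symmetric]) auto
  also have "\<dots> \<le> b" using assms by (intro SUP_least) auto
  finally show ?thesis .
qed

lemma outer_open: "open U \<Longrightarrow> outer_content U = inner_content U"
  unfolding outer_content_def by (intro antisym INF_lower INF_greatest inner_mono) auto

lemma outer_mono: "A \<subseteq> B \<Longrightarrow> outer_content A \<le> outer_content B"
  unfolding outer_content_def by (intro INF_superset_mono) auto

lemma outer_le: "open U \<Longrightarrow> A \<subseteq> U \<Longrightarrow> outer_content A \<le> inner_content U"
  unfolding outer_content_def by (intro INF_lower) auto

lemma outer_closed: "closed C \<Longrightarrow> ennreal (\<rho> C) \<le> outer_content C"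
  unfolding outer_content_def
proof (intro INF_greatest)
  fix U assume "closed C" "U \<in> {U. open U \<and> C \<subseteq> U}"
  then show "ennreal (\<rho> C) \<le> inner_content U"
    using inner_upper[of "C \<inter> X" U] compact_X by (auto simp: Int_X closed_Int_compact)
qed

lemma inner_Union:
  fixes U :: "nat \<Rightarrow> 'x set"
  assumes U: "\<And>i. open (U i)"
  shows "inner_content (\<Union>i. U i) \<le> (\<Sum>i. inner_content (U i))"
  unfolding inner_content_def[of "\<Union>i. U i"]
proof (intro SUP_least)
  fix K assume "K \<in> {K. compact K \<and> K \<subseteq> (\<Union>i. U i)}"
  then have K: "compact K" "K \<subseteq> (\<Union>i. U i)" by auto
  obtain I where I: "finite I" "K \<subseteq> (\<Union>i\<in>I. U i)"
    by (rule compactE_image[OF K(1), of UNIV U]) (use U K(2) in auto)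
  \<comment> \<open>A Lebesgue number of the cover: \<open>L i\<close> keeps the points of
    \<open>K\<close> at distance at least \<open>d\<close> from the complement of
    \<open>U i\<close>, so finitely many compact pieces inside the \<open>U i\<close> exhaust
    \<open>K\<close>.\<close>
  obtain d where d: "d > 0" "\<And>x. x \<in> K \<Longrightarrow> \<exists>G\<in>U ` I. ball x d \<subseteq> G"
    by (rule Heine_Borel_lemma[OF K(1), of "U ` I"]) (use U I(2) in auto)
  define L where "L i = K - (\<Union>y\<in>- U i. ball y d)" for i
  have L: "compact (L i)" "L i \<subseteq> U i" for i
    using d(1) K(1) by (auto simp: L_def intro!: compact_diff)
  have "K \<subseteq> (\<Union>i\<in>I. L i)"
  proof
    fix x assume x: "x \<in> K"
    then obtain i where "i \<in> I" "ball x d \<subseteq> U i" using d(2) by auto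
    then have "x \<in> L i" using x by (auto simp: L_def dist_commute subset_iff)
    with \<open>i \<in> I\<close> show "x \<in> (\<Union>i\<in>I. L i)" by auto
  qed
  then have "\<rho> K \<le> (\<Sum>i\<in>I. \<rho> (L i))"
    using mono[of K "\<Union>i\<in>I. L i"] subadd_finite[OF I(1), of L] by linarith
  then have "ennreal (\<rho> K) \<le> (\<Sum>i\<in>I. ennreal (\<rho> (L i)))"
    by (simp add: ennreal_leI nonneg)
  also have "\<dots> \<le> (\<Sum>i\<in>I. inner_content (U i))" by (intro sum_mono inner_upper L)
  also have "\<dots> \<le> (\<Sum>i. inner_content (U i))" using I(1) by (intro sum_le_suminf) auto
  finally show "ennreal (\<rho> K) \<le> (\<Sum>i. inner_content (U i))" .
qed

lemma outer_Union: "outer_content (\<Union>i. A i) \<le> (\<Sum>i. outer_content (A i))" for A :: "nat \<Rightarrow> 'x set"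
proof (rule ennreal_le_epsilon)
  fix e :: real assume e: "e > 0"
  have "\<exists>U. open U \<and> A i \<subseteq> U \<and> inner_content U \<le> outer_content (A i) + ennreal (e * (1 / 2) ^ Suc i)" for i
  proof -
    have "outer_content (A i) < top_class.top" using outer_le[of UNIV "A i"] inner_finite[of UNIV] by auto
    then have "outer_content (A i) < outer_content (A i) + ennreal (e * (1 / 2) ^ Suc i)"
      using ennreal_add_left_cancel_less[of "outer_content (A i)" 0 "ennreal (e * (1 / 2) ^ Suc i)"] e by simp
    then show ?thesis unfolding outer_content_def INF_less_iff by (auto intro: less_imp_le)
  qed
  then obtain U where U: "\<And>i. open (U i)" "\<And>i. A i \<subseteq> U i"
    "\<And>i. inner_content (U i) \<le> outer_content (A i) + ennreal (e * (1 / 2) ^ Suc i)" by metis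
  have "outer_content (\<Union>i. A i) \<le> inner_content (\<Union>i. U i)" using U by (intro outer_le) auto
  also have "\<dots> \<le> (\<Sum>i. inner_content (U i))" by (rule inner_Union[OF U(1)])
  also have "\<dots> \<le> (\<Sum>i. outer_content (A i) + ennreal (e * (1 / 2) ^ Suc i))"
    using U(3) by (intro suminf_le) auto
  also have "\<dots> = (\<Sum>i. outer_content (A i)) + (\<Sum>i. ennreal (e * (1 / 2) ^ Suc i))"
    by (rule suminf_add[symmetric]) auto
  also have "(\<Sum>i. ennreal (e * (1 / 2) ^ Suc i)) = ennreal e"
  proof -
    have "(\<lambda>i. e * (1 / 2) ^ Suc i) sums (e * 1)" by (intro sums_mult power_half_series)
    then have "(\<Sum>i. e * (1 / 2) ^ Suc i) = e" "summable (\<lambda>i. e * (1 / 2) ^ Suc i)" by (simp_all only: sums_iff mult_1_right)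
    then show ?thesis using e by (subst suminf_ennreal2) auto
  qed
  finally show "outer_content (\<Union>i. A i) \<le> (\<Sum>i. outer_content (A i)) + ennreal e" .
qed

text \<open>Caratheodory's criterion for open sets: approximate \<open>G \<inter> U\<close> by a
  compact \<open>K\<close>, then the open set \<open>G - K\<close>, which contains
  \<open>A - U\<close>, by a compact \<open>K'\<close>. As \<open>K\<close> and \<open>K'\<close>
  are disjoint, \<open>\<rho>\<close> adds up.\<close>

lemma open_split: "open U \<Longrightarrow> outer_content (A \<inter> U) + outer_content (A - U) \<le> outer_content A"
  unfolding outer_content_def[of A]
proof (intro INF_greatest)
  fix G assume U: "open U" and "G \<in> {U. open U \<and> A \<subseteq> U}"
  then have G: "open G" "A \<subseteq> G" by auto
  have "outer_content (A \<inter> U) + outer_content (A - U) \<le> inner_content (G \<inter> U) + outer_content (A - U)"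
    using G U by (intro add_right_mono outer_le) auto
  also have "\<dots> \<le> inner_content G"
  proof (rule inner_least_add)
    fix K assume K: "compact K" "K \<subseteq> G \<inter> U"
    have "outer_content (A - U) \<le> inner_content (G - K)"
      using G K by (intro outer_le) (auto simp: compact_imp_closed)
    moreover have "inner_content (G - K) + ennreal (\<rho> K) \<le> inner_content G"
    proof (rule inner_least_add)
      fix K' assume K': "compact K'" "K' \<subseteq> G - K"
      then have "K' \<inter> K = {}" by auto
      from additive[OF this] have "ennreal (\<rho> K') + ennreal (\<rho> K) = ennreal (\<rho> (K' \<union> K))"
        by (simp add: nonneg)
      also have "\<dots> \<le> inner_content G" using K K' by (intro inner_upper) auto
      finally show "ennreal (\<rho> K') + ennreal (\<rho> K) \<le> inner_content G" .
    qed
    ultimately show "ennreal (\<rho> K) + outer_content (A - U) \<le> inner_content G"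
      by (metis add.commute add_left_mono order_trans)
  qed
  finally show "outer_content (A \<inter> U) + outer_content (A - U) \<le> inner_content G" .
qed

definition Riesz_measure :: "'x measure" where "Riesz_measure = measure_of UNIV (sets borel) outer_content"

lemma sets_Riesz [simp]: "sets Riesz_measure = sets borel"
  by (simp add: Riesz_measure_def sets.sigma_sets_eq[of borel, simplified])

lemma space_Riesz [simp]: "space Riesz_measure = UNIV"
  using sets_eq_imp_space_eq[OF sets_Riesz] by simp

lemma emeasure_Riesz: "A \<in> sets borel \<Longrightarrow> emeasure Riesz_measure A = outer_content A"
proof -
  assume A: "A \<in> sets borel"
  define L where "L = lambda_system UNIV (Pow UNIV) outer_content"
  interpret P: sigma_algebra UNIV "Pow UNIV :: 'x set set" by (rule sigma_algebra_Pow)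
  have "outer_measure_space (Pow UNIV) outer_content"
    unfolding outer_measure_space_def positive_def increasing_def countably_subadditive_def
    using outer_mono outer_Union outer_open[of "{}"] inner_le[of "{}"] empty by auto
  then have ms: "measure_space UNIV L outer_content" unfolding L_def by (rule P.caratheodory_lemma)
  then interpret L: sigma_algebra UNIV L by (simp add: measure_space_def)
  have "{S. open S} \<subseteq> L"
  proof
    fix U :: "'x set" assume "U \<in> {S. open S}"
    then have U: "open U" by simp
    have "outer_content (U \<inter> x) + outer_content ((UNIV - U) \<inter> x) = outer_content x" for x
    proof (rule antisym)
      show "outer_content (U \<inter> x) + outer_content ((UNIV - U) \<inter> x) \<le> outer_content x"
        using open_split[OF U, of x] by (simp add: Int_commute Diff_eq)
      \<comment> \<open>Two sets padded by empty ones, so that countable subadditivity gives the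
        finite form.\<close>
      define D where "D = (\<lambda>i::nat. if i = 0 then U \<inter> x else if i = 1 then (UNIV - U) \<inter> x else {})"
      have "(\<Union>i. D i) = x"
      proof (intro equalityI subsetI)
        fix y assume "y \<in> x"
        then have "y \<in> D (if y \<in> U then 0 else 1)" by (simp add: D_def)
        then show "y \<in> (\<Union>i. D i)" by blast
      qed (auto simp: D_def split: if_splits)
      then have "outer_content x \<le> (\<Sum>i. outer_content (D i))"
        using outer_Union[of D] by simp
      also have "\<dots> = (\<Sum>i\<in>{0, 1::nat}. outer_content (D i))"
        using outer_open[of "{}"] inner_le[of "{}"] empty by (intro suminf_finite) (auto simp: D_def)
      finally show "outer_content x \<le> outer_content (U \<inter> x) + outer_content ((UNIV - U) \<inter> x)"
        by (simp add: D_def)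
    qed
    then show "U \<in> L" by (simp add: L_def lambda_system_def)
  qed
  then have sub: "sets borel \<subseteq> L"
    unfolding borel_def by (simp add: L.sigma_sets_subset)
  have "countably_additive L outer_content" "positive L outer_content" using ms by (auto simp: measure_space_def)
  then have "countably_additive (sets borel) outer_content" "positive (sets borel) outer_content"
    using sub unfolding countably_additive_def positive_def by (meson subset_trans | blast)+
  moreover have "sigma_algebra UNIV (sets (borel :: 'x measure))"
    using sets.sigma_algebra_axioms[of "borel :: 'x measure"] by simp
  ultimately show ?thesis using A unfolding Riesz_measure_def by (intro emeasure_measure_of_sigma)
qed

lemma closed_X: "closed X" using compact_X by (rule compact_imp_closed)

lemma X_borel [measurable, simp]: "X \<in> sets borel" using closed_X by simp

lemma emeasure_Riesz_UNIV: "emeasure Riesz_measure UNIV = 1"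
proof (rule antisym)
  show "emeasure Riesz_measure UNIV \<le> 1"
    using inner_le[of UNIV] total by (simp add: emeasure_Riesz outer_open)
  show "emeasure Riesz_measure UNIV \<ge> 1"
    using outer_closed[of UNIV] total by (simp add: emeasure_Riesz)
qed

lemma emeasure_Riesz_Int_X: "A \<in> sets borel \<Longrightarrow> emeasure Riesz_measure (A \<inter> X) = emeasure Riesz_measure A"
proof (rule antisym)
  assume A: "A \<in> sets borel"
  have "emeasure Riesz_measure (- X) \<le> ennreal (\<rho> (- X))"
    using inner_le[of "- X"] closed_X by (simp add: emeasure_Riesz outer_open open_Compl)
  then have 0: "emeasure Riesz_measure (- X) = 0" using null_outside by simp
  have "emeasure Riesz_measure A \<le> emeasure Riesz_measure (A \<inter> X \<union> - X)"
    using A by (intro emeasure_mono) auto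
  also have "\<dots> \<le> emeasure Riesz_measure (A \<inter> X) + emeasure Riesz_measure (- X)"
    using A by (intro emeasure_subadditive) auto
  finally show "emeasure Riesz_measure A \<le> emeasure Riesz_measure (A \<inter> X)" using 0 by simp
  show "emeasure Riesz_measure (A \<inter> X) \<le> emeasure Riesz_measure A"
    using A by (intro emeasure_mono) auto
qed

definition Riesz_on :: "'x measure" where "Riesz_on = restrict_space Riesz_measure X"

lemma space_Riesz_on [simp]: "space Riesz_on = X"
  by (simp add: Riesz_on_def space_restrict_space)

lemma sets_Riesz_on: "sets Riesz_on = sets (restrict_space borel X)"
  by (simp add: Riesz_on_def sets_restrict_space)

lemma emeasure_Riesz_on: "A \<in> sets borel \<Longrightarrow> emeasure Riesz_on (A \<inter> X) = emeasure Riesz_measure A"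
  unfolding Riesz_on_def by (subst emeasure_restrict_space) (auto simp: emeasure_Riesz_Int_X)

lemma prob_space_Riesz_on: "prob_space Riesz_on"
  using emeasure_Riesz_on[of UNIV] emeasure_Riesz_UNIV by (intro prob_spaceI) simp

text \<open>Comparing open sets is enough. Compact subsets of the preimage of \<open>U\<close> have
  compact images in \<open>U\<close>, compact subsets of \<open>U\<close> have compact preimages,
  and \<open>\<rho>\<close> is invariant on all sets; so the inner contents agree.\<close>

lemma Riesz_on_invariant:
  assumes T: "continuous_on X T" "T ` X \<subseteq> X" and inv: "\<And>A. \<rho> {x\<in>X. T x \<in> A} = \<rho> A"
  shows "invariant_prob_on X T Riesz_on"
proof -
  have TX: "T x \<in> X" if "x \<in> X" for x using T(2) that by auto
  have meas_borel: "T \<in> borel_measurable Riesz_on"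
    using borel_measurable_continuous_on_restrict[OF T(1)] measurable_cong_sets[OF sets_Riesz_on refl] by blast
  have meas: "T \<in> measurable Riesz_on Riesz_on"
    unfolding measurable_cong_sets[OF refl sets_Riesz_on]
    by (rule measurable_restrict_space2[OF _ meas_borel]) (simp add: TX)
  have open_eq: "emeasure (distr Riesz_on borel T) U = emeasure Riesz_measure U" if U: "open U" for U
  proof -
    \<comment> \<open>The preimage of \<open>U\<close> is open only relative to \<open>X\<close>;
      \<open>V\<close> is an open set of the whole space with the same trace on
      \<open>X\<close>.\<close>
    from iffD1[OF continuous_on_open_invariant T(1), rule_format, OF U]
    obtain V where V: "open V" "V \<inter> X = T -` U \<inter> X" by blast
    have "emeasure (distr Riesz_on borel T) U = emeasure Riesz_on (V \<inter> X)"
      using U V meas_borel by (simp add: emeasure_distr)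
    also have "\<dots> = inner_content V" using V(1) by (simp add: emeasure_Riesz_on emeasure_Riesz outer_open)
    also have "\<dots> = inner_content U"
    proof (rule antisym)
      show "inner_content V \<le> inner_content U"
        unfolding inner_content_def[of V]
      proof (rule SUP_least)
        fix K assume K: "K \<in> {K. compact K \<and> K \<subseteq> V}"
        have cont: "continuous_on (K \<inter> X) T" using T(1) by (rule continuous_on_subset) auto
        have "ennreal (\<rho> K) = ennreal (\<rho> (K \<inter> X))" by (simp add: Int_X)
        also have "\<dots> \<le> ennreal (\<rho> {x\<in>X. T x \<in> T ` (K \<inter> X)})" by (intro ennreal_leI mono) auto
        also have "\<dots> = ennreal (\<rho> (T ` (K \<inter> X)))" by (simp add: inv)
        also have "\<dots> \<le> inner_content U"
          using K V(2) compact_X cont by (intro inner_upper compact_continuous_image) (auto simp: compact_Int)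
        finally show "ennreal (\<rho> K) \<le> inner_content U" .
      qed
      show "inner_content U \<le> inner_content V"
        unfolding inner_content_def[of U]
      proof (rule SUP_least)
        fix K assume K: "K \<in> {K. compact K \<and> K \<subseteq> U}"
        have "closed {x\<in>X. T x \<in> K}"
          using continuous_closed_preimage[OF T(1) closed_X compact_imp_closed[of K]] K
          by (simp add: vimage_def Int_def)
        then have "compact {x\<in>X. T x \<in> K}"
          using compact_Int_closed[OF compact_X, of "{x\<in>X. T x \<in> K}"] by (simp add: Int_absorb1 subset_iff)
        moreover have "{x\<in>X. T x \<in> K} \<subseteq> V" using K V(2) by auto
        ultimately show "ennreal (\<rho> K) \<le> inner_content V"
          using inner_upper[of "{x\<in>X. T x \<in> K}" V] by (simp add: inv)
      qed
    qed
    also have "\<dots> = emeasure Riesz_measure U" using U by (simp add: emeasure_Riesz outer_open)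
    finally show ?thesis .
  qed
  have eq: "distr Riesz_on borel T = Riesz_measure"
  proof (rule measure_eqI_generator_eq[where E = "{S. open S}" and \<Omega> = UNIV and A = "\<lambda>_. UNIV"])
    show "Int_stable {S :: 'x set. open S}" by (auto simp: Int_stable_def)
    show "sets (distr Riesz_on borel T) = sigma_sets UNIV {S. open S}"
      by (simp add: borel_def)
    show "sets Riesz_measure = sigma_sets UNIV {S. open S}" unfolding sets_Riesz by (simp add: borel_def)
  qed (use open_eq emeasure_Riesz_UNIV in auto)
  have "distr Riesz_on Riesz_on T = Riesz_on"
  proof (rule measure_eqI)
    fix A assume "A \<in> sets (distr Riesz_on Riesz_on T)"
    then have A: "A \<subseteq> X" "A \<in> sets borel" "A \<in> sets Riesz_on"
      using sets_restrict_space_iff[of X borel A] by (auto simp: sets_Riesz_on)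
    have "emeasure (distr Riesz_on Riesz_on T) A = emeasure (distr Riesz_on borel T) A"
      using A meas meas_borel by (simp add: emeasure_distr)
    also have "\<dots> = emeasure Riesz_on (A \<inter> X)" using A by (simp add: eq emeasure_Riesz_on)
    finally show "emeasure (distr Riesz_on Riesz_on T) A = emeasure Riesz_on A"
      using A by (simp add: Int_absorb2)
  qed simp
  then show ?thesis
    unfolding invariant_prob_on_def using prob_space_Riesz_on sets_Riesz_on by simp
qed

section \<open>Comparison of limiting means with integrals\<close>

lemma sum_levels:
  fixes t :: real
  assumes "n > 0" "0 \<le> t" "t \<le> 1"
  shows "(\<Sum>k=1..n. of_bool (real k / n \<le> t)) = of_int \<lfloor>n * t\<rfloor>"
proof -
  have "{1..n} \<inter> {k. real k / n \<le> t} = {1..nat \<lfloor>n * t\<rfloor>}"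
  proof (intro equalityI subsetI)
    fix k assume "k \<in> {1..n} \<inter> {k. real k / n \<le> t}"
    then show "k \<in> {1..nat \<lfloor>n * t\<rfloor>}"
      using assms by (auto simp: le_nat_iff le_floor_iff field_simps)
  next
    fix k assume k: "k \<in> {1..nat \<lfloor>n * t\<rfloor>}"
    then have "real k \<le> n * t" using order_trans[OF _ of_nat_floor[of "n * t"], of "real k"] assms by auto
    moreover have "real n * t \<le> real n * 1" using assms by (intro mult_left_mono) auto
    ultimately have "real k \<le> n * t" "real k \<le> real n" by auto
    then show "k \<in> {1..n} \<inter> {k. real k / n \<le> t}"
      using k assms by (auto simp: field_simps)
  qed
  then show ?thesis using assms by simp
qed

text \<open>The content of a closed set is at most its measure, while the reverse may fail, so only
  a one-sided bound is available. The hypothesis on \<open>\<Lambda>\<close> is a layer-cake sum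
  over closed level sets, with discretisation error \<open>1 / n\<close>.\<close>

lemma integral_lower_bound:
  assumes g: "continuous_on X g" "\<And>x. x \<in> X \<Longrightarrow> 0 \<le> g x" "\<And>x. x \<in> X \<Longrightarrow> g x \<le> (1::real)"
    and \<Lambda>: "\<And>n. n > 0 \<Longrightarrow> \<Lambda> \<le> 1 / real n + (\<Sum>k=1..n. \<rho> {x\<in>X. real k / n \<le> g x}) / n"
  shows "\<Lambda> \<le> (\<integral>x. g x \<partial>Riesz_on)"
proof (rule field_le_epsilon)
  fix e :: real assume "e > 0"
  then obtain n where n: "n > 0" "1 / real n < e" by (metis nat_approx_posE zero_less_Suc)
  interpret P: prob_space Riesz_on by (rule prob_space_Riesz_on)
  have gm: "g \<in> borel_measurable Riesz_on"
    using borel_measurable_continuous_on_restrict[OF g(1)] measurable_cong_sets[OF sets_Riesz_on refl] by blast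
  have gi: "integrable Riesz_on g"
    using g gm by (intro P.integrable_const_bound[of _ 1]) auto
  define C where "C k = {x\<in>X. real k / n \<le> g x}" for k
  have closedC: "closed (C k)" for k
    using continuous_closed_preimage[OF g(1) closed_X closed_atLeast[of "real k / n"]]
    by (simp add: C_def vimage_def Int_def)
  have CX: "C k \<subseteq> X" for k by (auto simp: C_def)
  have Cs: "C k \<in> sets Riesz_on" for k
    using closedC[of k] CX[of k] by (simp add: sets_Riesz_on sets_restrict_space_iff)
  have \<rho>C: "\<rho> (C k) \<le> measure Riesz_on (C k)" for k
  proof -
    have "ennreal (\<rho> (C k)) \<le> emeasure Riesz_on (C k \<inter> X)"
      using outer_closed[OF closedC[of k]] closedC[of k] by (simp add: emeasure_Riesz_on emeasure_Riesz)
    then show ?thesis using CX[of k] by (simp add: Int_absorb2 P.emeasure_eq_measure)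
  qed
  have "\<Lambda> \<le> 1 / n + (\<Sum>k=1..n. \<rho> (C k)) / n" unfolding C_def using n(1) by (rule \<Lambda>)
  also have "\<dots> \<le> e + (\<Sum>k=1..n. measure Riesz_on (C k)) / n"
    using n by (intro add_mono divide_right_mono sum_mono \<rho>C) auto
  also have "(\<Sum>k=1..n. measure Riesz_on (C k)) / n = (\<integral>x. (\<Sum>k=1..n. indicator (C k) x) / n \<partial>Riesz_on)"
  proof -
    have "(\<integral>x. (\<Sum>k=1..n. indicator (C k) x :: real) \<partial>Riesz_on) = (\<Sum>k=1..n. \<integral>x. indicator (C k) x \<partial>Riesz_on)"
      by (rule Bochner_Integration.integral_sum) (use Cs in \<open>auto intro!: integrable_indicator simp: P.emeasure_eq_measure\<close>)
    then show ?thesis using Cs CX by (simp add: Int_absorb2)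
  qed
  also have "\<dots> \<le> (\<integral>x. g x \<partial>Riesz_on)"
  proof (intro integral_mono gi integrable_divide integrable_sum integrable_indicator)
    fix x assume "x \<in> space Riesz_on"
    then have x: "x \<in> X" by simp
    then have "(\<Sum>k=1..n. indicator (C k) x) = (\<Sum>k=1..n. of_bool (real k / n \<le> g x) :: real)"
      by (intro sum.cong refl) (simp add: indicator_def C_def)
    also have "\<dots> = of_int \<lfloor>n * g x\<rfloor>" using n g x by (intro sum_levels) auto
    also have "\<dots> \<le> n * g x" by simp
    finally show "(\<Sum>k=1..n. indicator (C k) x) / n \<le> g x" using n(1) by (simp add: field_simps)
  qed (use Cs in \<open>auto simp: P.emeasure_eq_measure\<close>)
  finally show "\<Lambda> \<le> (\<integral>x. g x \<partial>Riesz_on) + e" by simp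
qed

end

text \<open>Along a filter of failing \<open>N\<close>, the frequencies of all sets and the mean of
  \<open>g\<close> converge to \<open>\<rho>\<close> and \<open>\<Lambda>\<close>. By
  \<open>inv\<close> the content \<open>\<rho>\<close> is invariant, so its Riesz measure is
  \<open>\<nu>\<close>. The one-sided bound for \<open>g\<close> and for \<open>1 - g\<close>
  together gives equality.\<close>

lemma equidistribution_unit_interval:
  fixes z :: "nat \<Rightarrow> 'x::metric_space" and g :: "'x \<Rightarrow> real"
  assumes ue: "uniquely_ergodic_system X \<nu> T" and z: "\<And>n. z n \<in> X"
    and fin: "\<And>N. finite (S N)" and ne: "\<forall>\<^sub>F N in sequentially. S N \<noteq> {}"
    and inv: "\<And>A. (\<lambda>N. (\<Sum>n\<in>S N. indicator A (T (z n)) - indicator A (z n)) / real (card (S N))) \<longlonglongrightarrow> (0 :: real)"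
    and g: "continuous_on X g" "\<And>x. x \<in> X \<Longrightarrow> 0 \<le> g x \<and> g x \<le> 1"
  shows "(\<lambda>N. (\<Sum>n\<in>S N. g (z n)) / real (card (S N))) \<longlonglongrightarrow> (\<integral>x. g x \<partial>\<nu>)"
proof (rule ccontr)
  define avg where "avg \<phi> N = (\<Sum>n\<in>S N. \<phi> (z n)) / real (card (S N))" for \<phi> :: "'x \<Rightarrow> real" and N
  assume "\<not> ?thesis"
  then obtain \<eta> where \<eta>: "\<eta> > 0" "\<exists>\<^sub>F N in sequentially. \<not> \<bar>avg g N - (\<integral>x. g x \<partial>\<nu>)\<bar> < \<eta>"
    by (auto simp: tendsto_iff not_eventually dist_real_def avg_def)
  define bad where "bad N \<longleftrightarrow> \<not> \<bar>avg g N - (\<integral>x. g x \<partial>\<nu>)\<bar> < \<eta>" for N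
  define F where "F = inf sequentially (principal {N. bad N})"
  have F0: "F \<noteq> bot"
    using \<eta>(2) unfolding F_def bad_def[symmetric] trivial_limit_def eventually_inf_principal
    by (simp add: frequently_def)
  have avg_bound: "\<bar>avg \<phi> N\<bar> \<le> 1" if "\<And>x. x \<in> X \<Longrightarrow> \<bar>\<phi> x\<bar> \<le> 1" for \<phi> N
  proof -
    have "\<bar>\<Sum>n\<in>S N. \<phi> (z n)\<bar> \<le> real (card (S N))"
      using sum_norm_bound[of "S N" "\<lambda>n. \<phi> (z n)" 1] that z by simp
    then show ?thesis by (cases "card (S N) = 0") (auto simp: avg_def abs_divide)
  qed
  \<comment> \<open>\<open>Inl A\<close> indexes the frequency of visits to \<open>A\<close>, \<open>Inr ()\<close> the mean of \<open>g\<close>\<close>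
  define M where "M i N = avg (case i of Inl A \<Rightarrow> indicator A | Inr (u :: unit) \<Rightarrow> g) N" for i N
  have "\<bar>M i N\<bar> \<le> 1" for i N
    unfolding M_def using g(2) by (intro avg_bound) (auto split: sum.split simp: indicator_def)
  then obtain F' \<Phi> where F': "F' \<le> F" "F' \<noteq> bot" and lim: "\<And>i. (M i \<longlongrightarrow> \<Phi> i) F'"
    using cluster_filter[OF F0, of M "\<lambda>_. 1"] by metis
  have F'seq: "F' \<le> sequentially" using F'(1) unfolding F_def by (simp add: le_inf_iff)
  define \<rho> where "\<rho> A = \<Phi> (Inl A)" for A
  have \<rho>: "(avg (indicator A) \<longlongrightarrow> \<rho> A) F'" for A using lim[of "Inl A"] by (simp add: M_def[abs_def] \<rho>_def)
  define \<Lambda> where "\<Lambda> = \<Phi> (Inr ())"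
  have \<Lambda>: "(avg g \<longlongrightarrow> \<Lambda>) F'" using lim[of "Inr ()"] by (simp add: M_def[abs_def] \<Lambda>_def)
  have one: "\<forall>\<^sub>F N in F'. S N \<noteq> {}" using ne F'seq by (rule filter_leD[rotated])
  have X: "compact X" "continuous_on X T" "T ` X \<subseteq> X" and uniq: "\<And>\<mu>. invariant_prob_on X T \<mu> \<Longrightarrow> \<mu> = \<nu>"
    and inv_\<nu>: "invariant_prob_on X T \<nu>"
    using ue by (auto simp: uniquely_ergodic_system_def)
  interpret content_on_compact X \<rho>
  proof
    show "compact X" by (rule X)
    show "0 \<le> \<rho> A" for A
      by (rule tendsto_lowerbound[OF \<rho>[of A] _ F'(2)]) (auto simp: avg_def intro!: always_eventually divide_nonneg_nonneg sum_nonneg)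
    show "\<rho> (A \<union> B) = \<rho> A + \<rho> B" if "A \<inter> B = {}" for A B
    proof (rule tendsto_unique[OF F'(2) \<rho>])
      have "avg (indicator (A \<union> B)) = (\<lambda>N. avg (indicator A) N + avg (indicator B) N)"
        unfolding avg_def add_divide_distrib[symmetric] sum.distrib[symmetric] using that
        by (simp add: indicator_add)
      then show "(avg (indicator (A \<union> B)) \<longlongrightarrow> \<rho> A + \<rho> B) F'"
        by (simp only:) (intro tendsto_add \<rho>)
    qed
    show "\<rho> (- X) = 0"
      by (rule tendsto_unique[OF F'(2) \<rho>]) (simp add: avg_def[abs_def] z)
    have "\<forall>\<^sub>F N in F'. avg (indicator UNIV) N = 1"
      using one by eventually_elim (simp add: avg_def fin)
    then show "\<rho> UNIV = 1" by (intro tendsto_unique[OF F'(2) \<rho>] tendsto_eventually)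
  qed
  have "invariant_prob_on X T Riesz_on"
  proof (rule Riesz_on_invariant[OF X(2,3)])
    fix A
    have "((\<lambda>N. avg (indicator A) N + (\<Sum>n\<in>S N. indicator A (T (z n)) - indicator A (z n)) / real (card (S N))) \<longlongrightarrow> \<rho> A + 0) F'"
      by (intro tendsto_add \<rho> tendsto_mono[OF F'seq inv])
    moreover have "avg (indicator A) N + (\<Sum>n\<in>S N. indicator A (T (z n)) - indicator A (z n)) / real (card (S N))
        = avg (indicator {x\<in>X. T x \<in> A}) N" for N
    proof -
      have "avg (indicator A) N + (\<Sum>n\<in>S N. indicator A (T (z n)) - indicator A (z n)) / real (card (S N))
          = (\<Sum>n\<in>S N. indicator A (T (z n))) / real (card (S N))"
        by (simp add: avg_def sum_subtractf diff_divide_distrib)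
      also have "(\<Sum>n\<in>S N. indicator A (T (z n))) = (\<Sum>n\<in>S N. indicator {x\<in>X. T x \<in> A} (z n) :: real)"
        by (intro sum.cong refl) (simp add: indicator_def z)
      finally show ?thesis by (simp add: avg_def)
    qed
    ultimately have "(avg (indicator {x\<in>X. T x \<in> A}) \<longlongrightarrow> \<rho> A) F'" by simp
    then show "\<rho> {x\<in>X. T x \<in> A} = \<rho> A" by (rule tendsto_unique[OF F'(2) \<rho>])
  qed
  then have Riesz\<nu>: "Riesz_on = \<nu>" by (rule uniq)
  have upper: "L \<le> (\<integral>x. f x \<partial>\<nu>)"
    if f: "continuous_on X f" "\<And>x. x \<in> X \<Longrightarrow> 0 \<le> f x \<and> f x \<le> 1" and L: "(avg f \<longlongrightarrow> L) F'" for f L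
    unfolding Riesz\<nu>[symmetric]
  proof (rule integral_lower_bound)
    fix n :: nat assume n: "n > 0"
    define C where "C k = {x\<in>X. real k / n \<le> f x}" for k
    have "((\<lambda>N. 1 / n + (\<Sum>k=1..n. avg (indicator (C k)) N) / n) \<longlongrightarrow> 1 / n + (\<Sum>k=1..n. \<rho> (C k)) / n) F'"
      using n by (intro tendsto_intros \<rho>) auto
    then show "L \<le> 1 / n + (\<Sum>k=1..n. \<rho> {x\<in>X. real k / n \<le> f x}) / n"
      unfolding C_def[symmetric]
    proof (rule tendsto_le[OF F'(2) _ L])
      show "\<forall>\<^sub>F N in F'. avg f N \<le> 1 / n + (\<Sum>k=1..n. avg (indicator (C k)) N) / n"
        using one
      proof eventually_elim
        case (elim N)
        then have c: "real (card (S N)) > 0" using fin[of N] by (simp add: card_gt_0_iff)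
        have "f (z m) \<le> 1 / n + (\<Sum>k=1..n. indicator (C k) (z m)) / n" for m
        proof -
          have "(\<Sum>k=1..n. indicator (C k) (z m)) = (\<Sum>k=1..n. of_bool (real k / n \<le> f (z m)) :: real)"
            by (intro sum.cong refl) (simp add: indicator_def C_def z)
          also have "\<dots> = of_int \<lfloor>n * f (z m)\<rfloor>" using n f(2)[OF z] by (intro sum_levels) auto
          also have "\<dots> \<ge> n * f (z m) - 1" by linarith
          finally show ?thesis using n by (simp add: field_simps)
        qed
        then have "(\<Sum>m\<in>S N. f (z m)) \<le> (\<Sum>m\<in>S N. 1 / n + (\<Sum>k=1..n. indicator (C k) (z m)) / n)"
          by (intro sum_mono) auto
        also have "\<dots> = card (S N) / n + (\<Sum>k=1..n. \<Sum>m\<in>S N. indicator (C k) (z m)) / n"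
          by (simp add: sum.distrib sum_divide_distrib sum.swap[of _ "S N"])
        finally have "(\<Sum>m\<in>S N. f (z m)) / card (S N) \<le> (card (S N) / n + (\<Sum>k=1..n. \<Sum>m\<in>S N. indicator (C k) (z m)) / n) / card (S N)"
          by (intro divide_right_mono) auto
        also have "\<dots> = 1 / n + (\<Sum>k=1..n. avg (indicator (C k)) N) / n"
          using c by (simp add: avg_def add_divide_distrib flip: sum_divide_distrib)
        finally show ?case by (simp add: avg_def)
      qed
    qed
  qed (use f in auto)
  interpret P: prob_space \<nu> using inv_\<nu> by (simp add: invariant_prob_on_def)
  have sets\<nu>: "sets \<nu> = sets (restrict_space borel X)" "space \<nu> = X"
    using inv_\<nu> space_Riesz_on Riesz\<nu> by (auto simp: invariant_prob_on_def)
  have gm: "g \<in> borel_measurable \<nu>"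
    using borel_measurable_continuous_on_restrict[OF g(1)] measurable_cong_sets[OF sets\<nu>(1) refl] by blast
  have gi: "integrable \<nu> g"
    using g gm by (intro P.integrable_const_bound[of _ 1]) (auto simp: sets\<nu>(2))
  have "\<Lambda> \<le> (\<integral>x. g x \<partial>\<nu>)" using g \<Lambda> by (intro upper) auto
  moreover have "1 - \<Lambda> \<le> (\<integral>x. 1 - g x \<partial>\<nu>)"
  proof (rule upper)
    have "\<forall>\<^sub>F N in F'. 1 - avg g N = avg (\<lambda>x. 1 - g x) N"
      using one
    proof eventually_elim
      case (elim N)
      then have "real (card (S N)) > 0" using fin[of N] by (simp add: card_gt_0_iff)
      then show ?case by (simp add: avg_def sum_subtractf diff_divide_distrib)
    qed
    with tendsto_diff[OF tendsto_const \<Lambda>] show "(avg (\<lambda>x. 1 - g x) \<longlongrightarrow> 1 - \<Lambda>) F'"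
      by (rule Lim_transform_eventually)
  qed (use g in \<open>auto intro!: continuous_intros\<close>)
  moreover have "(\<integral>x. 1 - g x \<partial>\<nu>) = 1 - (\<integral>x. g x \<partial>\<nu>)"
    using gi by (simp add: P.prob_space)
  ultimately have "\<Lambda> = (\<integral>x. g x \<partial>\<nu>)" by simp
  with \<Lambda> have "\<forall>\<^sub>F N in F'. \<bar>avg g N - (\<integral>x. g x \<partial>\<nu>)\<bar> < \<eta>"
    using \<eta>(1) by (simp add: tendsto_iff dist_real_def)
  moreover have "\<forall>\<^sub>F N in F'. bad N"
    using F'(1) by (rule filter_leD) (simp add: F_def eventually_inf_principal)
  ultimately have "\<forall>\<^sub>F N in F'. False" by eventually_elim (simp add: bad_def)
  with F'(2) show False by (simp add: trivial_limit_def)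
qed

theorem equidistribution:
  fixes z :: "nat \<Rightarrow> 'x::metric_space" and h :: "'x \<Rightarrow> complex"
  assumes ue: "uniquely_ergodic_system X \<nu> T" and z: "\<And>n. z n \<in> X"
    and fin: "\<And>N. finite (S N)" and ne: "\<forall>\<^sub>F N in sequentially. S N \<noteq> {}"
    and inv: "\<And>A. (\<lambda>N. (\<Sum>n\<in>S N. indicator A (T (z n)) - indicator A (z n)) / real (card (S N))) \<longlonglongrightarrow> (0 :: real)"
    and h: "continuous_on X h"
  shows "(\<lambda>N. (\<Sum>n\<in>S N. h (z n)) / of_nat (card (S N))) \<longlonglongrightarrow> (\<integral>x. h x \<partial>\<nu>)"
proof -
  have X: "compact X" and inv_\<nu>: "invariant_prob_on X T \<nu>"
    using ue by (auto simp: uniquely_ergodic_system_def)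
  interpret P: prob_space \<nu> using inv_\<nu> by (simp add: invariant_prob_on_def)
  have sets\<nu>: "sets \<nu> = sets (restrict_space borel X)"
    using inv_\<nu> by (auto simp: invariant_prob_on_def)
  then have space\<nu>: "space \<nu> = X" using sets_eq_imp_space_eq[OF sets\<nu>] by (simp add: space_restrict_space)
  obtain B0 where B0: "\<And>x. x \<in> X \<Longrightarrow> cmod (h x) \<le> B0"
    using compact_imp_bounded[OF compact_continuous_image[OF h X]] by (auto simp: bounded_iff)
  define B where "B = max B0 1"
  have B: "B > 0" "\<And>x. x \<in> X \<Longrightarrow> cmod (h x) \<le> B" using B0 by (fastforce simp: B_def)+
  have real: "(\<lambda>N. (\<Sum>n\<in>S N. f (z n)) / real (card (S N))) \<longlonglongrightarrow> (\<integral>x. f x \<partial>\<nu>)"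
    if f: "continuous_on X f" "\<And>x. x \<in> X \<Longrightarrow> \<bar>f x\<bar> \<le> B" for f :: "'x \<Rightarrow> real"
  proof -
    define g where "g x = (f x + B) / (2 * B)" for x
    have fm: "f \<in> borel_measurable \<nu>"
      using borel_measurable_continuous_on_restrict[OF f(1)] measurable_cong_sets[OF sets\<nu> refl] by blast
    have fi: "integrable \<nu> f"
      using f fm by (intro P.integrable_const_bound[of _ B]) (auto simp: space\<nu>)
    have "0 \<le> g x \<and> g x \<le> 1" if "x \<in> X" for x
      using f(2)[OF that] B(1) by (auto simp: g_def field_simps abs_le_iff)
    moreover have "continuous_on X g" unfolding g_def[abs_def] using B(1) by (intro continuous_intros f) auto
    ultimately have "(\<lambda>N. (\<Sum>n\<in>S N. g (z n)) / real (card (S N))) \<longlonglongrightarrow> (\<integral>x. g x \<partial>\<nu>)"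
      by (intro equidistribution_unit_interval[OF ue z fin ne inv]) auto
    then have lim: "(\<lambda>N. 2 * B * ((\<Sum>n\<in>S N. g (z n)) / real (card (S N))) - B) \<longlonglongrightarrow> 2 * B * (\<integral>x. g x \<partial>\<nu>) - B"
      by (intro tendsto_intros)
    have eq: "2 * B * (\<integral>x. g x \<partial>\<nu>) - B = (\<integral>x. f x \<partial>\<nu>)"
      using fi B(1) by (simp add: g_def P.prob_space)
    have ev: "\<forall>\<^sub>F N in sequentially. 2 * B * ((\<Sum>n\<in>S N. g (z n)) / real (card (S N))) - B = (\<Sum>n\<in>S N. f (z n)) / real (card (S N))"
      using ne
    proof eventually_elim
      case (elim N)
      then have "real (card (S N)) > 0" using fin[of N] by (simp add: card_gt_0_iff)
      moreover have "(\<Sum>n\<in>S N. g (z n)) = ((\<Sum>n\<in>S N. f (z n)) + card (S N) * B) / (2 * B)"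
        by (simp add: g_def sum.distrib flip: sum_divide_distrib)
      ultimately show ?case using B(1) by (simp add: field_simps)
    qed
    show ?thesis using Lim_transform_eventually[OF lim ev] unfolding eq .
  qed
  have hm: "h \<in> borel_measurable \<nu>"
    using borel_measurable_continuous_on_restrict[OF h] measurable_cong_sets[OF sets\<nu> refl] by blast
  have hi: "integrable \<nu> h"
    using B hm by (intro P.integrable_const_bound[of _ B]) (auto simp: space\<nu>)
  have "(\<lambda>N. (\<Sum>n\<in>S N. Re (h (z n))) / real (card (S N))) \<longlonglongrightarrow> (\<integral>x. Re (h x) \<partial>\<nu>)"
    using order_trans[OF abs_Re_le_cmod B(2)] by (intro real continuous_intros h)
  moreover have "(\<lambda>N. (\<Sum>n\<in>S N. Im (h (z n))) / real (card (S N))) \<longlonglongrightarrow> (\<integral>x. Im (h x) \<partial>\<nu>)"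
    using order_trans[OF abs_Im_le_cmod B(2)] by (intro real continuous_intros h)
  ultimately show ?thesis
    using hi by (simp add: tendsto_complex_iff)
qed

section \<open>Correlations of divisor sums\<close>

lemma upto_real_of_nat: "upto_real (real N) = {1..N}"
  by (auto simp: upto_real_def)

lemma card_multiples: "k > 0 \<Longrightarrow> card {n\<in>{1..N}. k dvd n} = N div k"
  using card_multiples_upto_real[of k "real N"]
  by (simp add: upto_real_of_nat floor_divide_of_nat_eq flip: of_nat_eq_iff)

lemma card_residue_class_bounds:
  fixes l c N :: nat
  assumes l: "l > 0"
  shows "\<bar>real (card {n\<in>{1..N}. [n = c] (mod l)}) - N / l\<bar> \<le> 1"
proof -
  define r where "r = c mod l"
  have r: "r < l" using l by (simp add: r_def)
  define A where "A = {n\<in>{1..N}. [n = c] (mod l)}"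
  have A_eq: "A = (\<lambda>j. l * j + r) ` {j. 1 \<le> l * j + r \<and> l * j + r \<le> N}"
  proof (intro equalityI subsetI)
    fix n assume n: "n \<in> A"
    have "n = l * (n div l) + r" using n mult_div_mod_eq[of l n] by (simp add: A_def cong_def r_def)
    then show "n \<in> (\<lambda>j. l * j + r) ` {j. 1 \<le> l * j + r \<and> l * j + r \<le> N}"
      using n by (intro image_eqI[of _ _ "n div l"]) (auto simp: A_def)
  qed (auto simp: A_def cong_def r_def)
  have inj: "inj_on (\<lambda>j. l * j + r) B" for B using l by (auto intro: inj_onI)
  have card: "card A = card {j. 1 \<le> l * j + r \<and> l * j + r \<le> N}"
    unfolding A_eq by (rule card_image[OF inj])
  define M where "M = N div l"
  have M: "real N / l - 1 < M" "M \<le> real N / l"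
  proof -
    have "real M = of_int \<lfloor>real N / real l\<rfloor>" by (simp add: M_def floor_divide_of_nat_eq)
    then show "real N / l - 1 < M" "M \<le> real N / l" by linarith+
  qed
  have le_iff: "l * j + r \<le> N \<longleftrightarrow> j \<le> (N - r) div l" if "r \<le> N" for j
    using that l by (simp add: less_eq_div_iff_mult_less_eq mult.commute le_diff_conv2)
  show ?thesis
  proof (cases "r \<le> N")
    case False
    then have "{j. 1 \<le> l * j + r \<and> l * j + r \<le> N} = {}" by auto
    with card have "card A = 0" by (simp only: card.empty)
    moreover have "real N / l \<le> 1" using False r l by simp
    ultimately show ?thesis unfolding A_def[symmetric] by simp
  next
    case rN: True
    define q where "q = (N - r) div l"
    have q: "real (N - r) / l - 1 < q" "q \<le> real (N - r) / l"
    proof -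
      have "real q = of_int \<lfloor>real (N - r) / real l\<rfloor>" by (simp add: q_def floor_divide_of_nat_eq)
      then show "real (N - r) / l - 1 < q" "q \<le> real (N - r) / l" by linarith+
    qed
    have rl: "real (N - r) / l = real N / l - real r / l" using rN by (simp add: of_nat_diff diff_divide_distrib)
    have r1: "real r / l < 1" "0 \<le> real r / l" using r by auto
    show ?thesis
    proof (cases "r = 0")
      case True
      have ge_iff: "1 \<le> l * j + r \<longleftrightarrow> 1 \<le> j" for j using l True by (cases j) auto
      have "{j. 1 \<le> l * j + r \<and> l * j + r \<le> N} = {1..q}"
        unfolding ge_iff le_iff[OF rN] q_def[symmetric] by (simp only: atLeastAtMost_def atLeast_def atMost_def Collect_conj_eq)
      with card have "card A = q" by (simp only: card_atLeastAtMost diff_Suc_1)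
      then show ?thesis unfolding A_def[symmetric] using q rl True by (simp add: abs_le_iff)
    next
      case False
      then have ge: "1 \<le> l * j + r" for j by simp
      have "{j. 1 \<le> l * j + r \<and> l * j + r \<le> N} = {..q}"
        unfolding le_iff[OF rN] q_def[symmetric] by (simp only: ge simp_thms atMost_def)
      with card have "real (card A) = real q + 1" by (simp only: card_atMost of_nat_Suc add.commute)
      then show ?thesis unfolding A_def[symmetric] using q rl r1 by linarith
    qed
  qed
qed

lemma residue_class_density:
  fixes l c :: nat
  assumes l: "l > 0"
  shows "(\<lambda>N. real (card {n\<in>{1..N}. [n = c] (mod l)}) / N) \<longlonglongrightarrow> 1 / l"
proof -
  have "(\<lambda>N. real (card {n\<in>{1..N}. [n = c] (mod l)}) / N - 1 / l) \<longlonglongrightarrow> 0"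
  proof (rule Lim_null_comparison)
    show "\<forall>\<^sub>F N in sequentially. norm (real (card {n\<in>{1..N}. [n = c] (mod l)}) / N - 1 / l) \<le> 1 / real N"
      using eventually_gt_at_top[of 0]
    proof eventually_elim
      case (elim N)
      have "real (card {n\<in>{1..N}. [n = c] (mod l)}) / N - 1 / l = (real (card {n\<in>{1..N}. [n = c] (mod l)}) - N / l) / N"
        using elim by (simp add: diff_divide_distrib)
      then show ?case using divide_right_mono[OF card_residue_class_bounds[OF l, of N c], of N]
        by (simp add: abs_divide)
    qed
  qed (rule lim_1_over_n)
  then show ?thesis by (rule LIM_zero_cancel)
qed

lemma Omega_equidistribution:
  fixes h :: "'x::metric_space \<Rightarrow> complex"
  assumes ue: "uniquely_ergodic_system X \<nu> T" and x: "x \<in> X" and h: "continuous_on X h" and l: "l > 0"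
  shows "(\<lambda>N. (\<Sum>n | n \<in> {1..N} \<and> [n = c] (mod l). h ((T ^^ prime_Omega n) x)) / of_nat N)
    \<longlonglongrightarrow> (1 / of_nat l) * (\<integral>y. h y \<partial>\<nu>)"
proof -
  define S where "S N = {n\<in>{1..N}. [n = c] (mod l)}" for N
  define z where "z n = (T ^^ prime_Omega n) x" for n
  have TX: "T ` X \<subseteq> X" using ue by (simp add: uniquely_ergodic_system_def)
  have "(T ^^ k) x \<in> X" for k using x TX by (induction k) auto
  then have z: "z n \<in> X" for n by (simp add: z_def)
  have fin: "finite (S N)" for N by (simp add: S_def)
  have dens: "(\<lambda>N. real (card (S N)) / N) \<longlonglongrightarrow> 1 / l" unfolding S_def by (rule residue_class_density[OF l])
  have "\<forall>\<^sub>F N in sequentially. real (card (S N)) / N > 0"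
    using order_tendstoD(1)[OF dens, of 0] l by simp
  then have ne: "\<forall>\<^sub>F N in sequentially. S N \<noteq> {}" by eventually_elim auto
  have inv: "(\<lambda>N. (\<Sum>n\<in>S N. indicator A (T (z n)) - indicator A (z n)) / real (card (S N))) \<longlonglongrightarrow> (0 :: real)" for A
  proof -
    \<comment> \<open>The orbit and the arbitrary set \<open>A\<close> enter only through this
      bounded sequence; applying \<open>T\<close> to \<open>z n\<close> becomes the shift of
      \<open>f\<close> by 1.\<close>
    define f where "f k = (indicator A ((T ^^ k) x) :: real)" for k
    have f: "\<bar>f k\<bar> \<le> 1" for k by (simp add: f_def indicator_def)
    have cm: "class_mean l f k c (real N) = (\<Sum>n\<in>S N. f (prime_Omega n + k)) / N" for k N
      unfolding class_mean_def upto_real_of_nat S_def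
      by (rule arg_cong[of _ _ "\<lambda>s. s / real N"], rule sum.mono_neutral_cong_right) auto
    have "(\<lambda>N. (class_mean l f (Suc 0) c (real N) - class_mean l f 0 c (real N)) / (real (card (S N)) / N)) \<longlonglongrightarrow> 0 / (1 / l)"
      using l by (intro tendsto_divide Omega_shift_invariant dens f) auto
    moreover have "\<forall>\<^sub>F N in sequentially. (class_mean l f (Suc 0) c (real N) - class_mean l f 0 c (real N)) / (real (card (S N)) / N)
        = (\<Sum>n\<in>S N. indicator A (T (z n)) - indicator A (z n)) / real (card (S N))"
      using eventually_gt_at_top[of 0]
    proof eventually_elim
      case (elim N)
      then have "(class_mean l f (Suc 0) c (real N) - class_mean l f 0 c (real N)) / (real (card (S N)) / N)
        = ((\<Sum>n\<in>S N. f (Suc (prime_Omega n))) - (\<Sum>n\<in>S N. f (prime_Omega n))) / real (card (S N))"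
        by (simp add: cm flip: diff_divide_distrib)
      then show ?case by (simp add: f_def z_def sum_subtractf)
    qed
    ultimately show ?thesis by (simp add: Lim_transform_eventually)
  qed
  have "(\<lambda>N. ((\<Sum>n\<in>S N. h (z n)) / of_nat (card (S N))) * of_real (real (card (S N)) / N)) \<longlonglongrightarrow> (\<integral>y. h y \<partial>\<nu>) * of_real (1 / l)"
    by (intro tendsto_mult tendsto_of_real dens equidistribution[OF ue z fin ne inv h])
  moreover have "\<forall>\<^sub>F N in sequentially. ((\<Sum>n\<in>S N. h (z n)) / of_nat (card (S N))) * of_real (real (card (S N)) / N)
      = (\<Sum>n | n \<in> {1..N} \<and> [n = c] (mod l). h ((T ^^ prime_Omega n) x)) / of_nat N"
    using ne
  proof eventually_elim
    case (elim N)
    then have "card (S N) \<noteq> 0" using fin[of N] by simp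
    then have "((\<Sum>n\<in>S N. h (z n)) / of_nat (card (S N))) * of_real (real (card (S N)) / N) = (\<Sum>n\<in>S N. h (z n)) / of_nat N"
      by simp
    then show ?case by (simp add: S_def z_def)
  qed
  ultimately have "(\<lambda>N. (\<Sum>n | n \<in> {1..N} \<and> [n = c] (mod l). h ((T ^^ prime_Omega n) x)) / of_nat N)
    \<longlonglongrightarrow> (\<integral>y. h y \<partial>\<nu>) * of_real (1 / l)" by (rule Lim_transform_eventually)
  then show ?thesis by (simp add: mult.commute)
qed

lemma prime_Omega_mult: "m > 0 \<Longrightarrow> n > 0 \<Longrightarrow> prime_Omega (m * n) = prime_Omega m + prime_Omega n"
  by (simp add: prime_Omega_def prime_factorization_mult)

text \<open>With \<open>n = m * k\<close> the condition on \<open>l\<close> fixes \<open>k\<close>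
  modulo \<open>l\<close>, and \<open>\<Omega>(n) = \<Omega>(k) + \<Omega>(m)\<close> moves the
  starting point from \<open>x\<close> to \<open>x'\<close>. The limit is the same for every
  starting point in \<open>X\<close>.\<close>

lemma Omega_equidistribution_shifted_multiples:
  fixes h :: "'x::metric_space \<Rightarrow> complex"
  assumes ue: "uniquely_ergodic_system X \<nu> T" and x: "x \<in> X" and h: "continuous_on X h"
    and ml: "m > 0" "l > 0" "coprime m l"
  shows "(\<lambda>N. (\<Sum>n | n \<in> {1..N} \<and> m dvd n \<and> l dvd n + 1. h ((T ^^ prime_Omega n) x)) / of_nat N)
    \<longlonglongrightarrow> (1 / of_nat (m * l)) * (\<integral>y. h y \<partial>\<nu>)"
proof -
  define x' where "x' = (T ^^ prime_Omega m) x"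
  have TX: "T ` X \<subseteq> X" using ue by (simp add: uniquely_ergodic_system_def)
  have "(T ^^ k) x \<in> X" for k using x TX by (induction k) auto
  then have x': "x' \<in> X" by (simp add: x'_def)
  \<comment> \<open>The class of \<open>- 1 / m\<close> modulo \<open>l\<close>, with
    \<open>l - 1\<close> standing for \<open>- 1\<close> in the naturals.\<close>
  define c where "c = (l - 1) * inv_mod l m"
  have mc: "[m * c = l - 1] (mod l)"
    using inv_mod_cancel(2)[OF ml(2,3), of "l - 1"] by (simp add: c_def mult_ac)
  have iff: "l dvd m * k + 1 \<longleftrightarrow> [k = c] (mod l)" for k
  proof -
    have "l dvd m * k + 1 \<longleftrightarrow> [m * k + 1 = l - 1 + 1] (mod l)" using ml(2) by (simp add: cong_def dvd_eq_mod_eq_0)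
    also have "\<dots> \<longleftrightarrow> [m * k = l - 1] (mod l)" by (rule cong_add_rcancel_nat)
    also have "\<dots> \<longleftrightarrow> [m * k = m * c] (mod l)" using mc by (metis cong_sym cong_trans)
    also have "\<dots> \<longleftrightarrow> [k = c] (mod l)" using ml(3) by (rule cong_mult_lcancel_nat)
    finally show ?thesis .
  qed
  have sum_eq: "(\<Sum>n | n \<in> {1..N} \<and> m dvd n \<and> l dvd n + 1. h ((T ^^ prime_Omega n) x))
      = (\<Sum>k | k \<in> {1..N div m} \<and> [k = c] (mod l). h ((T ^^ prime_Omega k) x'))" for N
  proof -
    have "{n. n \<in> {1..N} \<and> m dvd n \<and> l dvd n + 1} = (\<lambda>k. m * k) ` {k. k \<in> {1..N div m} \<and> [k = c] (mod l)}"
    proof (intro equalityI subsetI)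
      fix n assume n: "n \<in> {n. n \<in> {1..N} \<and> m dvd n \<and> l dvd n + 1}"
      then obtain k where k: "n = m * k" by (auto elim: dvdE)
      then show "n \<in> (\<lambda>k. m * k) ` {k. k \<in> {1..N div m} \<and> [k = c] (mod l)}"
        using n iff[of k] ml(1) by (intro image_eqI[of _ _ k]) (auto simp: less_eq_div_iff_mult_less_eq mult.commute Suc_le_eq)
    next
      fix n assume "n \<in> (\<lambda>k. m * k) ` {k. k \<in> {1..N div m} \<and> [k = c] (mod l)}"
      then obtain k where k: "n = m * k" "k \<in> {1..N div m}" "[k = c] (mod l)" by blast
      then show "n \<in> {n. n \<in> {1..N} \<and> m dvd n \<and> l dvd n + 1}"
        using iff[of k] ml(1) by (auto simp: less_eq_div_iff_mult_less_eq mult.commute Suc_le_eq)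
    qed
    then have "(\<Sum>n | n \<in> {1..N} \<and> m dvd n \<and> l dvd n + 1. h ((T ^^ prime_Omega n) x))
      = (\<Sum>k | k \<in> {1..N div m} \<and> [k = c] (mod l). h ((T ^^ prime_Omega (m * k)) x))"
      using ml(1) by (simp only:) (subst sum.reindex, auto intro!: inj_onI)
    also have "\<dots> = (\<Sum>k | k \<in> {1..N div m} \<and> [k = c] (mod l). h ((T ^^ prime_Omega k) x'))"
    proof (rule sum.cong[OF refl])
      fix k assume "k \<in> {k. k \<in> {1..N div m} \<and> [k = c] (mod l)}"
      then have "prime_Omega (m * k) = prime_Omega k + prime_Omega m" using ml(1) by (simp add: prime_Omega_mult)
      then show "h ((T ^^ prime_Omega (m * k)) x) = h ((T ^^ prime_Omega k) x')" by (simp add: x'_def funpow_add)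
    qed
    finally show ?thesis .
  qed
  have div_lim: "filterlim (\<lambda>N. N div m) at_top sequentially"
    unfolding filterlim_at_top
  proof
    fix Z show "\<forall>\<^sub>F N in sequentially. Z \<le> N div m"
      using eventually_ge_at_top[of "Z * m"] by eventually_elim (use ml(1) in \<open>simp add: less_eq_div_iff_mult_less_eq\<close>)
  qed
  have dens: "(\<lambda>N. real (N div m) / N) \<longlonglongrightarrow> 1 / m"
    using residue_class_density[OF ml(1), of 0] card_multiples[OF ml(1)] by (simp add: cong_0_iff)
  have "(\<lambda>N. (\<Sum>k | k \<in> {1..N div m} \<and> [k = c] (mod l). h ((T ^^ prime_Omega k) x')) / of_nat (N div m) * of_real (real (N div m) / N))
      \<longlonglongrightarrow> ((1 / of_nat l) * (\<integral>y. h y \<partial>\<nu>)) * of_real (1 / m)"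
    by (intro tendsto_mult tendsto_of_real dens filterlim_compose[OF Omega_equidistribution[OF ue x' h ml(2)] div_lim])
  moreover have "(\<Sum>k | k \<in> {1..N div m} \<and> [k = c] (mod l). h ((T ^^ prime_Omega k) x')) / of_nat (N div m) * of_real (real (N div m) / N)
      = (\<Sum>n | n \<in> {1..N} \<and> m dvd n \<and> l dvd n + 1. h ((T ^^ prime_Omega n) x)) / of_nat N" for N
    unfolding sum_eq by (cases "N div m = 0") auto
  ultimately show ?thesis by (simp add: mult_ac)
qed

text \<open>At most \<open>N / lcm d e\<close> of the \<open>n\<close> are divisible by both
  \<open>d\<close> and \<open>e\<close>, and since \<open>gcd d e\<close> is at most the square root
  of \<open>d * e\<close>, this is at most \<open>N\<close> times
  \<open>(d * e) powr - (1 / 2)\<close>. Combined with the decay of \<open>G\<close> it leaves the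
  summable \<open>d powr (- 1 - \<epsilon>)\<close>. Rounding only decreases the count, so there is
  no error term that would limit the range of \<open>d\<close>.\<close>

lemma divisor_second_moment:
  fixes G :: "nat \<Rightarrow> real" and N :: nat
  assumes G: "\<And>d. d \<ge> 1 \<Longrightarrow> 0 \<le> G d \<and> G d \<le> C * real d powr (- 1 / 2 - \<epsilon>)" and C: "C \<ge> 0" and \<epsilon>: "\<epsilon> > 0"
    and A: "A \<subseteq> {1..}"
  shows "(\<Sum>n=1..N. (\<Sum>d | d dvd n \<and> d \<in> A. G d)\<^sup>2) \<le> N * (C * (\<Sum>d. of_bool (d \<in> A) * real d powr (- 1 - \<epsilon>)))\<^sup>2"
proof -
  define B where "B = A \<inter> {1..N}"
  have B: "finite B" "\<And>d. d \<in> B \<Longrightarrow> d \<ge> 1" by (auto simp: B_def)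
  define g where "g d = C * real d powr (- 1 - \<epsilon>)" for d
  have inner: "(\<Sum>d | d dvd n \<and> d \<in> A. G d) = (\<Sum>d\<in>B. of_bool (d dvd n) * G d)" if "n \<in> {1..N}" for n
  proof (rule sum.mono_neutral_cong_left)
    show "{d. d dvd n \<and> d \<in> A} \<subseteq> B" using that A by (auto simp: B_def dest!: dvd_imp_le)
  qed (use B in \<open>auto simp: B_def\<close>)
  have cnt: "(\<Sum>n=1..N. of_bool (d dvd n) * of_bool (e dvd n)) * (G d * G e) \<le> real N * (g d * g e)"
    if de: "d \<in> B" "e \<in> B" for d e
  proof -
    have pos: "real d > 0" "real e > 0" using B(2)[OF de(1)] B(2)[OF de(2)] by auto
    have "(\<Sum>n=1..N. of_bool (d dvd n) * of_bool (e dvd n) :: real) = real (card {n\<in>{1..N}. lcm d e dvd n})"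
      by (simp add: Int_def conj_ac flip: of_bool_conj)
    also have "\<dots> = real (N div lcm d e)" using pos by (subst card_multiples) (auto intro: lcm_pos_nat)
    also have "\<dots> \<le> real N / real (lcm d e)" by (rule of_nat_div_le_of_nat)
    also have "\<dots> = N * (real (gcd d e) / (real d * real e))"
      using pos by (simp add: lcm_nat_def real_of_nat_div)
    also have "\<dots> \<le> N * (real d powr (1 / 2) * real e powr (1 / 2) / (real d * real e))"
    proof (intro mult_left_mono divide_right_mono)
      have "gcd d e * gcd d e \<le> d * e" using pos by (intro mult_mono gcd_le1_nat gcd_le2_nat) auto
      then have "(real (gcd d e))\<^sup>2 \<le> real d * real e" by (metis of_nat_le_iff of_nat_mult power2_eq_square)
      also have "\<dots> = (real d powr (1 / 2) * real e powr (1 / 2))\<^sup>2"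
        using pos by (simp add: power_mult_distrib powr_power)
      finally show "real (gcd d e) \<le> real d powr (1 / 2) * real e powr (1 / 2)" by (rule power2_le_imp_le) auto
    qed (use pos in auto)
    also have "\<dots> = N * (real d powr (- 1 / 2) * real e powr (- 1 / 2))"
    proof -
      have "real a powr (- 1 / 2) = real a powr (1 / 2) / real a" if "real a > 0" for a
        using that powr_diff[of "real a" "1 / 2" 1] by simp
      then show ?thesis using pos by simp
    qed
    finally have 1: "(\<Sum>n=1..N. of_bool (d dvd n) * of_bool (e dvd n)) \<le> N * (real d powr (- 1 / 2) * real e powr (- 1 / 2))" .
    have gG: "0 \<le> G a \<and> real a powr (- 1 / 2) * G a \<le> g a" if "a \<in> B" for a
    proof -
      have "real a powr (- 1 / 2) * G a \<le> real a powr (- 1 / 2) * (C * real a powr (- 1 / 2 - \<epsilon>))"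
        using G[OF B(2)[OF that]] by (intro mult_left_mono) auto
      also have "\<dots> = C * (real a powr (- 1 / 2) * real a powr (- 1 / 2 - \<epsilon>))" by simp
      also have "real a powr (- 1 / 2) * real a powr (- 1 / 2 - \<epsilon>) = real a powr (- 1 - \<epsilon>)"
        unfolding powr_add[symmetric] by (rule arg_cong) simp
      finally show ?thesis using G[OF B(2)[OF that]] by (simp add: g_def)
    qed
    have "(\<Sum>n=1..N. of_bool (d dvd n) * of_bool (e dvd n)) * (G d * G e)
        \<le> N * (real d powr (- 1 / 2) * real e powr (- 1 / 2)) * (G d * G e)"
      using 1 gG de by (intro mult_right_mono mult_nonneg_nonneg) auto
    also have "\<dots> = N * ((real d powr (- 1 / 2) * G d) * (real e powr (- 1 / 2) * G e))" by simp
    also have "\<dots> \<le> N * (g d * g e)"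
      using gG[OF de(1)] gG[OF de(2)] C by (intro mult_left_mono mult_mono) (auto simp: g_def)
    finally show ?thesis .
  qed
  have "(\<Sum>n=1..N. (\<Sum>d | d dvd n \<and> d \<in> A. G d)\<^sup>2) = (\<Sum>n=1..N. \<Sum>d\<in>B. \<Sum>e\<in>B. of_bool (d dvd n) * of_bool (e dvd n) * (G d * G e))"
    by (intro sum.cong refl) (simp add: inner power2_eq_square sum_product mult_ac)
  also have "\<dots> = (\<Sum>d\<in>B. \<Sum>e\<in>B. \<Sum>n=1..N. of_bool (d dvd n) * of_bool (e dvd n) * (G d * G e))"
    by (subst sum.swap, rule sum.cong[OF refl], rule sum.swap)
  also have "\<dots> \<le> (\<Sum>d\<in>B. \<Sum>e\<in>B. N * (g d * g e))"
    unfolding sum_distrib_right[symmetric] by (intro sum_mono cnt)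
  also have "\<dots> = N * (\<Sum>d\<in>B. g d)\<^sup>2"
    unfolding power2_eq_square sum_product by (simp only: sum_distrib_left)
  also have "\<dots> \<le> N * (C * (\<Sum>d. of_bool (d \<in> A) * real d powr (- 1 - \<epsilon>)))\<^sup>2"
  proof (intro mult_left_mono power_mono)
    have "(\<Sum>d\<in>B. real d powr (- 1 - \<epsilon>)) = (\<Sum>d\<in>B. of_bool (d \<in> A) * real d powr (- 1 - \<epsilon>))"
      by (intro sum.cong) (auto simp: B_def)
    also have "\<dots> \<le> (\<Sum>d. of_bool (d \<in> A) * real d powr (- 1 - \<epsilon>))"
    proof (rule sum_le_suminf)
      have "summable (\<lambda>d. real d powr (- 1 - \<epsilon>))" using \<epsilon> by (simp add: summable_real_powr_iff)
      then show "summable (\<lambda>d. of_bool (d \<in> A) * real d powr (- 1 - \<epsilon>))"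
        by (rule summable_comparison_test'[where N = 0]) auto
    qed (use B in auto)
    finally show "(\<Sum>d\<in>B. g d) \<le> C * (\<Sum>d. of_bool (d \<in> A) * real d powr (- 1 - \<epsilon>))"
      using C unfolding g_def sum_distrib_left[symmetric] by (intro mult_left_mono) auto
  qed (use C in \<open>auto simp: g_def intro!: sum_nonneg\<close>)
  finally show ?thesis .
qed

lemma truncated_shifted_mean:
  fixes h :: "'x::metric_space \<Rightarrow> complex" and g1 g2 :: "nat \<Rightarrow> complex"
  assumes ue: "uniquely_ergodic_system X \<nu> T" and x: "x \<in> X" and h: "continuous_on X h"
  shows "(\<lambda>N. (\<Sum>n=1..N. (\<Sum>m | m dvd n \<and> m \<in> {1..D}. g1 m) * (\<Sum>l | l dvd n + 1 \<and> l \<in> {1..D}. g2 l)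
        * h ((T ^^ prime_Omega n) x)) / of_nat N)
    \<longlonglongrightarrow> (\<Sum>(m, l)\<in>{(m, l)\<in>{1..D} \<times> {1..D}. coprime m l}. g1 m * g2 l / of_nat (m * l)) * (\<integral>y. h y \<partial>\<nu>)"
proof -
  define H where "H n = h ((T ^^ prime_Omega n) x)" for n
  define I where "I = (\<integral>y. h y \<partial>\<nu>)"
  define Q where "Q m l N = (\<Sum>n | n \<in> {1..N} \<and> m dvd n \<and> l dvd n + 1. H n) / of_nat N" for m l N
  have Q: "Q m l \<longlonglongrightarrow> (if coprime m l then 1 / of_nat (m * l) * I else 0)" if "m \<in> {1..D}" "l \<in> {1..D}" for m l
  proof (cases "coprime m l")
    case True
    then show ?thesis using Omega_equidistribution_shifted_multiples[OF ue x h, of m l] that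
      by (simp add: Q_def[abs_def] H_def I_def)
  next
    case False
    \<comment> \<open>A common divisor of \<open>m\<close> and \<open>l\<close> would divide both
      \<open>n\<close> and \<open>n + 1\<close>; this is the origin of the restriction to coprime
      pairs.\<close>
    have "{n. n \<in> {1..N} \<and> m dvd n \<and> l dvd n + 1} = {}" for N
    proof -
      have False if "m dvd n" "l dvd n + 1" for n
      proof -
        have "gcd m l dvd n" "gcd m l dvd n + 1" using that gcd_dvd1 gcd_dvd2 dvd_trans by blast+
        then have "gcd m l dvd 1" using dvd_add_right_iff by blast
        then have "coprime m l" by (simp only: coprime_iff_gcd_eq_1 nat_dvd_1_iff_1)
        with False show False ..
      qed
      then show ?thesis by blast
    qed
    then have "Q m l = (\<lambda>N. 0)" unfolding Q_def by (simp only: sum.empty div_0)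
    then show ?thesis using False by simp
  qed
  have trunc: "(\<Sum>m | m dvd n \<and> m \<in> {1..D}. g m) = (\<Sum>m=1..D. of_bool (m dvd n) * g m)" for g :: "nat \<Rightarrow> complex" and n
    by (rule sum.mono_neutral_cong_left) auto
  have eq: "(\<Sum>n=1..N. (\<Sum>m | m dvd n \<and> m \<in> {1..D}. g1 m) * (\<Sum>l | l dvd n + 1 \<and> l \<in> {1..D}. g2 l) * H n) / of_nat N
      = (\<Sum>m=1..D. \<Sum>l=1..D. g1 m * g2 l * Q m l N)" for N
  proof -
    have "(\<Sum>n=1..N. (\<Sum>m | m dvd n \<and> m \<in> {1..D}. g1 m) * (\<Sum>l | l dvd n + 1 \<and> l \<in> {1..D}. g2 l) * H n)
        = (\<Sum>n=1..N. \<Sum>m=1..D. \<Sum>l=1..D. g1 m * g2 l * (of_bool (m dvd n) * of_bool (l dvd n + 1) * H n))"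
      unfolding trunc unfolding sum_product unfolding sum_distrib_right by (intro sum.cong refl) (simp only: mult_ac)
    also have "\<dots> = (\<Sum>m=1..D. \<Sum>l=1..D. \<Sum>n=1..N. g1 m * g2 l * (of_bool (m dvd n) * of_bool (l dvd n + 1) * H n))"
      by (subst sum.swap, rule sum.cong[OF refl], rule sum.swap)
    also have "\<dots> = (\<Sum>m=1..D. \<Sum>l=1..D. g1 m * g2 l * (\<Sum>n | n \<in> {1..N} \<and> m dvd n \<and> l dvd n + 1. H n))"
    proof (intro sum.cong refl)
      fix m l
      have "(\<Sum>n=1..N. of_bool (m dvd n) * of_bool (l dvd n + 1) * H n) = (\<Sum>n | n \<in> {1..N} \<and> m dvd n \<and> l dvd n + 1. H n)"
        by (rule sum.mono_neutral_cong_right) auto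
      then show "(\<Sum>n=1..N. g1 m * g2 l * (of_bool (m dvd n) * of_bool (l dvd n + 1) * H n))
          = g1 m * g2 l * (\<Sum>n | n \<in> {1..N} \<and> m dvd n \<and> l dvd n + 1. H n)"
        by (simp only: sum_distrib_left[symmetric])
    qed
    finally show ?thesis
      unfolding Q_def times_divide_eq_right sum_divide_distrib[symmetric] by (rule arg_cong)
  qed
  have "(\<lambda>N. \<Sum>m=1..D. \<Sum>l=1..D. g1 m * g2 l * Q m l N)
      \<longlonglongrightarrow> (\<Sum>m=1..D. \<Sum>l=1..D. g1 m * g2 l * (if coprime m l then 1 / of_nat (m * l) * I else 0))"
    by (intro tendsto_sum tendsto_mult tendsto_const Q)
  moreover have "(\<Sum>m=1..D. \<Sum>l=1..D. g1 m * g2 l * (if coprime m l then 1 / of_nat (m * l) * I else 0))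
      = (\<Sum>(m, l)\<in>{(m, l)\<in>{1..D} \<times> {1..D}. coprime m l}. g1 m * g2 l / of_nat (m * l)) * I"
    unfolding sum.cartesian_product sum_distrib_right
    by (rule sum.mono_neutral_cong_right) (auto simp: split_def)
  ultimately show ?thesis unfolding H_def[symmetric] eq I_def[symmetric] by simp
qed

text \<open>The product majorant makes the family absolutely summable, and the square truncations
  eventually contain every finite set of pairs, so they converge to the unordered sum.\<close>

lemma coprime_pairs_sum:
  fixes f :: "nat \<times> nat \<Rightarrow> complex"
  assumes u: "summable u" "\<And>n. u n \<ge> 0"
    and f: "\<And>m l. m \<ge> 1 \<Longrightarrow> l \<ge> 1 \<Longrightarrow> cmod (f (m, l)) \<le> K * (u m * u l)" and K: "K \<ge> 0"
  shows "(\<lambda>D. \<Sum>x\<in>{(m, l)\<in>{1..D} \<times> {1..D}. coprime m l}. f x)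
    \<longlonglongrightarrow> (\<Sum>\<^sub>\<infinity>x\<in>{(m, l). m \<ge> 1 \<and> l \<ge> 1 \<and> coprime m l}. f x)"
proof -
  define P where "P = {(m :: nat, l :: nat). m \<ge> 1 \<and> l \<ge> 1 \<and> coprime m l}"
  define PD where "PD D = {(m, l)\<in>{1..D} \<times> {1..D :: nat}. coprime m l}" for D
  have "(\<lambda>x. norm (f x)) summable_on P"
  proof (rule nonneg_bdd_above_summable_on)
    show "bdd_above (sum (\<lambda>x. norm (f x)) ` {F. F \<subseteq> P \<and> finite F})"
    proof (rule bdd_aboveI2)
      fix F assume F: "F \<in> {F. F \<subseteq> P \<and> finite F}"
      have "(\<Sum>x\<in>F. norm (f x)) \<le> (\<Sum>x\<in>F. K * (u (fst x) * u (snd x)))"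
        using F f by (intro sum_mono) (auto simp: P_def)
      also have "\<dots> \<le> (\<Sum>x\<in>fst ` F \<times> snd ` F. K * (u (fst x) * u (snd x)))"
        using F u K by (intro sum_mono2) (auto intro: rev_image_eqI)
      also have "\<dots> = K * ((\<Sum>m\<in>fst ` F. u m) * (\<Sum>l\<in>snd ` F. u l))"
        unfolding sum_product unfolding sum.cartesian_product split_def sum_distrib_left ..
      also have "\<dots> \<le> K * (suminf u * suminf u)"
        using F u K by (intro mult_left_mono mult_mono sum_le_suminf sum_nonneg suminf_nonneg) auto
      finally show "(\<Sum>x\<in>F. norm (f x)) \<le> K * (suminf u * suminf u)" .
    qed
  qed auto
  then have "f summable_on P" by (rule abs_summable_summable)
  then have "(f has_sum infsum f P) P" by (rule has_sum_infsum)
  then have lim: "(sum f \<longlongrightarrow> infsum f P) (finite_subsets_at_top P)" by (simp add: has_sum_def)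
  have "filterlim PD (finite_subsets_at_top P) sequentially"
    unfolding filterlim_finite_subsets_at_top
  proof (intro allI impI)
    fix F assume F: "finite F \<and> F \<subseteq> P"
    define D0 where "D0 = Max (insert 0 (fst ` F \<union> snd ` F))"
    have le: "fst x \<le> D0" "snd x \<le> D0" if "x \<in> F" for x
      unfolding D0_def using F that by (auto intro!: Max_ge)
    have "finite (PD D) \<and> F \<subseteq> PD D \<and> PD D \<subseteq> P" if "D \<ge> D0" for D
    proof (intro conjI)
      show "finite (PD D)" by (rule finite_subset[of _ "{1..D} \<times> {1..D}"]) (auto simp: PD_def)
      show "F \<subseteq> PD D"
      proof
        fix x assume x: "x \<in> F"
        then have "x \<in> P" using F by auto
        then show "x \<in> PD D" using le[OF x] that by (auto simp: P_def PD_def)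
      qed
    qed (auto simp: P_def PD_def)
    then show "\<forall>\<^sub>F D in sequentially. finite (PD D) \<and> F \<subseteq> PD D \<and> PD D \<subseteq> P"
      unfolding eventually_sequentially by blast
  qed
  from filterlim_compose[OF lim this] show ?thesis by (simp add: P_def PD_def)
qed

theorem theorem6p1:
  fixes a1 g1 a2 g2 :: "nat \<Rightarrow> complex" and \<epsilon> :: real
    and X :: "'x::metric_space set" and \<nu> :: "'x measure" and T :: "'x \<Rightarrow> 'x"
    and h :: "'x \<Rightarrow> complex" and x :: 'x
  assumes "\<epsilon> > 0"
    and "\<exists>C>0. \<forall>d\<ge>1. cmod (g1 d) \<le> C * real d powr (- 1/2 - \<epsilon>)"
    and "\<exists>C>0. \<forall>d\<ge>1. cmod (g2 d) \<le> C * real d powr (- 1/2 - \<epsilon>)"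
    and "\<forall>n\<ge>1. a1 n = (\<Sum>d | d dvd n. g1 d)"
    and "\<forall>n\<ge>1. a2 n = (\<Sum>d | d dvd n. g2 d)"
    and "uniquely_ergodic_system X \<nu> T"
    and "continuous_on X h"
    and "x \<in> X"
  shows "(\<lambda>N. (1 / of_nat N) * (\<Sum>n = 1..N. a1 n * a2 (n + 1) * h ((T ^^ prime_Omega n) x)))
    \<longlonglongrightarrow> (\<Sum>\<^sub>\<infinity>(m, l)\<in>{(m, l). m \<ge> 1 \<and> l \<ge> 1 \<and> coprime m l}.
               g1 m * g2 l / of_nat (m * l)) * (\<integral>y. h y \<partial>\<nu>)"
proof -
  note \<epsilon> = assms(1) and ue = assms(6) and h = assms(7) and x = assms(8)
  obtain C1 where C1: "C1 > 0" "\<And>d. d \<ge> 1 \<Longrightarrow> cmod (g1 d) \<le> C1 * real d powr (- 1/2 - \<epsilon>)" using assms(2) by blast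
  obtain C2 where C2: "C2 > 0" "\<And>d. d \<ge> 1 \<Longrightarrow> cmod (g2 d) \<le> C2 * real d powr (- 1/2 - \<epsilon>)" using assms(3) by blast
  define H where "H n = h ((T ^^ prime_Omega n) x)" for n
  obtain B where B: "\<And>n. cmod (H n) \<le> B" "B > 0"
  proof -
    have X: "compact X" "T ` X \<subseteq> X" using ue by (auto simp: uniquely_ergodic_system_def)
    obtain B0 where B0: "\<And>x. x \<in> X \<Longrightarrow> cmod (h x) \<le> B0"
      using compact_imp_bounded[OF compact_continuous_image[OF h X(1)]] by (auto simp: bounded_iff)
    have "(T ^^ k) x \<in> X" for k using x X(2) by (induction k) auto
    then have "cmod (H n) \<le> B0" for n unfolding H_def by (intro B0)
    then show thesis using that[of "max B0 1"] by (simp add: le_max_iff_disj)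
  qed
  define u where "u d = real d powr (- 1 - \<epsilon>)" for d :: nat
  have su: "summable u" unfolding u_def using \<epsilon> by (simp add: summable_real_powr_iff)
  define tail where "tail D = (\<Sum>d. of_bool (d \<in> {D<..}) * u d)" for D :: nat
  have tail_nonneg: "tail D \<ge> 0" for D
    unfolding tail_def by (intro suminf_nonneg summable_comparison_test'[OF su, of 0]) (auto simp: u_def)
  have tail_0: "tail \<longlonglongrightarrow> 0"
  proof -
    have "tail D = (\<Sum>n. u (n + Suc D))" for D
    proof -
      have "(\<lambda>n. u (n + Suc D)) sums (\<Sum>n. u (n + Suc D))"
        using summable_ignore_initial_segment[OF su] by (rule summable_sums)
      then have "(\<lambda>n. of_bool (n + Suc D \<in> {D<..}) * u (n + Suc D)) sums (\<Sum>n. u (n + Suc D))" by simp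
      then have "(\<lambda>d. of_bool (d \<in> {D<..}) * u d) sums (\<Sum>n. u (n + Suc D))"
        by (subst (asm) sums_zero_iff_shift) auto
      then show ?thesis unfolding tail_def by (rule sums_unique[symmetric])
    qed
    then have "tail = (\<lambda>D. \<Sum>n. u (n + Suc D))" by (rule ext)
    then show ?thesis using LIMSEQ_Suc[OF suminf_exist_split2[OF su]] by (simp only:)
  qed
  \<comment> \<open>The part of the absolute divisor sum beyond \<open>D\<close>. At
    \<open>D = 0\<close> it is the full sum and majorises the divisor sums of \<open>g\<close> and
    all their truncations.\<close>
  define R where "R g D n = (\<Sum>d | d dvd n \<and> d \<in> {D<..}. cmod (g d))" for g :: "nat \<Rightarrow> complex" and D n :: nat
  have R_nonneg: "R g D n \<ge> 0" for g D n unfolding R_def by (intro sum_nonneg) auto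
  define b where "b g D n = (\<Sum>d | d dvd n \<and> d \<in> {1..D}. g d)" for g :: "nat \<Rightarrow> complex" and D n :: nat
  have fin_dvd: "finite {d. d dvd n \<and> Q d}" if "n \<ge> 1" for n and Q :: "nat \<Rightarrow> bool"
    using finite_divisors_nat[of n] that by (rule_tac finite_subset[of _ "{d. d dvd n}"]) auto
  have pos_dvd: "{d. d dvd n} = {d. d dvd n \<and> d \<in> {0<..}}" if "n \<ge> 1" for n :: nat
    using that by (auto intro: Nat.gr0I)
  have full: "cmod (\<Sum>d | d dvd n. g d) \<le> R g 0 n" if n: "n \<ge> 1" for g n
    unfolding R_def pos_dvd[OF n] by (rule norm_sum)
  have trunc: "cmod (b g D n) \<le> R g 0 n" if n: "n \<ge> 1" for g D n
  proof -
    have "cmod (b g D n) \<le> (\<Sum>d | d dvd n \<and> d \<in> {1..D}. cmod (g d))" unfolding b_def by (rule norm_sum)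
    also have "\<dots> \<le> R g 0 n" unfolding R_def using fin_dvd[OF n] by (intro sum_mono2) auto
    finally show ?thesis .
  qed
  have diff: "cmod ((\<Sum>d | d dvd n. g d) - b g D n) \<le> R g D n" if n: "n \<ge> 1" for g D n
  proof -
    have split: "{d. d dvd n} = {d. d dvd n \<and> d \<in> {1..D}} \<union> {d. d dvd n \<and> d \<in> {D<..}}"
      using n by (auto simp: Suc_le_eq intro: Nat.gr0I)
    have "(\<Sum>d | d dvd n. g d) = b g D n + (\<Sum>d | d dvd n \<and> d \<in> {D<..}. g d)"
      unfolding b_def split by (intro sum.union_disjoint fin_dvd[OF n]) auto
    then show ?thesis unfolding R_def using norm_sum[of g "{d. d dvd n \<and> d \<in> {D<..}}"] by simp
  qed
  have moment: "(\<Sum>n=1..N. (R g D n)\<^sup>2) \<le> N * (C * tail D)\<^sup>2"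
    if "C > 0" "\<And>d. d \<ge> 1 \<Longrightarrow> cmod (g d) \<le> C * real d powr (- 1/2 - \<epsilon>)" for g C D N
    unfolding R_def tail_def u_def using that \<epsilon> by (intro divisor_second_moment) auto
  \<comment> \<open>Cauchy-Schwarz with the second moments at \<open>n\<close> and at
    \<open>n + 1\<close>. The shift costs \<open>N + 1\<close> in place of \<open>N\<close>, which
    the factor 2 covers.\<close>
  have cross: "(\<Sum>n=1..N. R g1 D n * R g2 D' (n + 1)) \<le> 2 * real N * (C1 * tail D) * (C2 * tail D')" for D D' N
  proof -
    have "(\<Sum>n=1..N. (R g2 D' (n + 1))\<^sup>2) = (\<Sum>n=Suc 1..Suc N. (R g2 D' n)\<^sup>2)"
      using sum.shift_bounds_cl_Suc_ivl[of "\<lambda>n. (R g2 D' n)\<^sup>2" 1 N] by simp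
    also have "\<dots> \<le> (\<Sum>n=1..Suc N. (R g2 D' n)\<^sup>2)" by (intro sum_mono2) auto
    also have "\<dots> \<le> Suc N * (C2 * tail D')\<^sup>2" by (rule moment[OF C2])
    finally have m2: "(\<Sum>n=1..N. (R g2 D' (n + 1))\<^sup>2) \<le> Suc N * (C2 * tail D')\<^sup>2" .
    have "(\<Sum>n=1..N. R g1 D n * R g2 D' (n + 1))\<^sup>2 \<le> (\<Sum>n=1..N. (R g1 D n)\<^sup>2) * (\<Sum>n=1..N. (R g2 D' (n + 1))\<^sup>2)"
      by (rule Cauchy_Schwarz_ineq_sum)
    also have "\<dots> \<le> (N * (C1 * tail D)\<^sup>2) * (Suc N * (C2 * tail D')\<^sup>2)"
      by (intro mult_mono moment C1 m2 sum_nonneg) auto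
    also have "\<dots> = (real N * real (Suc N)) * ((C1 * tail D) * (C2 * tail D'))\<^sup>2"
      by (simp add: power_mult_distrib mult_ac)
    also have "\<dots> \<le> (2 * real N)\<^sup>2 * ((C1 * tail D) * (C2 * tail D'))\<^sup>2"
    proof (rule mult_right_mono)
      have "real N * real (Suc N) \<le> real N * (4 * real N)" by (cases "N = 0") (auto intro!: mult_left_mono)
      then show "real N * real (Suc N) \<le> (2 * real N)\<^sup>2" by (simp add: power2_eq_square)
    qed auto
    also have "\<dots> = (2 * real N * (C1 * tail D) * (C2 * tail D'))\<^sup>2" by (simp add: power_mult_distrib mult_ac)
    finally show ?thesis
      by (rule power2_le_imp_le) (use C1 C2 tail_nonneg in \<open>auto intro!: mult_nonneg_nonneg\<close>)
  qed
  define s where "s N = (\<Sum>n=1..N. a1 n * a2 (n + 1) * H n) / of_nat N" for N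
  define t where "t D N = (\<Sum>n=1..N. b g1 D n * b g2 D (n + 1) * H n) / of_nat N" for D N
  \<comment> \<open>A difference of products splits into two terms, each with one remainder beyond
    \<open>D\<close> and one full sum. \<open>cross\<close> gives a factor 2 for each, hence the 4,
    and the bound is independent of \<open>N\<close>.\<close>
  define err where "err D = B * (4 * (C1 * C2 * tail 0)) * tail D" for D
  have approx: "cmod (s N - t D N) \<le> err D" for N D
  proof (cases "N = 0")
    case False
    have termwise: "cmod (a1 n * a2 (n + 1) * H n - b g1 D n * b g2 D (n + 1) * H n)
        \<le> (R g1 D n * R g2 0 (n + 1) + R g1 0 n * R g2 D (n + 1)) * B" if n: "n \<in> {1..N}" for n
    proof -
      have n1: "n \<ge> 1" "n + 1 \<ge> 1" using n by auto
      have a: "a1 n = (\<Sum>d | d dvd n. g1 d)" "a2 (n + 1) = (\<Sum>d | d dvd n + 1. g2 d)" using assms(4,5) n1 by blast+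
      have "a1 n * a2 (n + 1) - b g1 D n * b g2 D (n + 1)
          = (a1 n - b g1 D n) * a2 (n + 1) + b g1 D n * (a2 (n + 1) - b g2 D (n + 1))" by (simp add: algebra_simps)
      then have "cmod (a1 n * a2 (n + 1) - b g1 D n * b g2 D (n + 1))
          \<le> cmod (a1 n - b g1 D n) * cmod (a2 (n + 1)) + cmod (b g1 D n) * cmod (a2 (n + 1) - b g2 D (n + 1))"
        by (metis norm_mult norm_triangle_ineq)
      also have "\<dots> \<le> R g1 D n * R g2 0 (n + 1) + R g1 0 n * R g2 D (n + 1)"
        unfolding a using n1 by (intro add_mono mult_mono diff full trunc R_nonneg norm_ge_zero)
      finally have "cmod (a1 n * a2 (n + 1) - b g1 D n * b g2 D (n + 1)) * cmod (H n)
          \<le> (R g1 D n * R g2 0 (n + 1) + R g1 0 n * R g2 D (n + 1)) * B"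
        using B by (intro mult_mono add_nonneg_nonneg mult_nonneg_nonneg R_nonneg) auto
      then show ?thesis by (simp flip: norm_mult left_diff_distrib)
    qed
    have "s N - t D N = (\<Sum>n=1..N. a1 n * a2 (n + 1) * H n - b g1 D n * b g2 D (n + 1) * H n) / of_nat N"
      by (simp add: s_def t_def sum_subtractf diff_divide_distrib)
    then have "cmod (s N - t D N) \<le> (\<Sum>n=1..N. (R g1 D n * R g2 0 (n + 1) + R g1 0 n * R g2 D (n + 1)) * B) / N"
      using sum_norm_le[OF termwise, of "{1..N}"] by (simp add: norm_divide divide_right_mono)
    also have "\<dots> = B * ((\<Sum>n=1..N. R g1 D n * R g2 0 (n + 1)) + (\<Sum>n=1..N. R g1 0 n * R g2 D (n + 1))) / N"
      by (simp only: sum.distrib mult.commute[of _ B] sum_distrib_left[symmetric])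
    also have "\<dots> \<le> B * (2 * real N * (C1 * tail D) * (C2 * tail 0) + 2 * real N * (C1 * tail 0) * (C2 * tail D)) / N"
      using B by (intro divide_right_mono mult_left_mono add_mono cross) auto
    also have "\<dots> = err D" using False by (simp add: err_def field_simps)
    finally show ?thesis .
  qed (use B C1 C2 tail_nonneg in \<open>auto simp: s_def t_def err_def intro!: mult_nonneg_nonneg\<close>)
  define I where "I = (\<integral>y. h y \<partial>\<nu>)"
  define f where "f = (\<lambda>(m, l). g1 m * g2 l / of_nat (m * l))"
  define V where "V D = (\<Sum>x\<in>{(m, l)\<in>{1..D} \<times> {1..D}. coprime m l}. f x) * I" for D
  define L where "L = (\<Sum>\<^sub>\<infinity>x\<in>{(m, l). m \<ge> 1 \<and> l \<ge> 1 \<and> coprime m l}. f x) * I"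
  have tV: "t D \<longlonglongrightarrow> V D" for D
    using truncated_shifted_mean[OF ue x h, of g1 D g2] unfolding t_def[abs_def] V_def b_def H_def I_def f_def .
  have VL: "V \<longlonglongrightarrow> L"
    unfolding V_def[abs_def] L_def
  proof (intro tendsto_mult_right coprime_pairs_sum[OF su])
    have one: "cmod (g d) / d \<le> C * u d" if "C > 0" "d \<ge> 1" "cmod (g d) \<le> C * real d powr (- 1/2 - \<epsilon>)" for C g d
    proof -
      have "cmod (g d) / d \<le> C * real d powr (- 1/2 - \<epsilon>) / d" using that by (intro divide_right_mono) auto
      also have "\<dots> \<le> C * u d"
      proof -
        have "real d powr (- 1/2 - \<epsilon>) \<le> real d powr (- \<epsilon>)" using that by (intro powr_mono) auto
        also have "\<dots> = real d * u d" using that by (simp add: u_def powr_mult_base)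
        finally have "real d powr (- 1/2 - \<epsilon>) / d \<le> u d" using that by (simp add: field_simps)
        then have "C * (real d powr (- 1/2 - \<epsilon>) / d) \<le> C * u d" using that by (intro mult_left_mono) auto
        then show ?thesis by simp
      qed
      finally show ?thesis .
    qed
    fix m l :: nat assume ml: "m \<ge> 1" "l \<ge> 1"
    have "cmod (f (m, l)) = (cmod (g1 m) / m) * (cmod (g2 l) / l)" by (simp add: f_def norm_mult norm_divide)
    also have "\<dots> \<le> (C1 * u m) * (C2 * u l)"
      using one[where g = g1, OF C1(1) ml(1) C1(2)[OF ml(1)]] one[where g = g2, OF C2(1) ml(2) C2(2)[OF ml(2)]] C1(1)
      by (intro mult_mono) (auto simp: u_def)
    finally show "cmod (f (m, l)) \<le> C1 * C2 * (u m * u l)" by (simp add: mult_ac)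
  qed (use C1 C2 in \<open>auto simp: u_def\<close>)
  have err_0: "err \<longlonglongrightarrow> 0" unfolding err_def[abs_def] using tendsto_mult_left[OF tail_0] by simp
  have "s \<longlonglongrightarrow> L"
  proof (rule LIMSEQ_I)
    \<comment> \<open>Because \<open>err\<close> is uniform in \<open>N\<close>, \<open>D\<close>
      can be fixed before \<open>N\<close> tends to infinity.\<close>
    fix e :: real assume e: "e > 0"
    have "\<forall>\<^sub>F D in sequentially. err D < e / 3 \<and> dist (V D) L < e / 3"
      using order_tendstoD(2)[OF err_0, of "e / 3"] tendstoD[OF VL, of "e / 3"] e by (intro eventually_conj) auto
    then obtain D where D: "err D < e / 3" "dist (V D) L < e / 3"
      using eventually_happens trivial_limit_sequentially by blast
    have "\<forall>\<^sub>F N in sequentially. dist (t D N) (V D) < e / 3" using tendstoD[OF tV, of "e / 3"] e by auto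
    then obtain N0 where N0: "\<And>N. N \<ge> N0 \<Longrightarrow> dist (t D N) (V D) < e / 3" by (auto simp: eventually_sequentially)
    have "norm (s N - L) < e" if "N \<ge> N0" for N
    proof -
      have "s N - L = (s N - t D N) + ((t D N - V D) + (V D - L))" by simp
      then have "norm (s N - L) \<le> norm (s N - t D N) + (norm (t D N - V D) + norm (V D - L))"
        by (metis add_left_mono norm_triangle_ineq order_trans)
      then show ?thesis using approx[of N D] D N0[OF that] unfolding dist_norm by linarith
    qed
    then show "\<exists>N0. \<forall>N\<ge>N0. norm (s N - L) < e" by blast
  qed
  then show ?thesis
    unfolding s_def[abs_def] L_def f_def I_def H_def by simp
qed

end
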